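(* Let $p$ be a prime and let $\kappa\in\overline{\mathbb Q}\setminus\mu_\infty$, where $\overline{\mathbb Q}\subseteq\overline{\mathbb Q_p}$, be such that $|\kappa|_p=1$. Let $d=[\mathbb Q(\kappa):\mathbb Q]$. Then there exists a strict sequence $(\alpha_n)_{n\in\mathbb N}$ of algebraic numbers such that no $\alpha_n$ is a conjugate of $\kappa$, $\lim_{n\to\infty}h(\alpha_n)=0$, $$\limsup_{n\to\infty}\frac{1}{[\mathbb Q(\alpha_n):\mathbb Q]}\sum_{\sigma:\mathbb Q(\alpha_n)\to\overline{\mathbb Q_p}}\log|\sigma(\alpha_n)-\kappa|_p\le -h(\kappa)<0,$$ and $$\liminf_{n\to\infty}\frac{1}{[\mathbb Q(\alpha_n):\mathbb Q]}\sum_{\sigma:\mathbb Q(\alpha_n)\to\overline{\mathbb Q_p}}\log|\sigma(\alpha_n)-\kappa|_p\ge -d\,(h(\kappa)+\log 2).$$ Here the sums run over all field embeddings $\sigma:\mathbb Q(\alpha_n)\to\overline{\mathbb Q_p}$.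
   Context: $\overline{\mathbb Q_p}$ is an algebraic closure of $\mathbb Q_p$, $|\cdot|_p$ is the unique extension to $\overline{\mathbb Q_p}$ of the $p$-adic absolute value normalized by $|p|_p=1/p$, $\overline{\mathbb Q}$ is the algebraic closure of $\mathbb Q$ in $\overline{\mathbb Q_p}$, and $\mu_\infty\subseteq\overline{\mathbb Q}$ is the set of all roots of unity. For $P\in\mathbb Z[X]\setminus\{0\}$ let $m(P)=\int_0^1\log|P(e^{2\pi i t})|\,dt$ (complex absolute value). For an algebraic number $\alpha$, its $\mathbb Z$-minimal polynomial is the unique irreducible $P=a_DX^D+\dots+a_0\in\mathbb Z[X]$ with $P(\alpha)=0$ and $a_D\ge1$; the absolute logarithmic Weil height is $h(\alpha)=m(P)/D$. A sequence $(\alpha_n)_{n\in\mathbb N}$ of algebraic numbers is called strict if for every $\alpha\in\overline{\mathbb Q}$ there are at most finitely many $n$ with $\alpha_n=\alpha$. Two algebraic numbers are conjugate if they have the same minimal polynomial over $\mathbb Q$. *)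

theory Defs
  imports
    "HOL-Analysis.Analysis"
    "HOL-Computational_Algebra.Computational_Algebra"
begin

section \<open>The $p$-adic numbers and their algebraic closure\<close>

definition padic_abs :: "nat \<Rightarrow> rat \<Rightarrow> real" where
  "padic_abs p q =
     (if q = 0 then 0
      else real p powi (int (multiplicity (int p) (snd (quotient_of q)))
                        - int (multiplicity (int p) (fst (quotient_of q)))))"

definition absolute_value :: "('a :: field \<Rightarrow> real) \<Rightarrow> bool" where
  "absolute_value v \<longleftrightarrow>
     (\<forall>x. 0 \<le> v x) \<and> (\<forall>x. v x = 0 \<longleftrightarrow> x = 0) \<and>
     (\<forall>x y. v (x * y) = v x * v y) \<and> (\<forall>x y. v (x + y) \<le> v x + v y)"

definition is_subfield :: "'a :: field set \<Rightarrow> bool" where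
  "is_subfield F \<longleftrightarrow>
     0 \<in> F \<and> 1 \<in> F \<and>
     (\<forall>x\<in>F. \<forall>y\<in>F. x + y \<in> F \<and> x - y \<in> F \<and> x * y \<in> F) \<and> (\<forall>x\<in>F. inverse x \<in> F)"

text \<open>
  A type cannot depend on the prime \<open>p\<close>, so an algebraic closure of the \<open>p\<close>-adic field is
  described by its defining data: an algebraically closed field \<open>'a\<close>, an absolute value \<open>v\<close> on it
  that extends the \<open>p\<close>-adic one of the rationals, and a subfield \<open>Qp\<close> that is the completion of
  the rationals (complete, and containing the rationals as a dense subset) and over which every
  element of \<open>'a\<close> is algebraic. For a prime \<open>p\<close> these data exist and are unique up to isomorphism.
\<close>

locale padic_closure =
  fixes p :: nat
    and Qp :: "'a :: {alg_closed_field, field_char_0} set"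
    and v :: "'a \<Rightarrow> real"
  assumes absolute_value: "absolute_value v"
    and extends_padic_abs: "v (of_rat q) = padic_abs p q"
    and subfield_Qp: "is_subfield Qp"
    and complete_Qp: "Metric_space.mcomplete Qp (\<lambda>x y. v (x - y))"
    and Rats_dense_in_Qp:
      "(Metric_space.mtopology Qp (\<lambda>x y. v (x - y))) closure_of \<rat> = Qp"
    and algebraic_over_Qp:
      "\<exists>P :: 'a poly. P \<noteq> 0 \<and> (\<forall>i. coeff P i \<in> Qp) \<and> poly P x = 0"


section \<open>Number fields and embeddings\<close>

definition rat_adjoin :: "'a :: field_char_0 \<Rightarrow> 'a set" where
  "rat_adjoin \<alpha> = \<Inter>{F. is_subfield F \<and> \<alpha> \<in> F}"

abbreviation rat_scale :: "rat \<Rightarrow> 'a :: field_char_0 \<Rightarrow> 'a" where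
  "rat_scale q x \<equiv> of_rat q * x"

lemma vector_space_rat_scale: "vector_space (rat_scale :: rat \<Rightarrow> 'a :: field_char_0 \<Rightarrow> 'a)"
  by unfold_locales (simp_all add: algebra_simps of_rat_add of_rat_mult)

definition rat_degree :: "'a :: field_char_0 set \<Rightarrow> nat" where
  "rat_degree F = vector_space.dim rat_scale F"

text \<open>
  Embeddings are required to be extensional, so that embeddings that agree on \<open>F\<close> are equal.
\<close>

definition embeddings :: "'a :: field_char_0 set \<Rightarrow> ('a \<Rightarrow> 'a) set" where
  "embeddings F =
     {\<sigma> \<in> F \<rightarrow>\<^sub>E UNIV. \<sigma> 1 = 1 \<and>
        (\<forall>x\<in>F. \<forall>y\<in>F. \<sigma> (x + y) = \<sigma> x + \<sigma> y \<and> \<sigma> (x * y) = \<sigma> x * \<sigma> y)}"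


section \<open>Algebraic numbers and the Weil height\<close>

definition roots_of_unity :: "'a :: field_char_0 set" where
  "roots_of_unity = {x. \<exists>n>0. x ^ n = 1}"

definition rat_minpoly :: "'a :: field_char_0 \<Rightarrow> rat poly" where
  "rat_minpoly \<alpha> =
     (THE P. irreducible P \<and> lead_coeff P = 1 \<and> poly (map_poly of_rat P) \<alpha> = 0)"

definition conjugates :: "'a :: field_char_0 \<Rightarrow> 'a \<Rightarrow> bool" where
  "conjugates \<alpha> \<beta> \<longleftrightarrow> algebraic \<alpha> \<and> algebraic \<beta> \<and> rat_minpoly \<alpha> = rat_minpoly \<beta>"

text \<open>
  Irreducibility in the ring of integer polynomials includes primitivity.
\<close>

definition int_minpoly :: "'a :: field_char_0 \<Rightarrow> int poly" where
  "int_minpoly \<alpha> =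
     (THE P. irreducible P \<and> lead_coeff P \<ge> 1 \<and> poly (map_poly of_int P) \<alpha> = 0)"

text \<open>
  The integrand is \<open>ln 0 = 0\<close> instead of minus infinity at the finitely many zeros on the unit
  circle, which does not change the integral.
\<close>

definition log_mahler_measure :: "int poly \<Rightarrow> real" where
  "log_mahler_measure P =
     (LINT t:{0..1}|lborel.
        ln (cmod (poly (map_poly of_int P) (exp (2 * of_real pi * \<i> * of_real t)))))"

definition weil_height :: "'a :: field_char_0 \<Rightarrow> real" where
  "weil_height \<alpha> = log_mahler_measure (int_minpoly \<alpha>) / real (degree (int_minpoly \<alpha>))"

definition strict_sequence :: "(nat \<Rightarrow> 'a :: field_char_0) \<Rightarrow> bool" where
  "strict_sequence \<alpha> \<longleftrightarrow> (\<forall>\<beta>. algebraic \<beta> \<longrightarrow> finite {n. \<alpha> n = \<beta>})"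

text \<open>
  The logarithm is real, hence meaningful only if no embedding maps \<open>\<alpha>\<close> to \<open>\<kappa>\<close>, that is, if
  \<open>\<alpha>\<close> is not a conjugate of \<open>\<kappa>\<close>.
\<close>

definition mean_log_dist :: "('a :: field_char_0 \<Rightarrow> real) \<Rightarrow> 'a \<Rightarrow> 'a \<Rightarrow> real" where
  "mean_log_dist v \<kappa> \<alpha> =
     1 / real (rat_degree (rat_adjoin \<alpha>)) *
       (\<Sum>\<sigma>\<in>embeddings (rat_adjoin \<alpha>). ln (v (\<sigma> \<alpha> - \<kappa>)))"

end

theory Submission
  imports Defs "Berlekamp_Zassenhaus.Factor_Bound"
begin

text \<open>
  Let \<open>P\<close> be the minimal polynomial of \<open>\<kappa>\<close> over the integers, \<open>d\<close> its degree, \<open>M(P)\<close> its Mahler measure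
  and \<open>h = ln M(P) / d\<close> the height of \<open>\<kappa>\<close>. Everything is a statement about irreducible integer
  polynomials \<open>F\<close> that are not multiples of \<open>P\<close>: if \<open>\<alpha>\<close> is a root of \<open>F\<close> and \<open>n\<close> is the degree of \<open>F\<close>,
  then the mean of the numbers \<open>ln |\<sigma>(\<alpha>) - \<kappa>|\<close> is \<open>ln |F(\<kappa>)| / n\<close> up to a term from the leading
  coefficient (\<open>mean_log_dist_eq\<close>), which is negligible when the height of \<open>\<alpha>\<close> is small. What is needed
  are polynomials \<open>F\<close> of large degree \<open>n\<close> such that \<open>ln M(F)\<close> is small compared with \<open>n\<close> and \<open>|F(\<kappa>)|\<close>
  is at most about \<open>exp (- h n)\<close>. That Mahler measures can be computed from roots is Jensen's formula
  (\<open>log_mahler_measure_eq\<close>), and \<open>h > 0\<close> is Kronecker's theorem (\<open>kronecker_root_of_unity\<close>).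

  The lower bound holds for every such \<open>F\<close> and is Liouville's inequality (\<open>v_int_poly_ge\<close>): the
  resultant of \<open>P\<close> and \<open>F\<close> is a nonzero integer in the ideal of \<open>P\<close> and \<open>F\<close>, so \<open>|F(\<kappa>)|\<close> is at least
  its \<open>p\<close>-adic absolute value, while its size is at most \<open>2 ^ (n d) M(P) ^ n M(F) ^ d\<close>.

  The upper bound comes from the pigeonhole principle. Modulo \<open>P\<close> and \<open>p ^ k\<close> the integer polynomials
  of degree less than \<open>N\<close> fall into \<open>p ^ (k d)\<close> classes. Hence more than \<open>p ^ (k d)\<close> polynomials with
  small coefficients that are pairwise incongruent modulo \<open>P\<close> yield a difference \<open>Q\<close>, not a multiple of
  \<open>P\<close>, with \<open>|Q(\<kappa>)| \<le> p ^ (- k)\<close> (\<open>ex_small_value\<close>). To reach \<open>exp (- h N)\<close> one needs about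
  \<open>M(P) ^ N\<close> such polynomials, with coefficients that do not grow exponentially
  (\<open>digit_rate_irreducible\<close>). They are digit expansions. If one coefficient of \<open>P\<close> outweighs the others,
  then sums with digits below half of it are pairwise incongruent. In general, \<open>P\<close> is replaced by its
  iterated Graeffe transforms, whose roots are the powers of the roots of \<open>P\<close> with exponent \<open>m = 2 ^ k\<close>:
  among their coefficients one of size about \<open>M(P) ^ m\<close> eventually dominates
  (\<open>large_coeff_of_graeffe_multiple\<close>), and digits modulo the transform become digits modulo \<open>P\<close> on
  substituting \<open>X\<^sup>2\<close> for \<open>X\<close>. The only obstruction, a transform that is itself a polynomial in \<open>X\<^sup>2\<close>, lowers
  the degree and is removed by induction.

  It remains to pass from \<open>Q\<close> to an irreducible factor. Adding a small multiple of \<open>P\<close> to \<open>Q\<close> does not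
  change \<open>Q(\<kappa>)\<close> and avoids any given finite set of factors, in particular all those of small degree and
  small measure. Since degree, \<open>ln M\<close> and \<open>- ln |F(\<kappa>)|\<close> are all additive, and the last one is
  controlled by the other two, some factor of \<open>Q\<close> must be as good as \<open>Q\<close> itself (\<open>ex_good_factor\<close>).
\<close>

hide_const (open) module.smult up_ring.coeff up_ring.monom comm_monoid_mult_class.coprime

section \<open>Minimal polynomials over the integers\<close>

interpretation of_rat_poly_hom: map_poly_idom_hom "of_rat :: rat \<Rightarrow> 'a :: field_char_0" ..

lemma poly_of_rat_of_int_poly:
  "map_poly of_rat (of_int_poly F :: rat poly) = (of_int_poly F :: 'a :: field_char_0 poly)"
  by (simp add: map_poly_map_poly o_def)

lemma degree_pos_if_irreducible_root:
  fixes x :: "'a :: field_char_0" and F :: "int poly"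
  assumes F: "irreducible F" and Fx: "poly (of_int_poly F) x = 0"
  shows "degree F > 0"
proof (rule ccontr)
  assume "\<not> 0 < degree F"
  then obtain c where c: "F = [:c:]" by (metis degree_eq_zeroE gr0I)
  with Fx have "c = 0" by (simp add: of_int_hom.map_poly_pCons_hom)
  with c F show False by simp
qed

lemma irreducible_rat_poly_of_int:
  fixes F :: "int poly"
  assumes "irreducible F" and "degree F > 0"
  shows "irreducible (of_int_poly F :: rat poly)"
  using assms irreducible\<^sub>d_int_rat[of F] irreducible_connect_field irreducible_imp_primitive
    irreducible_primitive_connect[of F] by auto

abbreviation rat_eval :: "rat poly \<Rightarrow> 'a :: field_char_0 \<Rightarrow> 'a" where
  "rat_eval q x \<equiv> poly (map_poly of_rat q) x"

lemma irreducible_rat_poly_bezout: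
  fixes P q :: "rat poly"
  assumes "irreducible P" and "\<not> P dvd q"
  obtains a b where "a * P + b * q = 1"
proof -
  have "coprime P q"
    using assms by (intro prime_elem_imp_coprime) (auto intro: field_poly_irreducible_imp_prime)
  hence "fst (bezout_coefficients P q) * P + snd (bezout_coefficients P q) * q = 1"
    by (simp add: bezout_coefficients_fst_snd)
  thus ?thesis by (rule that)
qed

lemma irreducible_rat_poly_dvd_if_common_root:
  fixes x :: "'a :: field_char_0"
  assumes "irreducible P" and "rat_eval P x = 0" and "rat_eval q x = 0"
  shows "P dvd q"
proof (rule ccontr)
  assume "\<not> P dvd q"
  then obtain a b where "a * P + b * q = 1" by (rule irreducible_rat_poly_bezout[OF assms(1)])
  hence "rat_eval (a * P + b * q) x = 1" by simp
  thus False
    by (simp add: of_rat_poly_hom.hom_mult of_rat_poly_hom.hom_add assms)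
qed

text \<open>
  Over the rationals this is Bezout's identity. Gauss's lemma brings the divisibility back to the
  integers, because a nonconstant irreducible integer polynomial is primitive.
\<close>

lemma irreducible_int_poly_dvd_if_common_root:
  fixes x :: "'a :: field_char_0" and F G :: "int poly"
  assumes F: "irreducible F" and Fx: "poly (of_int_poly F) x = 0"
    and Gx: "poly (of_int_poly G) x = 0"
  shows "F dvd G"
proof -
  let ?F = "of_int_poly F :: rat poly" and ?G = "of_int_poly G :: rat poly"
  have deg: "degree F > 0"
    using F Fx by (rule degree_pos_if_irreducible_root)
  have prim: "content F = 1"
    using irreducible_imp_primitive[OF F] deg by (simp add: primitive_iff_content_eq_1)
  have "?F dvd ?G"
    by (rule irreducible_rat_poly_dvd_if_common_root[OF irreducible_rat_poly_of_int[OF F deg], of x])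
       (simp_all add: poly_of_rat_of_int_poly Fx Gx)
  then obtain H where H: "?G = ?F * H" by (elim dvdE)
  obtain d q where dq: "rat_to_int_poly H = (d, q)" by force
  from rat_to_int_poly[OF dq] have d: "d > 0" and Hq: "H = smult (inverse (of_int d)) (of_int_poly q)"
    by auto
  have "of_int_poly (smult d G) = smult (of_int d) ?G" by (simp add: hom_distribs)
  also have "\<dots> = of_int_poly (F * q)"
    using d by (simp add: H Hq of_int_poly_hom.hom_mult)
  finally have "smult d G = F * q" by (simp only: of_int_poly_hom.eq_iff)
  hence "F dvd smult d G" by simp
  hence "primitive_part F dvd G" using d by (intro dvd_smult_int[of d]) auto
  thus ?thesis using prim by (simp add: primitive_part_prim)
qed

lemma int_minpoly_eqI:
  fixes x :: "'a :: field_char_0" and F :: "int poly"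
  assumes F: "irreducible F" "lead_coeff F > 0" and Fx: "poly (of_int_poly F) x = 0"
  shows "int_minpoly x = F"
  unfolding int_minpoly_def
proof (rule the_equality)
  show "irreducible F \<and> 1 \<le> lead_coeff F \<and> poly (of_int_poly F) x = 0" using assms by auto
next
  fix P :: "int poly"
  assume P: "irreducible P \<and> 1 \<le> lead_coeff P \<and> poly (of_int_poly P) x = 0"
  have "F dvd P" "P dvd F"
    using irreducible_int_poly_dvd_if_common_root P assms by blast+
  hence "normalize F = normalize P"
    by (intro normalization_semidom_class.associatedI)
  moreover have "normalize F = F" "normalize P = P"
    using F P by (auto simp: normalize_poly_def unit_factor_poly_def sgn_if div_poly_def)
  ultimately show "P = F" by simp
qed

lemma algebraic_imp_irreducible_int_poly:
  fixes x :: "'a :: field_char_0"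
  assumes "algebraic x"
  obtains F :: "int poly"
  where "irreducible F" "lead_coeff F > 0" "poly (of_int_poly F) x = 0"
proof -
  obtain P :: "int poly" where P: "P \<noteq> 0" "poly (of_int_poly P) x = 0"
    using assms by (rule algebraicE')
  have "\<exists>F. irreducible F \<and> poly (of_int_poly F) x = 0"
    using P
  proof (induction "P" rule: prime_divisors_induct)
    case (unit P)
    then obtain Q where "1 = P * Q" by (elim dvdE)
    hence "poly (of_int_poly P * of_int_poly Q) x = 1"
      by (metis of_int_poly_hom.hom_mult of_int_poly_hom.hom_one poly_1)
    with unit(3) show ?case by simp
  next
    case (factor p P)
    then show ?case by (auto simp: of_int_poly_hom.hom_mult prime_imp_prime_elem prime_elem_imp_irreducible)
  qed auto
  then obtain F where F: "irreducible F" "poly (of_int_poly F) x = 0" by blast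
  show ?thesis
  proof (cases "lead_coeff F > 0")
    case True with F that show ?thesis by blast
  next
    case False
    have "lead_coeff F \<noteq> 0" using F(1) by (metis leading_coeff_0_iff not_irreducible_zero)
    with False have "lead_coeff (-F) > 0" by (simp del: leading_coeff_0_iff)
    moreover have "irreducible (-F)" using F by simp
    moreover have "poly (of_int_poly (-F)) x = 0" using F by (simp add: of_int_poly_hom.hom_uminus)
    ultimately show ?thesis using that by blast
  qed
qed

section \<open>Number fields and their embeddings\<close>

lemma rat_eval_inverse:
  fixes x :: "'a :: field_char_0"
  assumes "irreducible P" and "rat_eval P x = 0" and "rat_eval q x \<noteq> 0"
  obtains b where "rat_eval b x * rat_eval q x = 1"
proof -
  have "\<not> P dvd q"
    using assms by (auto elim!: dvdE simp: of_rat_poly_hom.hom_mult)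
  then obtain a b where "a * P + b * q = 1" by (rule irreducible_rat_poly_bezout[OF assms(1)])
  hence "rat_eval (a * P + b * q) x = 1" by simp
  hence "rat_eval b x * rat_eval q x = 1"
    by (simp add: of_rat_poly_hom.hom_mult of_rat_poly_hom.hom_add assms)
  thus ?thesis by (rule that)
qed

lemma is_subfield_of_rat:
  assumes "is_subfield F"
  shows "of_rat r \<in> F"
proof -
  have F: "0 \<in> F" "1 \<in> F" "\<And>x y. x \<in> F \<Longrightarrow> y \<in> F \<Longrightarrow> x + y \<in> F"
    "\<And>x y. x \<in> F \<Longrightarrow> y \<in> F \<Longrightarrow> x - y \<in> F" "\<And>x y. x \<in> F \<Longrightarrow> y \<in> F \<Longrightarrow> x * y \<in> F"
    "\<And>x. x \<in> F \<Longrightarrow> inverse x \<in> F"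
    using assms by (auto simp: is_subfield_def)
  have nat: "of_nat n \<in> F" for n by (induction n) (auto intro: F)
  have int: "of_int k \<in> F" for k
  proof (cases k rule: int_cases2)
    case (nonneg n) with nat show ?thesis by simp
  next
    case (nonpos n) with F(4)[OF F(1) nat] show ?thesis by simp
  qed
  obtain a b where "r = of_int a / of_int b" by (metis Rat_cases Fract_of_int_quotient)
  hence "of_rat r = (of_int a :: 'a) * inverse (of_int b)"
    by (simp add: of_rat_divide field_simps)
  thus ?thesis using F(5)[OF int F(6)[OF int]] by simp
qed

lemma rat_adjoin_eq:
  fixes \<alpha> :: "'a :: field_char_0"
  assumes "irreducible P" and "rat_eval P \<alpha> = 0"
  shows "rat_adjoin \<alpha> = range (\<lambda>q. rat_eval q \<alpha>)"
proof
  have "is_subfield (range (\<lambda>q. rat_eval q \<alpha>))"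
    unfolding is_subfield_def
  proof (intro conjI ballI)
    show "0 \<in> range (\<lambda>q. rat_eval q \<alpha>)" by (rule range_eqI[of _ _ 0]) simp
    show "1 \<in> range (\<lambda>q. rat_eval q \<alpha>)" by (rule range_eqI[of _ _ 1]) simp
  next
    fix x y assume "x \<in> range (\<lambda>q. rat_eval q \<alpha>)" "y \<in> range (\<lambda>q. rat_eval q \<alpha>)"
    then obtain q r where "x = rat_eval q \<alpha>" "y = rat_eval r \<alpha>" by blast
    thus "x + y \<in> range (\<lambda>q. rat_eval q \<alpha>)" "x - y \<in> range (\<lambda>q. rat_eval q \<alpha>)"
      "x * y \<in> range (\<lambda>q. rat_eval q \<alpha>)"
      by (auto intro: range_eqI[of _ _ "q + r"] range_eqI[of _ _ "q - r"] range_eqI[of _ _ "q * r"]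
          simp: of_rat_poly_hom.hom_mult of_rat_poly_hom.hom_add of_rat_poly_hom.hom_minus)
  next
    fix x assume "x \<in> range (\<lambda>q. rat_eval q \<alpha>)"
    then obtain q where q: "x = rat_eval q \<alpha>" by blast
    show "inverse x \<in> range (\<lambda>q. rat_eval q \<alpha>)"
    proof (cases "x = 0")
      case True
      thus ?thesis by (intro range_eqI[of _ _ 0]) simp
    next
      case False
      then obtain b where "rat_eval b \<alpha> * x = 1"
        using rat_eval_inverse[OF assms, of q] q by auto
      hence "inverse x = rat_eval b \<alpha>" by (metis inverse_unique mult.commute)
      thus ?thesis by simp
    qed
  qed
  moreover have "\<alpha> \<in> range (\<lambda>q. rat_eval q \<alpha>)"
    by (rule range_eqI[of _ _ "[:0, 1:]"]) (simp add: of_rat_hom.map_poly_pCons_hom)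
  ultimately show "rat_adjoin \<alpha> \<subseteq> range (\<lambda>q. rat_eval q \<alpha>)"
    unfolding rat_adjoin_def by blast
next
  have "rat_eval q \<alpha> \<in> F" if F: "is_subfield F" "\<alpha> \<in> F" for q F
  proof (induction q)
    case 0
    with F show ?case by (simp add: is_subfield_def)
  next
    case (pCons c q)
    with F is_subfield_of_rat[OF F(1)] show ?case
      by (simp add: is_subfield_def of_rat_hom.map_poly_pCons_hom)
  qed
  thus "range (\<lambda>q. rat_eval q \<alpha>) \<subseteq> rat_adjoin \<alpha>"
    unfolding rat_adjoin_def by blast
qed

lemma rat_eval_sum:
  "rat_eval (\<Sum>i\<in>I. monom (u i) i) x = (\<Sum>i\<in>I. of_rat (u i) * x ^ i)"
  by (induction I rule: infinite_finite_induct)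
     (auto simp: of_rat_poly_hom.hom_add poly_monom map_poly_monom)

lemma rat_degree_rat_adjoin:
  fixes \<alpha> :: "'a :: field_char_0"
  assumes P: "irreducible P" and P0: "rat_eval P \<alpha> = 0"
  shows "rat_degree (rat_adjoin \<alpha>) = degree P"
proof -
  interpret rv: vector_space "rat_scale :: rat \<Rightarrow> 'a \<Rightarrow> 'a" by (rule vector_space_rat_scale)
  let ?n = "degree P"
  let ?B = "(\<lambda>i. \<alpha> ^ i) ` {..<?n}"
  have coeffs_zero: "u i = 0" if "(\<Sum>i<?n. of_rat (u i) * \<alpha> ^ i) = 0" "i < ?n" for u i
  proof -
    let ?q = "\<Sum>i<?n. monom (u i) i"
    have "P dvd ?q"
      using irreducible_rat_poly_dvd_if_common_root[OF assms, of ?q] that by (simp only: rat_eval_sum)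
    moreover have "degree ?q < ?n"
      using that(2) by (intro degree_lessI) (auto simp: coeff_sum)
    ultimately have "?q = 0"
      by (meson dvd_imp_degree_le leD)
    hence "coeff ?q i = 0" by simp
    thus ?thesis using that(2) by (simp add: coeff_sum)
  qed
  have inj: "inj_on (\<lambda>i. \<alpha> ^ i) {..<?n}"
  proof (rule inj_onI, rule ccontr)
    fix i j assume ij: "i \<in> {..<?n}" "j \<in> {..<?n}" "\<alpha> ^ i = \<alpha> ^ j" "i \<noteq> j"
    let ?u = "\<lambda>k. if k = i then 1 else if k = j then -1 else 0 :: rat"
    have "(\<Sum>k<?n. of_rat (?u k) * \<alpha> ^ k) = (\<Sum>k\<in>{i, j}. of_rat (?u k) * \<alpha> ^ k)"
      using ij by (intro sum.mono_neutral_right) auto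
    also have "\<dots> = 0" using ij by simp
    finally have "?u i = 0" using coeffs_zero[of ?u i] ij by blast
    thus False by simp
  qed
  have "rv.independent ?B"
  proof (rule rv.independent_if_scalars_zero)
    fix f x assume *: "(\<Sum>x\<in>?B. rat_scale (f x) x) = 0" "x \<in> ?B"
    from * have "(\<Sum>i<?n. of_rat (f (\<alpha> ^ i)) * \<alpha> ^ i) = 0"
      by (simp add: sum.reindex[OF inj])
    with *(2) show "f x = 0" using coeffs_zero[of "\<lambda>i. f (\<alpha> ^ i)"] by auto
  qed auto
  moreover have "rat_adjoin \<alpha> \<subseteq> rv.span ?B"
  proof
    fix x assume "x \<in> rat_adjoin \<alpha>"
    then obtain q where q: "x = rat_eval q \<alpha>" unfolding rat_adjoin_eq[OF assms] by blast
    let ?r = "q mod P"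
    have "q = P * (q div P) + ?r" by simp
    hence "x = rat_eval (P * (q div P) + ?r) \<alpha>" using q by simp
    hence x: "x = rat_eval ?r \<alpha>"
      by (simp only: of_rat_poly_hom.hom_mult of_rat_poly_hom.hom_add poly_add poly_mult P0)
         simp
    have "P \<noteq> 0" using P by auto
    moreover have "?n > 0" using P P0
      by (metis \<open>P \<noteq> 0\<close> bot_nat_0.not_eq_extremum irreducible_def is_unit_iff_degree)
    ultimately have deg: "degree ?r < ?n" by (metis degree_0 degree_mod_less)
    hence "?r = (\<Sum>i<?n. monom (coeff ?r i) i)"
      by (intro poly_eqI) (auto simp: coeff_sum coeff_eq_0)
    hence "x = rat_eval (\<Sum>i<?n. monom (coeff ?r i) i) \<alpha>" using x by simp
    hence "x = (\<Sum>i<?n. rat_scale (coeff ?r i) (\<alpha> ^ i))" by (simp only: rat_eval_sum)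
    also have "\<dots> \<in> rv.span ?B"
      by (intro rv.span_sum rv.span_scale rv.span_base) auto
    finally show "x \<in> rv.span ?B" .
  qed
  moreover have "?B \<subseteq> rat_adjoin \<alpha>"
  proof
    fix x assume "x \<in> ?B"
    then obtain i where "x = \<alpha> ^ i" by blast
    hence "x = rat_eval (monom 1 i) \<alpha>" by (simp add: map_poly_monom poly_monom)
    thus "x \<in> rat_adjoin \<alpha>" unfolding rat_adjoin_eq[OF assms] by blast
  qed
  moreover have "card ?B = ?n" using inj by (simp add: card_image)
  ultimately show ?thesis unfolding rat_degree_def by (intro rv.dim_unique)
qed

lemma embedding_rat_eval:
  fixes \<alpha> :: "'a :: field_char_0"
  assumes P: "irreducible P" "rat_eval P \<alpha> = 0"
    and \<sigma>: "\<sigma> \<in> embeddings (rat_adjoin \<alpha>)"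
  shows "\<sigma> (rat_eval q \<alpha>) = rat_eval q (\<sigma> \<alpha>)"
proof -
  note eq = rat_adjoin_eq[OF P]
  have one: "\<sigma> 1 = 1"
    and add: "\<And>x y. x \<in> rat_adjoin \<alpha> \<Longrightarrow> y \<in> rat_adjoin \<alpha> \<Longrightarrow> \<sigma> (x + y) = \<sigma> x + \<sigma> y"
    and mult: "\<And>x y. x \<in> rat_adjoin \<alpha> \<Longrightarrow> y \<in> rat_adjoin \<alpha> \<Longrightarrow> \<sigma> (x * y) = \<sigma> x * \<sigma> y"
    using \<sigma> by (auto simp: embeddings_def)
  have mem: "rat_eval q \<alpha> \<in> rat_adjoin \<alpha>" for q unfolding eq by blast
  have memr: "of_rat r \<in> rat_adjoin \<alpha>" for r
    using mem[of "[:r:]"] by (simp add: of_rat_hom.map_poly_pCons_hom)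
  have mem\<alpha>: "\<alpha> \<in> rat_adjoin \<alpha>" using mem[of "[:0,1:]"] by (simp add: of_rat_hom.map_poly_pCons_hom)
  have zero: "\<sigma> 0 = 0" using add[of 0 0] memr[of 0] by simp
  have nat: "\<sigma> (of_nat n) = of_nat n" for n
  proof (induction n)
    case (Suc n)
    thus ?case using add[of 1 "of_nat n"] memr[of 1] memr[of "of_nat n"] one by simp
  qed (simp add: zero)
  have int: "\<sigma> (of_int k) = of_int k" for k
  proof (cases k rule: int_cases2)
    case (nonpos n)
    have "\<sigma> (of_nat n + of_int k) = \<sigma> (of_nat n) + \<sigma> (of_int k)"
      using memr[of "of_nat n"] memr[of "of_int k"] by (intro add) auto
    hence "of_nat n + \<sigma> (of_int k) = 0" using nonpos by (simp add: nat zero)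
    hence "\<sigma> (of_int k) = - of_nat n" by (simp add: eq_neg_iff_add_eq_0 add.commute)
    thus ?thesis using nonpos by simp
  qed (simp add: nat)
  have rat: "\<sigma> (of_rat r) = of_rat r" for r
  proof -
    obtain a b where ab: "r = of_int a / of_int b" "b > 0"
      by (metis Rat_cases Fract_of_int_quotient)
    have "\<sigma> (of_int b * of_rat r) = of_int b * \<sigma> (of_rat r)"
      using mult[of "of_int b" "of_rat r"] memr[of "of_int b"] memr[of r] by (simp add: int)
    moreover have "of_int b * of_rat r = (of_int a :: 'a)"
      using ab by (simp add: of_rat_divide)
    ultimately have "of_int b * \<sigma> (of_rat r) = (of_int a :: 'a)" by (simp add: int)
    also have "\<dots> = of_int b * of_rat r" using ab by (simp add: of_rat_divide)
    finally show ?thesis using ab by simp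
  qed
  show ?thesis
  proof (induction q)
    case (pCons c q)
    have "\<alpha> * rat_eval q \<alpha> \<in> rat_adjoin \<alpha>"
      using mem[of "[:0,1:] * q"] by (simp add: of_rat_poly_hom.hom_mult of_rat_hom.map_poly_pCons_hom)
    thus ?case
      using add[OF memr[of c]] mult[OF mem\<alpha> mem[of q]] pCons
      by (simp add: of_rat_hom.map_poly_pCons_hom rat)
  qed (simp add: zero)
qed

text \<open>
  An embedding of \<open>\<rat>(\<alpha>)\<close> is determined by the image of \<open>\<alpha>\<close>, which can be any root of the
  minimal polynomial: evaluating polynomials at another root is well defined because two polynomials
  that agree at \<open>\<alpha>\<close> differ by a multiple of the minimal polynomial.
\<close>

lemma bij_betw_embeddings_roots:
  fixes \<alpha> :: "'a :: field_char_0"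
  assumes P: "irreducible P" "rat_eval P \<alpha> = 0"
  shows "bij_betw (\<lambda>\<sigma>. \<sigma> \<alpha>) (embeddings (rat_adjoin \<alpha>)) {\<beta>. rat_eval P \<beta> = 0}"
proof (rule bij_betwI')
  note eq = rat_adjoin_eq[OF P]
  note ev = embedding_rat_eval[OF P]
  fix \<sigma> \<tau> assume st: "\<sigma> \<in> embeddings (rat_adjoin \<alpha>)" "\<tau> \<in> embeddings (rat_adjoin \<alpha>)"
  show "(\<sigma> \<alpha> = \<tau> \<alpha>) = (\<sigma> = \<tau>)"
  proof
    assume *: "\<sigma> \<alpha> = \<tau> \<alpha>"
    have "\<sigma> x = \<tau> x" if "x \<in> rat_adjoin \<alpha>" for x
    proof -
      obtain q where "x = rat_eval q \<alpha>" using \<open>x \<in> rat_adjoin \<alpha>\<close> unfolding eq by blast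
      thus ?thesis using ev[OF st(1), of q] ev[OF st(2), of q] * by simp
    qed
    thus "\<sigma> = \<tau>" using st unfolding embeddings_def by (auto intro: PiE_ext)
  qed simp
next
  note ev = embedding_rat_eval[OF P]
  fix \<sigma> assume s: "\<sigma> \<in> embeddings (rat_adjoin \<alpha>)"
  have "0 \<in> rat_adjoin \<alpha>" unfolding rat_adjoin_def is_subfield_def by auto
  hence "\<sigma> (0 + 0) = \<sigma> 0 + \<sigma> 0" using s unfolding embeddings_def by blast
  hence "\<sigma> 0 = 0" by simp
  thus "\<sigma> \<alpha> \<in> {\<beta>. rat_eval P \<beta> = 0}" using ev[OF s, of P] P by simp
next
  note eq = rat_adjoin_eq[OF P]
  fix \<beta> :: 'a assume "\<beta> \<in> {\<beta>. rat_eval P \<beta> = 0}"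
  hence \<beta>: "rat_eval P \<beta> = 0" by simp
  define \<sigma> :: "'a \<Rightarrow> 'a" where "\<sigma> = restrict (\<lambda>x. rat_eval (SOME q. rat_eval q \<alpha> = x) \<beta>) (rat_adjoin \<alpha>)"
  have mem: "rat_eval q \<alpha> \<in> rat_adjoin \<alpha>" for q unfolding eq by blast
  have \<sigma>: "\<sigma> (rat_eval q \<alpha>) = rat_eval q \<beta>" for q
  proof -
    define r where "r = (SOME r. rat_eval r \<alpha> = rat_eval q \<alpha>)"
    have "rat_eval r \<alpha> = rat_eval q \<alpha>" unfolding r_def by (rule someI[of _ q]) simp
    hence "rat_eval (r - q) \<alpha> = 0" by (simp add: of_rat_poly_hom.hom_minus)
    hence "P dvd r - q" by (rule irreducible_rat_poly_dvd_if_common_root[OF P])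
    then obtain s where "r = q + P * s" by (metis add_diff_cancel_left' diff_add_cancel dvdE add.commute)
    hence "rat_eval r \<beta> = rat_eval q \<beta>"
      by (simp add: of_rat_poly_hom.hom_add of_rat_poly_hom.hom_mult \<beta>)
    thus ?thesis unfolding \<sigma>_def r_def using mem by simp
  qed
  have "\<sigma> \<in> embeddings (rat_adjoin \<alpha>)"
    unfolding embeddings_def
  proof (intro CollectI conjI ballI)
    show "\<sigma> \<in> rat_adjoin \<alpha> \<rightarrow>\<^sub>E UNIV" unfolding \<sigma>_def by auto
    show "\<sigma> 1 = 1" using \<sigma>[of 1] by simp
  next
    fix x y assume "x \<in> rat_adjoin \<alpha>" "y \<in> rat_adjoin \<alpha>"
    then obtain q r where *: "x = rat_eval q \<alpha>" "y = rat_eval r \<alpha>" unfolding eq by blast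
    show "\<sigma> (x + y) = \<sigma> x + \<sigma> y" "\<sigma> (x * y) = \<sigma> x * \<sigma> y"
      using \<sigma>[of q] \<sigma>[of r] \<sigma>[of "q + r"] \<sigma>[of "q * r"]
      by (simp_all add: * of_rat_poly_hom.hom_add of_rat_poly_hom.hom_mult)
  qed
  moreover have "\<sigma> \<alpha> = \<beta>" using \<sigma>[of "[:0,1:]"] by (simp add: of_rat_hom.map_poly_pCons_hom)
  ultimately show "\<exists>\<sigma>\<in>embeddings (rat_adjoin \<alpha>). \<beta> = \<sigma> \<alpha>" by blast
qed

lemma irreducible_int_poly_roots_simple:
  fixes x :: "'a :: field_char_0"
  assumes F: "irreducible F" and x: "poly (of_int_poly F) x = 0"
  shows "poly (pderiv (of_int_poly F)) x \<noteq> 0"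
proof
  assume "poly (pderiv (of_int_poly F)) x = 0"
  hence "poly (of_int_poly (pderiv F)) x = 0" by (simp add: of_int_hom.map_poly_pderiv)
  hence "F dvd pderiv F"
    by (rule irreducible_int_poly_dvd_if_common_root[OF F x])
  moreover have deg: "degree F > 0" by (rule degree_pos_if_irreducible_root[OF F x])
  hence "pderiv F \<noteq> 0" by (simp add: pderiv_eq_0_iff)
  ultimately have "degree F \<le> degree (pderiv F)" by (rule dvd_imp_degree_le)
  with deg show False by (simp add: degree_pderiv)
qed

lemma irreducible_int_poly_factorization:
  fixes F :: "int poly"
  assumes F: "irreducible F"
  defines "R \<equiv> {\<beta> :: 'a :: {alg_closed_field, field_char_0}. poly (of_int_poly F) \<beta> = 0}"
  shows "poly (of_int_poly F) x = of_int (lead_coeff F) * (\<Prod>\<beta>\<in>R. x - \<beta>)"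
    and "finite R"
proof -
  let ?F = "of_int_poly F :: 'a poly"
  have F0: "?F \<noteq> 0" using F by auto
  show fin: "finite R" unfolding R_def using F0 by (rule poly_roots_finite)
  obtain A where A: "?F = smult (lead_coeff ?F) (\<Prod>x\<in>#A. [:-x, 1:])"
    using alg_closed_imp_factorization[OF F0] by blast
  have lc: "lead_coeff ?F \<noteq> 0" using F0 by simp
  have root_iff: "poly ?F y = 0 \<longleftrightarrow> y \<in># A" for y
  proof -
    have "poly ?F y = lead_coeff ?F * (\<Prod>x\<in>#A. y - x)"
      by (subst A) (simp add: poly_prod_mset image_mset.compositionality o_def)
    thus ?thesis using lc by (auto simp: prod_mset_zero_iff)
  qed
  have "count A y \<le> 1" for y
  proof (rule ccontr)
    assume "\<not> count A y \<le> 1"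
    hence "{#y, y#} \<subseteq># A" by (auto simp: subseteq_mset_def)
    then obtain B where B: "A = {#y, y#} + B" by (metis subset_mset.add_diff_inverse)
    have "?F = [:-y, 1:] * ([:-y, 1:] * smult (lead_coeff ?F) (\<Prod>x\<in>#B. [:-x, 1:]))"
      by (subst A) (simp add: B algebra_simps del: mult_pCons_left mult_pCons_right)
    then obtain G where G: "?F = [:-y, 1:] * ([:-y, 1:] * G)" by blast
    have "poly ?F y = 0" by (simp add: G)
    moreover have "poly (pderiv ?F) y = 0"
      by (simp add: G pderiv_mult pderiv_pCons del: mult_pCons_left mult_pCons_right)
    ultimately show False using irreducible_int_poly_roots_simple[OF F, of y] by blast
  qed
  hence "A = mset_set (set_mset A)"
    by (intro multiset_eqI) (metis count_eq_zero_iff count_mset_set(1) count_mset_set(3) finite_set_mset le_less less_one)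
  also have "set_mset A = R" using root_iff by (auto simp: R_def)
  finally have AR: "A = mset_set R" .
  have "poly ?F x = lead_coeff ?F * (\<Prod>y\<in>#A. x - y)"
    by (subst A) (simp add: poly_prod_mset image_mset.compositionality o_def)
  thus "poly ?F x = of_int (lead_coeff F) * (\<Prod>\<beta>\<in>R. x - \<beta>)"
    by (simp add: AR prod_unfold_prod_mset)
qed

text \<open>
  The conjugates of \<open>\<alpha>\<close> are the roots of \<open>F\<close>, so the sum over the embeddings is the logarithm of the
  absolute value of the product of all \<open>\<kappa> - \<beta>\<close>, which is \<open>F(\<kappa>)\<close> divided by the leading coefficient.
  This is how the embeddings disappear from the problem.
\<close>

lemma mean_log_dist_eq:
  fixes \<alpha> \<kappa> :: "'a :: {alg_closed_field, field_char_0}"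
  assumes v: "absolute_value v"
    and F: "irreducible F" "lead_coeff F > 0" "poly (of_int_poly F) \<alpha> = 0"
    and \<kappa>: "poly (of_int_poly F) \<kappa> \<noteq> 0"
  shows "mean_log_dist v \<kappa> \<alpha> =
    (ln (v (poly (of_int_poly F) \<kappa>)) - ln (v (of_int (lead_coeff F)))) / real (degree F)"
proof -
  let ?P = "of_int_poly F :: rat poly"
  define R where "R = {\<beta> :: 'a. poly (of_int_poly F) \<beta> = 0}"
  have deg: "degree F > 0" using F by (intro degree_pos_if_irreducible_root)
  have P: "irreducible ?P" using F(1) deg by (rule irreducible_rat_poly_of_int)
  have P0: "rat_eval ?P \<alpha> = 0" using F by (simp add: poly_of_rat_of_int_poly)
  have R: "{\<beta>. rat_eval ?P \<beta> = 0} = R" by (simp add: R_def poly_of_rat_of_int_poly)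
  note fac = irreducible_int_poly_factorization[OF F(1), where 'a = 'a, folded R_def]
  have v_mult: "v (x * y) = v x * v y" and v_pos: "v x \<ge> 0" and v_0: "v x = 0 \<longleftrightarrow> x = 0" for x y
    using v by (auto simp: absolute_value_def)
  have v_gt: "v x > 0" if "x \<noteq> 0" for x using v_pos[of x] v_0[of x] that by linarith
  have v1: "v 1 = 1" using v_mult[of 1 1] v_0[of 1] by simp
  have vm1: "v (-1) = 1"
  proof -
    have "v (-1) ^ 2 = 1" using v_mult[of "-1" "-1"] v1 by (simp add: power2_eq_square)
    thus ?thesis using v_pos[of "-1"] by (simp add: power2_eq_1_iff)
  qed
  have vminus: "v (x - y) = v (y - x)" for x y using v_mult[of "-1" "y - x"] vm1 by simp
  have \<kappa>R: "\<kappa> - \<beta> \<noteq> 0" if "\<beta> \<in> R" for \<beta> using that \<kappa> by (auto simp: R_def)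
  have lnprod: "ln (v (\<Prod>\<beta>\<in>S. \<kappa> - \<beta>)) = (\<Sum>\<beta>\<in>S. ln (v (\<kappa> - \<beta>)))" if "finite S" "S \<subseteq> R" for S
    using that
  proof (induction S rule: finite_induct)
    case (insert b S)
    have "(\<Prod>\<beta>\<in>S. \<kappa> - \<beta>) \<noteq> 0" using insert \<kappa>R by auto
    with insert \<kappa>R[of b] show ?case by (simp add: v_mult ln_mult_pos v_gt)
  qed (simp add: v1)
  have "(\<Sum>\<sigma>\<in>embeddings (rat_adjoin \<alpha>). ln (v (\<sigma> \<alpha> - \<kappa>))) = (\<Sum>\<beta>\<in>R. ln (v (\<beta> - \<kappa>)))"
    using sum.reindex_bij_betw[OF bij_betw_embeddings_roots[OF P P0], of "\<lambda>\<beta>. ln (v (\<beta> - \<kappa>))"]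
    by (simp add: R)
  also have "\<dots> = ln (v (\<Prod>\<beta>\<in>R. \<kappa> - \<beta>))"
    using lnprod[OF fac(2)] by (simp add: vminus)
  also have "\<dots> = ln (v (poly (of_int_poly F) \<kappa>)) - ln (v (of_int (lead_coeff F)))"
  proof -
    have "(\<Prod>\<beta>\<in>R. \<kappa> - \<beta>) \<noteq> 0" using fac(2) \<kappa>R by auto
    moreover have "(of_int (lead_coeff F) :: 'a) \<noteq> 0" using F(1) by auto
    ultimately show ?thesis unfolding fac(1)
      by (simp add: v_mult ln_mult_pos v_gt)
  qed
  finally show ?thesis
    unfolding mean_log_dist_def rat_degree_rat_adjoin[OF P P0] by simp
qed

section \<open>Jensen's formula\<close>

definition circ :: "real \<Rightarrow> complex" where
  "circ t = exp (2 * of_real pi * \<i> * of_real t)"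

lemma norm_circ [simp]: "cmod (circ t) = 1"
  by (simp add: circ_def norm_exp_eq_Re)

lemma circ_add: "circ (s + t) = circ s * circ t"
  by (simp add: circ_def exp_add [symmetric] algebra_simps)

lemma circ_1 [simp]: "circ 1 = 1"
  by (simp add: circ_def)

lemma circ_0 [simp]: "circ 0 = 1"
  by (simp add: circ_def)

lemma circ_half: "circ (1 / 2) = -1"
  by (simp add: circ_def mult.commute)

lemma circ_double: "circ (2 * t) = circ t ^ 2"
  by (simp only: mult_2 circ_add power2_eq_square)

lemma circ_eq_1_iff: "circ t = 1 \<longleftrightarrow> (\<exists>n :: int. t = of_int n)"
  by (auto simp: circ_def exp_eq_1)

lemma continuous_on_circ [continuous_intros]: "continuous_on A circ"
  unfolding circ_def by (intro continuous_intros)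

lemma measurable_circ [measurable]: "circ \<in> borel_measurable borel"
  by (rule borel_measurable_continuous_onI) (rule continuous_on_circ)

lemma circ_surj:
  assumes "cmod z = 1"
  obtains c where "c \<in> {0..1}" "z = circ c"
proof -
  have z: "z = cis (Arg2pi z)" using assms Arg2pi_eq[of z] by (metis cis_conv_exp mult_1 of_real_1)
  have "z = circ (Arg2pi z / (2 * pi))"
    by (subst z) (simp add: circ_def cis_conv_exp)
  moreover have "Arg2pi z / (2 * pi) \<in> {0..1}"
    using Arg2pi_ge_0[of z] Arg2pi_lt_2pi[of z] by auto
  ultimately show ?thesis by (rule that[rotated])
qed

lemma finite_circ_eq: "finite {t \<in> {0..1}. circ t = z}"
proof (cases "{t \<in> {0..1}. circ t = z} = {}")
  case False
  then obtain s where s: "s \<in> {0..1}" "circ s = z" by blast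
  have "{t \<in> {0..1}. circ t = z} \<subseteq> {s - 1, s, s + 1}"
  proof
    fix t assume t: "t \<in> {t \<in> {0..1}. circ t = z}"
    have "circ s * circ (t - s) = circ t" by (simp add: circ_add [symmetric])
    with t s have "circ s * circ (t - s) = circ s" by simp
    moreover have "circ s \<noteq> 0" by (simp add: circ_def)
    ultimately have "circ (t - s) = 1" by simp
    then obtain n :: int where n: "t - s = of_int n" by (auto simp: circ_eq_1_iff)
    have "\<bar>t - s\<bar> \<le> 1" using t s by auto
    hence "\<bar>n\<bar> \<le> 1" unfolding n by linarith
    hence "n = -1 \<or> n = 0 \<or> n = 1" by linarith
    thus "t \<in> {s - 1, s, s + 1}" using n by auto
  qed
  thus ?thesis by (rule finite_subset) auto
next
  case True
  thus ?thesis by (simp only: finite.emptyI)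
qed

lemma has_integral_periodic_shift:
  fixes f :: "real \<Rightarrow> real"
  assumes f: "f integrable_on {0..1}" and per: "\<And>t. f (t + 1) = f t" and c: "c \<in> {0..1}"
  shows "((\<lambda>t. f (t + c)) has_integral integral {0..1} f) {0..1}"
proof -
  have 1: "(f has_integral integral {0..c} f) {0..c}" "(f has_integral integral {c..1} f) {c..1}"
    using c by (auto intro!: integrable_integral integrable_subinterval_real[OF f])
  have "((\<lambda>t. f (t + c)) has_integral integral {c..1} f) {0..1-c}"
    using has_integral_affinity[OF 1(2)[folded cbox_interval], of 1 c] c
      image_affinity_atLeastAtMost[of 1 "- c" c 1]
    by (simp add: algebra_simps)
  moreover have *: "((\<lambda>t. f (t + (c - 1))) has_integral integral {0..c} f) {1-c..1}"
    using has_integral_affinity[OF 1(1)[folded cbox_interval], of 1 "c - 1"] c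
      image_affinity_atLeastAtMost[of 1 "1 - c" 0 c]
    by (simp add: algebra_simps)
  then have "((\<lambda>t. f (t + c)) has_integral integral {0..c} f) {1-c..1}"
  proof -
    have "f (t + (c - 1)) = f (t + c)" for t using per[of "t + (c - 1)"] by (simp add: algebra_simps)
    with * show ?thesis by simp
  qed
  ultimately have "((\<lambda>t. f (t + c)) has_integral integral {c..1} f + integral {0..c} f) {0..1}"
    using c by (intro has_integral_combine[of 0 "1 - c" 1]) auto
  moreover have "integral {c..1} f + integral {0..c} f = integral {0..1} f"
    using c Henstock_Kurzweil_Integration.integral_combine[of 0 c 1 f] f by simp
  ultimately show ?thesis by simp
qed

lemma has_integral_periodic_double:
  fixes f :: "real \<Rightarrow> real"
  assumes f: "f integrable_on {0..1}" and per: "\<And>t. f (t + 1) = f t"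
  shows "((\<lambda>t. f (2 * t)) has_integral integral {0..1} f) {0..1}"
proof -
  have 1: "(f has_integral integral {0..1} f) {0..1}" using f by (rule integrable_integral)
  have "((\<lambda>t. f (2 * t)) has_integral integral {0..1} f / 2) {0..1/2}"
    using has_integral_affinity[OF 1[folded cbox_interval], of 2 0] by simp
  moreover have *: "((\<lambda>t. f (2 * t + (-1))) has_integral integral {0..1} f / 2) {1/2..1}"
    using has_integral_affinity[OF 1[folded cbox_interval], of 2 "-1"]
      image_affinity_atLeastAtMost[of "1/2" "1/2" 0 "1 :: real"] by simp
  hence "((\<lambda>t. f (2 * t)) has_integral integral {0..1} f / 2) {1/2..1}"
  proof -
    have "f (2 * t + (-1)) = f (2 * t)" for t using per[of "2 * t + (-1)"] by simp
    with * show ?thesis by simp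
  qed
  ultimately have "((\<lambda>t. f (2 * t)) has_integral integral {0..1} f / 2 + integral {0..1} f / 2) {0..1}"
    by (intro has_integral_combine[of 0 "1/2" 1]) auto
  thus ?thesis by simp
qed

lemma integrable_on_ln: "(\<lambda>x :: real. ln x) integrable_on {0..1}"
proof -
  have "continuous_on {0..1} (\<lambda>x :: real. x * ln x - x)"
    unfolding continuous_on_eq_continuous_within
  proof
    fix x :: real assume x: "x \<in> {0..1}"
    show "continuous (at x within {0..1}) (\<lambda>x. x * ln x - x)"
    proof (cases "x = 0")
      case True
      have "((\<lambda>x :: real. x * ln x - x) \<longlongrightarrow> 0) (at_right 0)" by real_asymp
      moreover have "at 0 within {0..1} = at_right (0 :: real)"
        by (rule at_within_Icc_at_right) simp
      ultimately show ?thesis using True by (simp add: continuous_within)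
    next
      case False
      thus ?thesis by (intro continuous_intros) auto
    qed
  qed
  \<comment> \<open>The antiderivative extends continuously to 0, and \<open>0 * ln 0\<close> is 0, so its value there is the limit.\<close>
  hence "((\<lambda>x :: real. ln x) has_integral (1 * ln 1 - 1) - (0 * ln 0 - 0)) {0..1}"
    by (intro fundamental_theorem_of_calculus_interior)
       (auto intro!: derivative_eq_intros simp: has_real_derivative_iff_has_vector_derivative [symmetric])
  thus ?thesis by blast
qed

text \<open>
  A crude bound for the chord suffices: its logarithm \<open>ln t + ln (1 - t)\<close> is integrable, and this makes
  \<open>ln |circ t - 1|\<close> integrable across its singularities.
\<close>

lemma cmod_circ_minus_1_ge:
  assumes t: "t \<in> {0..1}"
  shows "cmod (circ t - 1) \<ge> t * (1 - t)"
proof -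
  have half: "cmod (circ t - 1) \<ge> t" if "t \<in> {0..1/2}" for t
  proof -
    have "circ t - 1 = circ (t / 2) * (circ (t / 2) - circ (- t / 2))"
      using circ_add[of "t/2" "t/2"] circ_add[of "t/2" "-t/2"] by (simp add: algebra_simps)
    also have "circ (t / 2) - circ (- t / 2) = 2 * \<i> * of_real (sin (pi * t))"
    proof -
      have "circ (t / 2) = exp (\<i> * of_real (pi * t))" "circ (- t / 2) = exp (- (\<i> * of_real (pi * t)))"
        unfolding circ_def by (simp_all add: mult_ac)
      moreover have "complex_of_real (sin (pi * t)) = sin (of_real (pi * t))"
        by (simp only: sin_of_real)
      ultimately show ?thesis by (simp only: sin_exp_eq) simp
    qed
    finally have eq: "cmod (circ t - 1) = 2 * \<bar>sin (pi * t)\<bar>" by (simp add: norm_mult)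
    let ?x = "pi * t"
    have x: "0 \<le> ?x" "?x \<le> pi / 2" using that by auto
    have "\<bar>sin ?x - (\<Sum>m<3. sin_coeff m * ?x ^ m)\<bar> \<le> inverse (fact 3) * \<bar>?x\<bar> ^ 3"
      by (rule Maclaurin_sin_bound)
    hence "\<bar>sin ?x - ?x\<bar> \<le> ?x ^ 3 / 6"
      using x(1) by (simp add: eval_nat_numeral sin_coeff_def)
    moreover have "?x ^ 3 \<le> 4 * ?x"
    proof -
      have "?x \<le> 2" using x pi_less_4 by linarith
      hence "?x ^ 2 \<le> 2 ^ 2" using x(1) by (intro power_mono) auto
      hence "?x * ?x ^ 2 \<le> ?x * 4" using x(1) by (intro mult_left_mono) auto
      thus ?thesis by (simp add: eval_nat_numeral)
    qed
    ultimately have "sin ?x \<ge> ?x / 3" by linarith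
    moreover have "?x \<ge> 3 * t" using that pi_gt3 by (intro mult_right_mono) auto
    ultimately have "sin ?x \<ge> t" by linarith
    with that show ?thesis unfolding eq by auto
  qed
  show ?thesis
  proof (cases "t \<le> 1/2")
    case True
    have "t * (1 - t) \<le> t * 1" using t by (intro mult_left_mono) auto
    with half[of t] True t show ?thesis by auto
  next
    case False
    have "circ t - 1 = - circ t * (circ (1 - t) - 1)"
      using circ_add[of t "1 - t"] by (simp add: algebra_simps)
    hence "cmod (circ t - 1) = cmod (circ (1 - t) - 1)" by (simp add: norm_mult)
    moreover have "t * (1 - t) \<le> 1 * (1 - t)" using t by (intro mult_right_mono) auto
    ultimately show ?thesis using half[of "1 - t"] False t by auto
  qed
qed

lemma ln_dist_circ_periodic: "ln (cmod (circ (t + 1) - z)) = ln (cmod (circ t - z))"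
  by (simp add: circ_add)

lemma integrable_ln_dist_circ_1: "(\<lambda>t. ln (cmod (circ t - 1))) integrable_on {0..1}"
proof (rule measurable_bounded_by_integrable_imp_integrable_real[where g = "\<lambda>t. ln 2 - ln t - ln (1 - t)"])
  show "(\<lambda>t. ln (cmod (circ t - 1))) \<in> borel_measurable (lebesgue_on {0..1})"
    by (intro measurable_restrict_space1 measurable_completion) measurable
  have "(\<lambda>t :: real. ln (1 - t)) integrable_on {0..1}"
    using integrable_on_ln has_integral_affinity[of "\<lambda>x :: real. ln x" _ 0 1 "-1" 1]
    by (auto simp: integrable_on_def)
  thus "(\<lambda>t :: real. ln 2 - ln t - ln (1 - t)) integrable_on {0..1}"
    by (intro Henstock_Kurzweil_Integration.integrable_diff integrable_on_ln integrable_const_ivl)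
next
  fix t :: real assume t: "t \<in> {0..1}"
  show "\<bar>ln (cmod (circ t - 1))\<bar> \<le> ln 2 - ln t - ln (1 - t)"
  proof (cases "t = 0 \<or> t = 1")
    case True thus ?thesis by auto
  next
    case False
    with t have t': "0 < t" "t < 1" by auto
    have lo: "0 < t * (1 - t)" "t * (1 - t) \<le> cmod (circ t - 1)"
      using t' cmod_circ_minus_1_ge[OF t] by auto
    have "cmod (circ t - 1) \<le> cmod (circ t) + cmod 1" by (rule norm_triangle_ineq4)
    hence "ln (cmod (circ t - 1)) \<le> ln 2" using lo by (intro ln_mono) auto
    moreover have "ln (t * (1 - t)) \<le> ln (cmod (circ t - 1))" using lo by (intro ln_mono) auto
    moreover have "ln (t * (1 - t)) = ln t + ln (1 - t)" using t' by (simp add: ln_mult)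
    moreover have "ln t \<le> 0" "ln (1 - t) \<le> 0" "ln 2 \<ge> (0 :: real)" using t' by auto
    ultimately show ?thesis by linarith
  qed
qed auto

lemma integrable_ln_dist_circ: "(\<lambda>t. ln (cmod (circ t - z))) integrable_on {0..1}"
proof (cases "cmod z = 1")
  case False
  hence "circ t \<noteq> z" for t using norm_circ[of t] by metis
  hence "continuous_on {0..1} (\<lambda>t. ln (cmod (circ t - z)))"
    by (intro continuous_intros continuous_on_ln) auto
  thus ?thesis by (rule integrable_continuous_interval)
next
  case True
  hence "cmod (inverse z) = 1" by (simp add: norm_inverse)
  then obtain c where c: "c \<in> {0..1}" "inverse z = circ c" by (rule circ_surj)
  have z: "circ c * z = 1" using True c(2) by (metis norm_zero right_inverse zero_neq_one mult.commute)
  have "ln (cmod (circ (t + c) - 1)) = ln (cmod (circ t - z))" for t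
  proof -
    have "circ (t + c) - 1 = circ c * (circ t - z)" using z by (simp add: circ_add algebra_simps)
    thus ?thesis by (simp add: norm_mult)
  qed
  with has_integral_periodic_shift[OF integrable_ln_dist_circ_1 ln_dist_circ_periodic c(1)]
  show ?thesis by (auto simp: integrable_on_def)
qed

definition circle_mean :: "complex \<Rightarrow> real" where
  "circle_mean z = integral {0..1} (\<lambda>t. ln (cmod (circ t - z)))"

lemma circle_mean_rotate:
  assumes "c \<in> {0..1}"
  shows "circle_mean (inverse (circ c) * z) = circle_mean z"
proof -
  have "((\<lambda>t. ln (cmod (circ (t + c) - z))) has_integral circle_mean z) {0..1}"
    unfolding circle_mean_def
    by (rule has_integral_periodic_shift[OF integrable_ln_dist_circ ln_dist_circ_periodic assms])
  moreover have "ln (cmod (circ (t + c) - z)) = ln (cmod (circ t - inverse (circ c) * z))" for t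
  proof -
    have "circ c \<noteq> 0" by (simp add: circ_def)
    hence "circ (t + c) - z = circ c * (circ t - inverse (circ c) * z)"
      by (simp add: circ_add algebra_simps)
    thus ?thesis by (simp add: norm_mult)
  qed
  ultimately show ?thesis unfolding circle_mean_def by (auto intro: integral_unique)
qed

text \<open>
  Because \<open>circ (2 t) - z\<^sup>2 = (circ t - z) (circ t + z)\<close>, squaring \<open>z\<close> doubles the mean. This determines
  the mean: iterated squaring sends a point inside the circle to the origin, near which the mean is
  bounded, and it fixes the point 1, from which the other points of the circle arise by rotation.
  Points outside are reflected in the circle.
\<close>

lemma circle_mean_square: "circle_mean (z\<^sup>2) = 2 * circle_mean z"
proof -
  have "((\<lambda>t. ln (cmod (circ (2 * t) - z\<^sup>2))) has_integral circle_mean (z\<^sup>2)) {0..1}"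
    unfolding circle_mean_def
    by (rule has_integral_periodic_double[OF integrable_ln_dist_circ ln_dist_circ_periodic])
  moreover have "((\<lambda>t. ln (cmod (circ (2 * t) - z\<^sup>2))) has_integral
      (circle_mean z + circle_mean (- z))) {0..1}"
  proof (rule has_integral_spike_finite)
    show "finite ({t \<in> {0..1}. circ t = z} \<union> {t \<in> {0..1}. circ t = - z})"
      using finite_circ_eq by blast
    show "((\<lambda>t. ln (cmod (circ t - z)) + ln (cmod (circ t - (- z)))) has_integral
      (circle_mean z + circle_mean (- z))) {0..1}"
      unfolding circle_mean_def by (intro has_integral_add integrable_integral integrable_ln_dist_circ)
    fix t assume t: "t \<in> {0..1} - ({t \<in> {0..1}. circ t = z} \<union> {t \<in> {0..1}. circ t = - z})"
    have eq: "circ (2 * t) - z\<^sup>2 = (circ t - z) * (circ t - (- z))"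
      by (simp only: circ_double) (simp add: algebra_simps power2_eq_square)
    show "ln (cmod (circ (2 * t) - z\<^sup>2)) = ln (cmod (circ t - z)) + ln (cmod (circ t - (- z)))"
    proof -
      have "circ t - z \<noteq> 0" "circ t - (- z) \<noteq> 0" using t by (auto simp only: right_minus_eq)
      hence "cmod (circ t - z) > 0" "cmod (circ t - (- z)) > 0" by (simp_all only: zero_less_norm_iff not_False_eq_True)
      from ln_mult_pos[OF this] show ?thesis by (simp only: eq norm_mult)
    qed
  qed
  moreover have "circle_mean (- z) = circle_mean z"
    using circle_mean_rotate[of "1/2" z] by (simp add: circ_half)
  ultimately show ?thesis by (auto dest: has_integral_unique)
qed

lemma circle_mean_power: "circle_mean (z ^ 2 ^ k) = 2 ^ k * circle_mean z"
proof (induction k)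
  case (Suc k)
  have "z ^ 2 ^ Suc k = (z ^ 2 ^ k)\<^sup>2" by (simp only: power_Suc power_mult [symmetric] mult.commute)
  thus ?case by (simp add: circle_mean_square Suc)
qed simp

lemma circle_mean_bound:
  assumes "cmod z \<le> 1/2"
  shows "\<bar>circle_mean z\<bar> \<le> ln 2"
proof -
  have "norm (integral (cbox 0 1) (\<lambda>t. ln (cmod (circ t - z)))) \<le> ln 2 * measure lborel (cbox 0 (1::real))"
  proof (rule integrable_bound)
    show "(\<lambda>t. ln (cmod (circ t - z))) integrable_on cbox 0 1" using integrable_ln_dist_circ by simp
    fix t :: real assume "t \<in> cbox 0 1"
    have "cmod (circ t - z) \<le> 1 + cmod z" using norm_triangle_ineq4[of "circ t" z] by simp
    moreover have lo: "cmod (circ t - z) \<ge> 1 - cmod z" using norm_triangle_ineq2[of "circ t" z] by simp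
    ultimately have "cmod (circ t - z) \<le> 2" "1/2 \<le> cmod (circ t - z)" using assms by linarith+
    hence "ln (cmod (circ t - z)) \<le> ln 2" "ln (1/2) \<le> ln (cmod (circ t - z))"
      by (auto intro!: ln_mono)
    moreover have "ln (1/2 :: real) = - ln 2" by (simp add: ln_div)
    ultimately show "norm (ln (cmod (circ t - z))) \<le> ln 2" by simp
  qed simp
  thus ?thesis by (simp add: circle_mean_def)
qed

lemma circle_mean_inside:
  assumes "cmod z < 1"
  shows "circle_mean z = 0"
proof (rule ccontr)
  assume ne: "circle_mean z \<noteq> 0"
  have lim: "(\<lambda>k. cmod z ^ k) \<longlonglongrightarrow> 0" using assms by (intro LIMSEQ_power_zero) auto
  hence "eventually (\<lambda>k. cmod z ^ k < 1/2) sequentially" by (rule order_tendstoD) simp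
  then obtain K where K: "\<And>k. k \<ge> K \<Longrightarrow> cmod z ^ k < 1/2" by (auto simp: eventually_sequentially)
  obtain N where N: "ln 2 / \<bar>circle_mean z\<bar> < 2 ^ N" using real_arch_pow[of 2] by auto
  let ?k = "max K N"
  have "?k < 2 ^ ?k" by (rule less_exp)
  hence "K \<le> 2 ^ ?k" by linarith
  hence "cmod (z ^ 2 ^ ?k) \<le> 1/2" using K[of "2 ^ ?k"] by (simp add: norm_power less_imp_le)
  hence "\<bar>2 ^ ?k * circle_mean z\<bar> \<le> ln 2"
    using circle_mean_bound[of "z ^ 2 ^ ?k"] by (simp add: circle_mean_power)
  hence "2 ^ ?k * \<bar>circle_mean z\<bar> \<le> ln 2" by (simp add: abs_mult)
  moreover have "(2::real) ^ N \<le> 2 ^ ?k" by (intro power_increasing) auto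
  hence "2 ^ N * \<bar>circle_mean z\<bar> \<le> 2 ^ ?k * \<bar>circle_mean z\<bar>" by (intro mult_right_mono) auto
  ultimately have "2 ^ N * \<bar>circle_mean z\<bar> \<le> ln 2" by linarith
  moreover have "ln 2 < 2 ^ N * \<bar>circle_mean z\<bar>" using N ne by (simp add: divide_less_eq)
  ultimately show False by linarith
qed

lemma circle_mean_eq: "circle_mean z = ln (max 1 (cmod z))"
proof -
  consider "cmod z < 1" | "cmod z = 1" | "cmod z > 1" by linarith
  thus ?thesis
  proof cases
    case 1
    thus ?thesis by (simp add: circle_mean_inside max_def)
  next
    case 2
    have "circle_mean 1 = 2 * circle_mean 1" using circle_mean_square[of 1] by simp
    hence "circle_mean 1 = 0" by simp
    moreover obtain c where "c \<in> {0..1}" "z = circ c" using 2 by (rule circ_surj)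
    hence "circle_mean 1 = circle_mean z"
      using circle_mean_rotate[of c z] by (simp add: circ_def)
    ultimately show ?thesis using 2 by simp
  next
    case 3
    hence z0: "z \<noteq> 0" by auto
    have eq: "ln (cmod (circ t - z)) = ln (cmod z) + ln (cmod (circ t - cnj (inverse z)))" for t
    proof -
      have "cnj (circ t) * circ t = 1"
        using complex_norm_square[of "circ t"] by (simp add: mult.commute)
      hence "circ t - z = - (circ t * z) * cnj (circ t - cnj (inverse z))"
        using z0 by (simp add: algebra_simps)
      hence "cmod (circ t - z) = cmod z * cmod (circ t - cnj (inverse z))"
        by (simp only: norm_mult norm_minus_cancel norm_circ complex_mod_cnj mult_1)
      moreover have "circ t \<noteq> cnj (inverse z)"
      proof
        assume "circ t = cnj (inverse z)"
        hence "cmod (circ t) = inverse (cmod z)" by (simp only: complex_mod_cnj norm_inverse)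
        with 3 show False by simp
      qed
      ultimately show ?thesis using z0 by (simp add: ln_mult_pos)
    qed
    have "((\<lambda>t. ln (cmod z) + ln (cmod (circ t - cnj (inverse z)))) has_integral
        ln (cmod z) + circle_mean (cnj (inverse z))) {0..1}"
      unfolding circle_mean_def
      using has_integral_const_real[of "ln (cmod z)" 0 1]
      by (intro has_integral_add integrable_integral integrable_ln_dist_circ) simp
    hence "circle_mean z = ln (cmod z) + circle_mean (cnj (inverse z))"
      unfolding circle_mean_def eq by (rule integral_unique)
    moreover have "circle_mean (cnj (inverse z)) = 0"
    proof (rule circle_mean_inside)
      show "cmod (cnj (inverse z)) < 1"
        using 3 by (simp only: complex_mod_cnj norm_inverse) (simp add: inverse_less_1_iff)
    qed
    ultimately show ?thesis using 3 by simp
  qed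
qed

lemma log_mahler_measure_eq:
  assumes "P \<noteq> 0"
  shows "log_mahler_measure P = ln (mahler_measure P)"
proof -
  define c where "c = complex_of_int (lead_coeff P)"
  define as where "as = complex_roots_int P"
  have c0: "c \<noteq> 0" using assms by (simp add: c_def)
  let ?P = "of_int_poly P :: complex poly"
  have P: "?P = smult c (\<Prod>a\<leftarrow>as. [:-a, 1:])"
    unfolding c_def as_def by (rule complex_roots_int(1)[symmetric])
  have polyP: "poly ?P z = c * (\<Prod>a\<leftarrow>as. z - a)" for z
    unfolding P by (simp add: poly_prod_list o_def)
  have mm: "mahler_measure P = cmod c * (\<Prod>a\<leftarrow>as. max 1 (cmod a))"
    unfolding mahler_measure_def P by (rule mahler_measure_poly_explicit)
  have ln_mm: "ln (cmod c * (\<Prod>a\<leftarrow>bs. max 1 (cmod a))) = ln (cmod c) + (\<Sum>a\<leftarrow>bs. ln (max 1 (cmod a)))" for bs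
  proof -
    have "(\<Prod>a\<leftarrow>bs. max 1 (cmod a)) > 0 \<and> ln (\<Prod>a\<leftarrow>bs. max 1 (cmod a)) = (\<Sum>a\<leftarrow>bs. ln (max 1 (cmod a)))"
      by (induction bs) (auto simp: ln_mult_pos zero_less_mult_iff less_max_iff_disj)
    thus ?thesis using c0 by (simp add: ln_mult_pos)
  qed
  let ?f = "\<lambda>t. ln (cmod (poly ?P (circ t)))"
  have int_sum: "((\<lambda>t. ln (cmod c) + (\<Sum>a\<leftarrow>bs. ln (cmod (circ t - a)))) has_integral
      ln (cmod c) + (\<Sum>a\<leftarrow>bs. ln (max 1 (cmod a)))) {0..1}" for bs
  proof (induction bs)
    case Nil
    show ?case using has_integral_const_real[of "ln (cmod c)" 0 1] by simp
  next
    case (Cons b bs)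
    have "((\<lambda>t. ln (cmod (circ t - b))) has_integral circle_mean b) {0..1}"
      unfolding circle_mean_def by (rule integrable_integral) (rule integrable_ln_dist_circ)
    from has_integral_add[OF this Cons.IH] show ?case
      by (simp add: circle_mean_eq algebra_simps)
  qed
  have has_int: "(?f has_integral ln (mahler_measure P)) {0..1}"
    unfolding mm ln_mm
  proof (rule has_integral_spike_finite[OF _ _ int_sum])
    show "finite (\<Union>a\<in>set as. {t \<in> {0..1}. circ t = a})" using finite_circ_eq by blast
    fix t assume t: "t \<in> {0..1} - (\<Union>a\<in>set as. {t \<in> {0..1}. circ t = a})"
    have "(\<Prod>a\<leftarrow>bs. circ t - a) \<noteq> 0 \<and>
        ln (cmod (\<Prod>a\<leftarrow>bs. circ t - a)) = (\<Sum>a\<leftarrow>bs. ln (cmod (circ t - a)))" if "set bs \<subseteq> set as" for bs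
      using that
    proof (induction bs)
      case (Cons b bs)
      have "circ t - b \<noteq> 0" using t Cons.prems by auto
      with Cons show ?case by (auto simp: norm_mult ln_mult_pos simp del: prod_cmod)
    qed auto
    from this[of as] c0 show "?f t = ln (cmod c) + (\<Sum>a\<leftarrow>as. ln (cmod (circ t - a)))"
      by (simp add: polyP norm_mult ln_mult_pos del: prod_cmod)
  qed
  have cont: "continuous_on {0..1} (\<lambda>t. poly ?P (circ t))" by (intro continuous_intros)
  obtain B where B: "\<And>t. t \<in> {0..1} \<Longrightarrow> cmod (poly ?P (circ t)) \<le> B"
    using compact_imp_bounded[OF compact_continuous_image[OF cont compact_Icc]]
    unfolding bounded_iff by (auto simp only: ball_simps)
  define C where "C = ln (max 1 B)"
  have le: "?f t \<le> C" if "t \<in> {0..1}" for t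
  proof (cases "poly ?P (circ t) = 0")
    case False
    thus ?thesis using B[OF that] unfolding C_def by (intro ln_mono) auto
  qed (auto simp: C_def)
  have "(\<lambda>t. C - ?f t) integrable_on {0..1}"
    using has_int by (intro Henstock_Kurzweil_Integration.integrable_diff integrable_const_ivl) auto
  hence "(\<lambda>t. C - ?f t) absolutely_integrable_on {0..1}"
    using le by (intro nonnegative_absolutely_integrable_1) auto
  moreover have "(\<lambda>t. C) absolutely_integrable_on {0..1::real}"
    by (rule absolutely_integrable_on_const) simp
  ultimately have "(\<lambda>t. C - (C - ?f t)) absolutely_integrable_on {0..1}"
    by (rule set_integral_diff(1)[rotated])
  hence abs_int: "integrable lebesgue (\<lambda>t. indicator {0..1} t *\<^sub>R ?f t)"
    unfolding set_integrable_def by simp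
  have meas: "(\<lambda>t. cmod (poly ?P (circ t))) \<in> borel_measurable lborel"
    using borel_measurable_continuous_onI[of "\<lambda>t. cmod (poly ?P (circ t))"]
    by (simp add: continuous_intros)
  have "(\<lambda>t. indicator {0..1} t *\<^sub>R ?f t) \<in> borel_measurable lborel"
    by (intro borel_measurable_scaleR borel_measurable_ln meas borel_measurable_indicator) simp
  from integrable_completion[OF this] abs_int have "set_integrable lborel {0..1} ?f"
    unfolding set_integrable_def by blast
  hence "(LINT t:{0..1}|lborel. ?f t) = integral {0..1} ?f"
    by (rule set_borel_integral_eq_integral(2))
  also have "\<dots> = ln (mahler_measure P)" using has_int by (rule integral_unique)
  finally show ?thesis unfolding log_mahler_measure_def circ_def .
qed

section \<open>The resultant as a determinant\<close>

text \<open>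
  Determinants are taken of matrices whose rows are the coefficients of given polynomials; a change of
  basis of the polynomials then becomes a product of matrices.
\<close>

definition coeff_mat :: "nat \<Rightarrow> (nat \<Rightarrow> 'a poly) \<Rightarrow> 'a :: comm_ring_1 mat" where
  "coeff_mat N g = mat N N (\<lambda>(i, j). coeff (g i) j)"

lemma coeff_mat_carrier [simp]: "coeff_mat N g \<in> carrier_mat N N"
  by (simp add: coeff_mat_def)

lemma coeff_mat_mult:
  assumes "\<And>i. i < N \<Longrightarrow> g i = (\<Sum>k<N. smult (c i k) (h k))"
  shows "coeff_mat N g = mat N N (\<lambda>(i, k). c i k) * coeff_mat N h"
proof (rule eq_matI)
  fix i j assume ij: "i < dim_row (mat N N (\<lambda>(i, k). c i k) * coeff_mat N h)"
    "j < dim_col (mat N N (\<lambda>(i, k). c i k) * coeff_mat N h)"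
  hence ij': "i < N" "j < N" by (simp_all add: coeff_mat_def)
  have "coeff (g i) j = (\<Sum>k<N. c i k * coeff (h k) j)"
    by (simp add: assms[OF ij'(1)] coeff_sum)
  thus "coeff_mat N g $$ (i, j) = (mat N N (\<lambda>(i, k). c i k) * coeff_mat N h) $$ (i, j)"
    using ij' by (simp add: coeff_mat_def scalar_prod_def atLeast0LessThan)
qed (simp_all add: coeff_mat_def)

text \<open>
  Stated by coefficients, because these are the entries of the triangular matrices below.
\<close>

definition monic_of_degree :: "nat \<Rightarrow> 'a :: comm_ring_1 poly \<Rightarrow> bool" where
  "monic_of_degree k f \<longleftrightarrow> coeff f k = 1 \<and> (\<forall>j>k. coeff f j = 0)"

lemma monic_of_degree_mult:
  fixes f g :: "'a :: idom poly"
  assumes "monic_of_degree k f" "monic_of_degree l g"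
  shows "monic_of_degree (k + l) (f * g)"
proof -
  have char: "monic_of_degree k f \<longleftrightarrow> monic f \<and> degree f = k" for k and f :: "'a poly"
  proof
    assume *: "monic_of_degree k f"
    hence "degree f = k"
      by (intro antisym degree_le le_degree) (auto simp: monic_of_degree_def)
    with * show "monic f \<and> degree f = k" by (simp add: monic_of_degree_def)
  qed (auto simp: monic_of_degree_def coeff_eq_0)
  have "f \<noteq> 0" "g \<noteq> 0" using assms by (auto simp: monic_of_degree_def)
  with assms show ?thesis
    unfolding char by (simp add: degree_mult_eq lead_coeff_mult del: leading_coeff_0_iff)
      (metis lead_coeff_mult mult_1 degree_mult_eq)
qed

lemma monic_of_degree_monom: "monic_of_degree k (monom 1 k)"
  by (simp add: monic_of_degree_def)

lemma monic_of_degree_linear_prod: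
  fixes \<alpha> :: "nat \<Rightarrow> 'a :: idom"
  shows "m \<le> k \<Longrightarrow> monic_of_degree (k - m) (\<Prod>l\<in>{m..<k}. [:- \<alpha> l, 1:])"
proof (induction k rule: dec_induct)
  case base
  show ?case by (simp add: monic_of_degree_def)
next
  case (step k)
  have "monic_of_degree 1 [:- \<alpha> k, 1:]"
    by (auto simp: monic_of_degree_def coeff_pCons split: nat.splits)
  from monic_of_degree_mult[OF step.IH this] step.hyps show ?case
    by (simp add: Suc_diff_le prod.atLeastLessThan_Suc mult.commute)
qed

lemma monic_basis_expansion:
  fixes e :: "nat \<Rightarrow> 'a :: comm_ring_1 poly"
  assumes "\<And>k. k < N \<Longrightarrow> monic_of_degree k (e k)" and "\<And>j. j \<ge> N \<Longrightarrow> coeff S j = 0"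
  shows "\<exists>c. S = (\<Sum>k<N. smult (c k) (e k))"
  using assms
proof (induction N arbitrary: S)
  case 0
  hence "S = 0" by (intro poly_eqI) simp
  thus ?case by simp
next
  case (Suc M)
  define S' where "S' = S - smult (coeff S M) (e M)"
  have "coeff S' j = 0" if "j \<ge> M" for j
  proof (cases "j = M")
    case True
    thus ?thesis using Suc.prems(1)[of M] by (simp add: S'_def monic_of_degree_def)
  next
    case False
    thus ?thesis using that Suc.prems(1)[of M] Suc.prems(2)[of j] by (simp add: S'_def monic_of_degree_def)
  qed
  with Suc.IH[of S'] Suc.prems(1) obtain c where c: "S' = (\<Sum>k<M. smult (c k) (e k))" by auto
  have "S = S' + smult (coeff S M) (e M)" by (simp add: S'_def)
  also have "\<dots> = (\<Sum>k<Suc M. smult ((c(M := coeff S M)) k) (e k))"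
    by (simp add: c)
  finally show ?case by blast
qed

definition sylvester_rows :: "nat \<Rightarrow> 'a poly \<Rightarrow> 'a poly \<Rightarrow> nat \<Rightarrow> 'a :: comm_ring_1 poly" where
  "sylvester_rows n P F i = (if i < n then monom 1 i * P else monom 1 (i - n) * F)"

lemma det_unit_lower:
  fixes A :: "'a :: comm_ring_1 mat"
  assumes "A \<in> carrier_mat N N" "\<And>i j. i < j \<Longrightarrow> j < N \<Longrightarrow> A $$ (i, j) = 0"
    "\<And>i. i < N \<Longrightarrow> A $$ (i, i) = 1"
  shows "det A = 1"
proof -
  have "det A = prod_list (diag_mat A)" using assms(2,1) by (rule det_lower_triangular)
  also have "diag_mat A = map (\<lambda>_. 1) [0..<N]" using assms by (auto simp: diag_mat_def)
  also have "prod_list (map (\<lambda>_. 1) [0..<N]) = (1 :: 'a)" by (induction N) auto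
  finally show ?thesis .
qed

text \<open>
  The product formula for the resultant. The rows are expressed in the basis consisting of the partial
  products of the linear factors of \<open>F\<close> and of the multiples of the full product. After a unipotent
  change of the rows that come from \<open>P\<close>, the matrix is triangular with the values of \<open>P\<close> at the roots
  of \<open>F\<close> and its leading coefficient on the diagonal.
\<close>

lemma det_sylvester_rows:
  fixes P :: "'a :: idom poly" and \<alpha> :: "nat \<Rightarrow> 'a"
  assumes P: "degree P \<le> d"
  shows "det (coeff_mat (n + d) (sylvester_rows n P (smult b (\<Prod>l\<in>{0..<n}. [:- \<alpha> l, 1:])))) =
    (\<Prod>i<n. poly P (\<alpha> i)) * b ^ d"
proof -
  define F where "F = smult b (\<Prod>l\<in>{0..<n}. [:- \<alpha> l, 1:])"
  define N where "N = n + d"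
  define L where "L m k = (\<Prod>l\<in>{m..<k}. [:- \<alpha> l, 1:])" for m k
  define e where "e m k = (if k < n then L m k else monom 1 (k - n) * L m n)" for m k
  define g where "g = sylvester_rows n P F"
  define g' where "g' i = (if i < n then L 0 i * P else g i)" for i
  have F: "F = smult b (L 0 n)" by (simp add: F_def L_def)
  have L_split: "L 0 k = L 0 m * L m k" if "m \<le> k" for m k
    unfolding L_def using that by (intro prod.atLeastLessThan_concat [symmetric]) auto
  have e_monic: "monic_of_degree (k - m) (e m k)" if "m \<le> n" "m \<le> k" "k < N" for m k
  proof (cases "k < n")
    case True
    thus ?thesis using that monic_of_degree_linear_prod[of m k \<alpha>] by (simp add: e_def L_def)
  next
    case False
    have "monic_of_degree ((k - n) + (n - m)) (monom 1 (k - n) * L m n)"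
      unfolding L_def using that by (intro monic_of_degree_mult monic_of_degree_monom monic_of_degree_linear_prod)
    with False that show ?thesis by (simp add: e_def)
  qed
  have e_split: "e 0 k = L 0 m * e m k" if "m \<le> n" "m \<le> k" for m k
    using that L_split[of m k] L_split[of m n] by (auto simp: e_def mult_ac)

  \<comment> \<open>The change from the rows \<open>X ^ i * P\<close> to the rows \<open>L 0 i * P\<close> is unipotent.\<close>
  define u where "u i k = (if i < n then coeff (L 0 i) k else if k = i then 1 else 0)" for i k
  have L0: "coeff (L 0 i) i = 1" "\<And>k. k > i \<Longrightarrow> coeff (L 0 i) k = 0" for i
    using monic_of_degree_linear_prod[of 0 i \<alpha>] by (auto simp: L_def monic_of_degree_def)
  have g'_u: "g' i = (\<Sum>k<N. smult (u i k) (g k))" if "i < N" for i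
  proof (cases "i < n")
    case True
    have "degree (L 0 i) \<le> i" using L0(2) by (intro degree_le) auto
    hence "L 0 i = (\<Sum>k\<le>i. monom (coeff (L 0 i) k) k)"
      by (rule poly_as_sum_of_monoms' [symmetric])
    hence "L 0 i * P = (\<Sum>k\<le>i. monom (coeff (L 0 i) k) k) * P" by (rule arg_cong)
    also have "\<dots> = (\<Sum>k\<le>i. smult (u i k) (g k))"
      unfolding sum_distrib_right
    proof (rule sum.cong)
      fix k assume "k \<in> {..i}"
      hence "u i k = coeff (L 0 i) k" "g k = monom 1 k * P"
        using True by (simp_all add: u_def g_def sylvester_rows_def)
      moreover have "monom (coeff (L 0 i) k) k = smult (coeff (L 0 i) k) (monom 1 k)"
        by (simp add: smult_monom)
      ultimately show "monom (coeff (L 0 i) k) k * P = smult (u i k) (g k)"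
        by (simp only: mult_smult_left)
    qed simp
    also have "\<dots> = (\<Sum>k<N. smult (u i k) (g k))"
      using True that L0(2) by (intro sum.mono_neutral_left) (auto simp: u_def)
    finally show ?thesis using True by (simp add: g'_def)
  next
    case False
    have "(\<Sum>k<N. smult (u i k) (g k)) = (\<Sum>k\<in>{i}. smult (u i k) (g k))"
      using False that by (intro sum.mono_neutral_right) (auto simp: u_def)
    thus ?thesis using False by (simp add: g'_def u_def)
  qed
  have det_u: "det (mat N N (\<lambda>(i, k). u i k)) = 1"
    by (rule det_unit_lower[of _ N]) (auto simp: u_def L0)

  \<comment> \<open>With respect to the basis \<open>e 0\<close> the new rows are triangular, because
    \<open>P\<close> is congruent to its value at \<open>\<alpha> i\<close> modulo the next linear factor.\<close>
  define D where "D i = (if i < n then poly P (\<alpha> i) else b)" for i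
  have ex_row: "\<exists>t. (\<forall>k<i. t k = 0) \<and> t i = D i \<and> g' i = (\<Sum>k<N. smult (t k) (e 0 k))" if "i < N" for i
  proof (cases "i < n")
    case True
    define S where "S = synthetic_div P (\<alpha> i)"
    define m where "m = Suc i"
    have m: "m \<le> n" "m \<le> N" using True by (auto simp: m_def N_def)
    have S0: "coeff S j = 0" if "j \<ge> N - m" for j
    proof (cases "degree P = 0")
      case True
      hence "S = 0" using synthetic_div_eq_0_iff[of P "\<alpha> i"] by (simp add: S_def)
      thus ?thesis by simp
    next
      case False
      hence "degree S < d" using P by (simp add: S_def degree_synthetic_div)
      moreover have "d \<le> j" using that True by (simp add: N_def m_def)
      ultimately show ?thesis by (intro coeff_eq_0) simp
    qed
    have "\<exists>c. S = (\<Sum>k<N - m. smult (c k) (e m (m + k)))"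
    proof (rule monic_basis_expansion)
      fix k assume "k < N - m"
      thus "monic_of_degree k (e m (m + k))" using e_monic[of m "m + k"] m by simp
    qed (use S0 in auto)
    then obtain c where c: "S = (\<Sum>k<N - m. smult (c k) (e m (m + k)))" by blast
    define t where "t k = (if k < i then 0 else if k = i then D i else c (k - m))" for k
    have "P = [:- \<alpha> i, 1:] * S + [:poly P (\<alpha> i):]"
      unfolding S_def by (rule synthetic_div_correct' [symmetric])
    hence "L 0 i * P = L 0 i * ([:- \<alpha> i, 1:] * S + [:poly P (\<alpha> i):])" by (rule arg_cong)
    also have "\<dots> = (L 0 i * [:- \<alpha> i, 1:]) * S + smult (D i) (L 0 i)"
    proof -
      have "L 0 i * [:poly P (\<alpha> i):] = smult (D i) (L 0 i)" using True by (simp add: D_def)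
      thus ?thesis by (simp only: distrib_left mult.assoc)
    qed
    also have "L 0 i * [:- \<alpha> i, 1:] = L 0 m"
      by (simp add: L_def m_def prod.atLeastLessThan_Suc del: mult_pCons_right mult_pCons_left)
    also have "L 0 m * S = (\<Sum>k<N - m. smult (c k) (e 0 (m + k)))"
      unfolding c sum_distrib_left using m by (intro sum.cong) (auto simp: e_split[of m])
    also have "\<dots> = (\<Sum>k\<in>{m..<N}. smult (t k) (e 0 k))"
      using m by (intro sum.reindex_bij_witness[of _ "\<lambda>k. k - m" "\<lambda>k. m + k"]) (auto simp: t_def m_def)
    also have "\<dots> + smult (D i) (L 0 i) = (\<Sum>k\<in>{i..<N}. smult (t k) (e 0 k))"
      using True that by (subst sum.atLeast_Suc_lessThan) (auto simp: t_def e_def m_def)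
    also have "\<dots> = (\<Sum>k<N. smult (t k) (e 0 k))"
      by (intro sum.mono_neutral_left) (auto simp: t_def)
    finally have "g' i = (\<Sum>k<N. smult (t k) (e 0 k))" using True by (simp add: g'_def)
    moreover have "(\<forall>k<i. t k = 0) \<and> t i = D i" by (simp add: t_def)
    ultimately show ?thesis by blast
  next
    case False
    let ?t = "\<lambda>k. if k = i then D i else 0"
    have "(\<Sum>k<N. smult (?t k) (e 0 k)) = (\<Sum>k\<in>{i}. smult (?t k) (e 0 k))"
      using that by (intro sum.mono_neutral_right) auto
    also have "\<dots> = g' i"
      using False by (simp add: g'_def g_def sylvester_rows_def D_def e_def F)
    finally show ?thesis by (intro exI[of _ ?t]) auto
  qed
  have "\<forall>i. \<exists>t. i < N \<longrightarrow> (\<forall>k<i. t k = 0) \<and> t i = D i \<and> g' i = (\<Sum>k<N. smult (t k) (e 0 k))"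
    using ex_row by blast
  from choice[OF this] obtain t where t: "\<And>i. i < N \<Longrightarrow> (\<forall>k<i. t i k = 0) \<and> t i i = D i \<and>
      g' i = (\<Sum>k<N. smult (t i k) (e 0 k))" by blast
  have t0: "t i k = 0" if "k < i" "i < N" for i k using t[OF that(2)] that(1) by blast
  have t1: "t i i = D i" if "i < N" for i using t[OF that] by blast
  have t2: "g' i = (\<Sum>k<N. smult (t i k) (e 0 k))" if "i < N" for i using t[OF that] by blast
  let ?T = "mat N N (\<lambda>(i, k). t i k)"
  have "upper_triangular ?T" by (auto simp: upper_triangular_def t0)
  hence "det ?T = prod_list (diag_mat ?T)" by (rule det_upper_triangular[where n = N]) simp
  also have "diag_mat ?T = map D [0..<N]" by (auto simp: diag_mat_def t1)
  also have "prod_list (map D [0..<N]) = (\<Prod>i<N. D i)"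
    by (simp add: prod.list_conv_set_nth lessThan_atLeast0)
  also have "\<dots> = (\<Prod>i<n. D i) * (\<Prod>i\<in>{n..<N}. D i)"
    unfolding N_def by (simp add: lessThan_atLeast0 prod.atLeastLessThan_concat)
  also have "\<dots> = (\<Prod>i<n. poly P (\<alpha> i)) * b ^ d"
    by (simp add: D_def N_def)
  finally have det_T: "det ?T = (\<Prod>i<n. poly P (\<alpha> i)) * b ^ d" .
  have e0: "coeff (e 0 k) k = 1" "coeff (e 0 k) j = 0" if "k < N" "j > k" for j k
    using e_monic[of 0 k] that by (simp_all add: monic_of_degree_def)
  have e01: "coeff (e 0 k) k = 1" if "k < N" for k using e0(1)[OF that lessI] .
  have det_e: "det (coeff_mat N (e 0)) = 1"
  proof (rule det_unit_lower[of _ N])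
    have entry: "coeff_mat N (e 0) $$ (i, j) = coeff (e 0 i) j" if "i < N" "j < N" for i j
      unfolding coeff_mat_def using that by (subst index_mat) simp_all
    show "coeff_mat N (e 0) $$ (i, j) = 0" if "i < j" "j < N" for i j
      using entry[of i j] e0(2)[of i j] less_trans[OF that] that by (simp only:)
    show "coeff_mat N (e 0) $$ (i, i) = 1" if "i < N" for i
      using entry[of i i] e01[of i] that by (simp only:)
  qed (rule coeff_mat_carrier)
  have 1: "coeff_mat N g' = mat N N (\<lambda>(i, k). u i k) * coeff_mat N g"
    by (rule coeff_mat_mult) (rule g'_u)
  have 2: "coeff_mat N g' = ?T * coeff_mat N (e 0)"
    by (rule coeff_mat_mult) (rule t2)
  have "det (coeff_mat N g') = det (coeff_mat N g)"
    unfolding 1 by (subst det_mult[OF mat_carrier coeff_mat_carrier]) (simp only: det_u mult_1)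
  moreover have "det (coeff_mat N g') = (\<Prod>i<n. poly P (\<alpha> i)) * b ^ d"
    unfolding 2 by (subst det_mult[OF mat_carrier coeff_mat_carrier]) (simp only: det_T det_e mult_1_right)
  ultimately have "det (coeff_mat N g) = (\<Prod>i<n. poly P (\<alpha> i)) * b ^ d" by (simp only:)
  thus ?thesis by (simp only: g_def N_def F_def)
qed

text \<open>
  Cramer's rule: the first row of the adjugate matrix combines the rows to the constant polynomial
  given by the determinant.
\<close>

lemma det_sylvester_rows_bezout:
  fixes P F :: "'a :: idom poly"
  assumes "degree P \<le> d" "degree F \<le> n" "n + d > 0" "d > 0"
  shows "\<exists>A B. [:det (coeff_mat (n + d) (sylvester_rows n P F)):] = A * P + B * F"
proof -
  define N where "N = n + d"
  define g where "g = sylvester_rows n P F"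
  define M where "M = coeff_mat N g"
  define c where "c k = adj_mat M $$ (0, k)" for k
  have M: "M \<in> carrier_mat N N" by (simp add: M_def)
  have N: "N > 0" using assms by (simp add: N_def)
  have adj: "adj_mat M \<in> carrier_mat N N" "adj_mat M * M = det M \<cdot>\<^sub>m 1\<^sub>m N"
    using adj_mat[OF M] by auto
  have "[:det M:] = (\<Sum>k<N. smult (c k) (g k))"
  proof (rule poly_eqI)
    fix j
    show "coeff [:det M:] j = coeff (\<Sum>k<N. smult (c k) (g k)) j"
    proof (cases "j < N")
      case True
      have "(adj_mat M * M) $$ (0, j) = (\<Sum>k<N. c k * coeff (g k) j)"
        using adj(1) True N by (simp add: M_def coeff_mat_def scalar_prod_def c_def atLeast0LessThan)
      thus ?thesis using True N
        by (cases j) (simp_all add: adj(2) coeff_sum)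
    next
      case False
      have "coeff (g k) j = 0" if "k < N" for k
      proof (rule coeff_eq_0)
        have "degree (g k) < N"
        proof (cases "k < n")
          case True
          have "degree (monom 1 k * P) \<le> k + d"
            using degree_mult_le[of "monom 1 k" P] degree_monom_le[of "1::'a" k] assms by linarith
          thus ?thesis using True by (simp add: g_def sylvester_rows_def N_def)
        next
          case False
          have "degree (monom 1 (k - n) * F) \<le> (k - n) + n"
            using degree_mult_le[of "monom 1 (k - n)" F] degree_monom_le[of "1::'a" "k - n"] assms by linarith
          thus ?thesis using False that by (simp add: g_def sylvester_rows_def)
        qed
        thus "degree (g k) < j" using False by linarith
      qed
      thus ?thesis using False N by (simp add: coeff_sum coeff_pCons split: nat.splits)
    qed
  qed
  also have "\<dots> = (\<Sum>k\<in>{..<n}. smult (c k) (g k)) + (\<Sum>k\<in>{n..<N}. smult (c k) (g k))"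
    unfolding N_def by (simp add: lessThan_atLeast0 sum.atLeastLessThan_concat)
  also have "(\<Sum>k\<in>{..<n}. smult (c k) (g k)) = (\<Sum>k<n. smult (c k) (monom 1 k)) * P"
    unfolding sum_distrib_right by (intro sum.cong) (auto simp: g_def sylvester_rows_def)
  also have "(\<Sum>k\<in>{n..<N}. smult (c k) (g k)) = (\<Sum>k\<in>{n..<N}. smult (c k) (monom 1 (k - n))) * F"
    unfolding sum_distrib_right by (intro sum.cong) (auto simp: g_def sylvester_rows_def)
  finally show ?thesis unfolding M_def N_def g_def by blast
qed

lemma mahler_measure_via_roots:
  "mahler_measure F = \<bar>real_of_int (lead_coeff F)\<bar> * (\<Prod>a\<leftarrow>complex_roots_int F. max 1 (cmod a))"
  unfolding mahler_measure_def mahler_measure_poly_def complex_roots_int_def by simp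

lemma cmod_poly_le_mahler_measure:
  fixes P :: "int poly"
  shows "cmod (poly (of_int_poly P) z) \<le> 2 ^ degree P * max 1 (cmod z) ^ degree P * mahler_measure P"
proof -
  let ?as = "complex_roots_int P"
  have fac: "cmod (\<Prod>a\<leftarrow>as. z - a) \<le> 2 ^ length as * max 1 (cmod z) ^ length as * (\<Prod>a\<leftarrow>as. max 1 (cmod a))"
    for as
  proof (induction as)
    case (Cons a as)
    have m: "1 \<le> max 1 (cmod z)" "1 \<le> max 1 (cmod a)" by auto
    have "cmod (z - a) \<le> cmod z + cmod a" by (rule norm_triangle_ineq4)
    also have "\<dots> \<le> max 1 (cmod z) + max 1 (cmod a)" by (intro add_mono) auto
    also have "\<dots> \<le> 2 * (max 1 (cmod z) * max 1 (cmod a))"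
    proof -
      have "max 1 (cmod z) \<le> max 1 (cmod z) * max 1 (cmod a)"
        using mult_left_mono[OF m(2), of "max 1 (cmod z)"] m by linarith
      moreover have "max 1 (cmod a) \<le> max 1 (cmod z) * max 1 (cmod a)"
        using mult_right_mono[OF m(1), of "max 1 (cmod a)"] m by linarith
      ultimately show ?thesis by linarith
    qed
    finally have 1: "cmod (z - a) \<le> 2 * (max 1 (cmod z) * max 1 (cmod a))" .
    have "cmod ((z - a) * (\<Prod>a\<leftarrow>as. z - a)) \<le> (2 * (max 1 (cmod z) * max 1 (cmod a))) *
        (2 ^ length as * max 1 (cmod z) ^ length as * (\<Prod>a\<leftarrow>as. max 1 (cmod a)))"
      unfolding norm_mult by (rule mult_mono[OF 1 Cons.IH]) (rule norm_ge_zero | simp)+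
    thus ?case by (simp only: list.map prod_list.Cons length_Cons power_Suc mult_ac)
  qed simp
  have "poly (of_int_poly P) z = of_int (lead_coeff P) * (\<Prod>a\<leftarrow>?as. z - a)"
    by (subst complex_roots_int(1)[symmetric]) (simp add: poly_prod_list o_def)
  hence "cmod (poly (of_int_poly P) z) = \<bar>real_of_int (lead_coeff P)\<bar> * cmod (\<Prod>a\<leftarrow>?as. z - a)"
    by (simp only: norm_mult norm_of_int)
  also have "\<dots> \<le> \<bar>real_of_int (lead_coeff P)\<bar> *
      (2 ^ length ?as * max 1 (cmod z) ^ length ?as * (\<Prod>a\<leftarrow>?as. max 1 (cmod a)))"
    by (intro mult_left_mono fac) auto
  finally show ?thesis
    unfolding mahler_measure_via_roots complex_roots_int(2) by (simp only: mult_ac)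
qed

text \<open>
  The witness is the resultant of \<open>P\<close> and \<open>F\<close>. The product formula bounds it in terms of the Mahler
  measures themselves. Hadamard's inequality would give coefficient norms instead, which are too large
  because \<open>P\<close> enters with the exponent \<open>degree F\<close>.
\<close>

lemma ex_bezout_int_le_mahler:
  fixes P F :: "int poly"
  assumes P: "irreducible P" "degree P > 0" and F: "\<not> P dvd F"
  shows "\<exists>R A B. R \<noteq> 0 \<and> [:R:] = A * P + B * F \<and>
    \<bar>real_of_int R\<bar> \<le> 2 ^ (degree F * degree P) * mahler_measure P ^ degree F * mahler_measure F ^ degree P"
proof -
  define n d where "n = degree F" and "d = degree P"
  define as where "as = complex_roots_int F"
  define b where "b = lead_coeff F"
  define R where "R = det (coeff_mat (n + d) (sylvester_rows n P F))"
  have F0: "F \<noteq> 0" using F by auto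
  have len: "length as = n" by (simp add: as_def n_def complex_roots_int(2))
  obtain A B where AB: "[:R:] = A * P + B * F"
    using det_sylvester_rows_bezout[of P d F n] P unfolding R_def n_def d_def by auto
  have Fc: "(of_int_poly F :: complex poly) = smult (of_int b) (\<Prod>l\<in>{0..<n}. [:- (as ! l), 1:])"
    unfolding b_def complex_roots_int(1)[of F, folded as_def, symmetric] len[symmetric]
    by (simp add: prod.list_conv_set_nth)
  have "complex_of_int R = det (map_mat of_int (coeff_mat (n + d) (sylvester_rows n P F)))"
    unfolding R_def by (rule of_int_hom.hom_det[symmetric])
  also have "map_mat of_int (coeff_mat (n + d) (sylvester_rows n P F)) =
      coeff_mat (n + d) (sylvester_rows n (of_int_poly P :: complex poly) (of_int_poly F))"
  proof (rule eq_matI)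
    fix i j assume "i < dim_row (coeff_mat (n + d) (sylvester_rows n (of_int_poly P :: complex poly) (of_int_poly F)))"
      "j < dim_col (coeff_mat (n + d) (sylvester_rows n (of_int_poly P :: complex poly) (of_int_poly F)))"
    hence "i < n + d" "j < n + d" by (simp_all add: coeff_mat_def)
    thus "map_mat of_int (coeff_mat (n + d) (sylvester_rows n P F)) $$ (i, j) =
      coeff_mat (n + d) (sylvester_rows n (of_int_poly P :: complex poly) (of_int_poly F)) $$ (i, j)"
      by (auto simp: coeff_mat_def sylvester_rows_def coeff_monom_mult)
  qed (simp_all add: coeff_mat_def)
  also have "det \<dots> = (\<Prod>i<n. poly (of_int_poly P) (as ! i)) * of_int b ^ d"
    unfolding Fc by (rule det_sylvester_rows) (simp add: d_def)
  finally have R: "complex_of_int R = (\<Prod>i<n. poly (of_int_poly P) (as ! i)) * of_int b ^ d" .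
  have b0: "b \<noteq> 0" using F0 by (simp add: b_def)
  have "R \<noteq> 0"
  proof
    assume "R = 0"
    with R b0 obtain i where i: "i < n" "poly (of_int_poly P) (as ! i) = 0" by auto
    have "poly (of_int_poly F) (as ! i) = (0 :: complex)"
      unfolding Fc using i(1) by (auto simp: poly_prod)
    hence "P dvd F" using irreducible_int_poly_dvd_if_common_root[OF P(1) i(2)] by blast
    with F show False by blast
  qed
  moreover have "\<bar>real_of_int R\<bar> \<le> 2 ^ (n * d) * mahler_measure P ^ n * mahler_measure F ^ d"
  proof -
    have "\<bar>real_of_int R\<bar> = cmod (complex_of_int R)" by simp
    also have "\<dots> = (\<Prod>i<n. cmod (poly (of_int_poly P) (as ! i))) * \<bar>real_of_int b\<bar> ^ d"
      unfolding R by (simp add: norm_mult norm_power prod_norm)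
    also have "\<dots> \<le> (\<Prod>i<n. 2 ^ d * max 1 (cmod (as ! i)) ^ d * mahler_measure P) * \<bar>real_of_int b\<bar> ^ d"
      using cmod_poly_le_mahler_measure[of P] unfolding d_def by (intro mult_right_mono prod_mono) auto
    also have "\<dots> = 2 ^ (n * d) * mahler_measure P ^ n * (\<bar>real_of_int b\<bar> * (\<Prod>i<n. max 1 (cmod (as ! i)))) ^ d"
      by (simp only: prod.distrib prod_constant card_lessThan prod_power_distrib[symmetric]
          power_mult_distrib power_mult[symmetric] mult_ac)
    also have "(\<Prod>i<n. max 1 (cmod (as ! i))) = (\<Prod>a\<leftarrow>as. max 1 (cmod a))"
      unfolding len[symmetric] by (simp add: prod.list_conv_set_nth lessThan_atLeast0)
    finally show ?thesis unfolding mahler_measure_via_roots[of F] as_def b_def .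
  qed
  ultimately show ?thesis using AB unfolding n_def d_def by blast
qed

section \<open>Liouville's inequality for the p-adic absolute value\<close>

lemma padic_abs_of_int:
  assumes "m \<noteq> 0"
  shows "padic_abs p (of_int m) = real p powi (- int (multiplicity (int p) m))"
  using assms by (simp add: padic_abs_def)

text \<open>
  All that enters about the ambient field: an absolute value that is \<open>p\<close>-adic on the rationals, and a
  point \<open>\<kappa>\<close> of absolute value 1.
\<close>

locale padic_unit =
  fixes p :: nat and v :: "'a :: field_char_0 \<Rightarrow> real" and \<kappa> :: 'a
  assumes prime_p: "prime p"
    and absolute_value_v: "absolute_value v"
    and v_of_rat: "\<And>q. v (of_rat q) = padic_abs p q"
    and v_\<kappa>: "v \<kappa> = 1"
begin

lemma v_nonneg: "v x \<ge> 0" and v_eq_0_iff: "v x = 0 \<longleftrightarrow> x = 0"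
  and v_mult: "v (x * y) = v x * v y" and v_triangle: "v (x + y) \<le> v x + v y"
  using absolute_value_v by (auto simp: absolute_value_def)

lemma v_pos: "x \<noteq> 0 \<Longrightarrow> v x > 0"
  using v_nonneg[of x] v_eq_0_iff[of x] by linarith

lemma v_1: "v 1 = 1"
  using v_mult[of 1 1] v_eq_0_iff[of 1] by simp

lemma v_power: "v (x ^ n) = v x ^ n"
  by (induction n) (simp_all add: v_1 v_mult)

lemma v_of_int: "m \<noteq> 0 \<Longrightarrow> v (of_int m) = inverse (real p ^ multiplicity (int p) m)"
  using v_of_rat[of "of_int m"] by (simp add: padic_abs_of_int power_int_minus)

lemma v_of_int_le_1: "v (of_int m) \<le> 1"
proof (cases "m = 0")
  case True
  thus ?thesis by (simp add: v_eq_0_iff[THEN iffD2])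
next
  case False
  have "real p ^ multiplicity (int p) m \<ge> 1"
    using prime_gt_0_nat[OF prime_p] by (intro one_le_power) simp
  with False show ?thesis by (simp add: v_of_int inverse_le_1_iff)
qed

lemma v_of_int_ge:
  assumes "m \<noteq> 0"
  shows "v (of_int m) \<ge> 1 / \<bar>real_of_int m\<bar>"
proof -
  have "int p ^ multiplicity (int p) m dvd m" by (rule multiplicity_dvd)
  hence "int p ^ multiplicity (int p) m \<le> \<bar>m\<bar>"
    using assms by (intro zdvd_imp_le) auto
  hence "real_of_int (int p ^ multiplicity (int p) m) \<le> real_of_int \<bar>m\<bar>" by (simp only: of_int_le_iff)
  hence "real p ^ multiplicity (int p) m \<le> \<bar>real_of_int m\<bar>" by simp
  moreover have "real p ^ multiplicity (int p) m > 0" using prime_gt_0_nat[OF prime_p] by simp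
  ultimately have "inverse \<bar>real_of_int m\<bar> \<le> inverse (real p ^ multiplicity (int p) m)"
    by (intro le_imp_inverse_le)
  thus ?thesis using assms by (simp add: v_of_int divide_inverse)
qed

lemma v_p_power: "v (of_int (int p ^ k)) = inverse (real p ^ k)"
proof -
  have p1: "int p \<noteq> 0" "\<not> is_unit (int p)" using prime_gt_1_nat[OF prime_p] by auto
  hence "multiplicity (int p) (int p ^ k) = k" by (intro multiplicity_same_power)
  thus ?thesis using p1 by (subst v_of_int) auto
qed

lemma v_sum_le: "v (\<Sum>i\<in>I. f i) \<le> (\<Sum>i\<in>I. v (f i))"
proof (induction I rule: infinite_finite_induct)
  case (insert i I)
  thus ?case using v_triangle[of "f i" "\<Sum>i\<in>I. f i"] by simp
qed (simp_all add: v_eq_0_iff[THEN iffD2])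

text \<open>
  The triangle inequality bounds a value of an integer polynomial by the number of its coefficients.
  For the powers of the polynomial this number grows only linearly, which leaves no room for a value
  above 1.
\<close>

lemma v_int_poly_le_1: "v (poly (of_int_poly G) \<kappa>) \<le> 1"
proof (rule ccontr)
  assume "\<not> ?thesis"
  hence x: "v (poly (of_int_poly G) \<kappa>) > 1" (is "?x > 1") by simp
  have bound: "v (poly (of_int_poly H) \<kappa>) \<le> real (degree H) + 1" for H
  proof -
    have "v (poly (of_int_poly H) \<kappa>) = v (\<Sum>i\<le>degree H. of_int (coeff H i) * \<kappa> ^ i)"
      by (simp add: poly_altdef)
    also have "\<dots> \<le> (\<Sum>i\<le>degree H. v (of_int (coeff H i) * \<kappa> ^ i))" by (rule v_sum_le)
    also have "\<dots> \<le> (\<Sum>i\<le>degree H. 1)"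
      by (intro sum_mono) (simp add: v_mult v_power v_\<kappa> v_of_int_le_1)
    finally show ?thesis by simp
  qed
  have "?x ^ n \<le> real n * real (degree G) + 1" for n
  proof -
    have "?x ^ n = v (poly (of_int_poly (G ^ n)) \<kappa>)"
      by (simp add: of_int_poly_hom.hom_power v_power)
    also have "\<dots> \<le> real (degree (G ^ n)) + 1" by (rule bound)
    also have "degree (G ^ n) \<le> n * degree G" using degree_power_le[of G n] by (simp add: mult.commute)
    hence "real (degree (G ^ n)) + 1 \<le> real n * real (degree G) + 1"
      by (metis add_le_cancel_right of_nat_le_iff of_nat_mult)
    finally show ?thesis .
  qed
  moreover obtain n where "?x ^ n > real n * real (degree G) + 1"
  proof -
    have "(\<lambda>n. real n / ?x ^ n) \<longlonglongrightarrow> 0" using x by (intro lim_n_over_pown) simp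
    hence "eventually (\<lambda>n. real n / ?x ^ n < 1 / (real (degree G) + 1)) sequentially"
      by (rule order_tendstoD) simp
    then obtain N where N: "\<And>n. n \<ge> N \<Longrightarrow> real n / ?x ^ n < 1 / (real (degree G) + 1)"
      by (auto simp: eventually_sequentially)
    let ?n = "Suc N"
    have "?x ^ ?n > 0" using x by (intro zero_less_power) simp
    hence "real ?n * (real (degree G) + 1) < ?x ^ ?n"
      using N[of ?n] by (simp only: divide_less_eq less_divide_eq) (simp add: field_simps)
    moreover have "real ?n * real (degree G) + 1 \<le> real ?n * (real (degree G) + 1)"
      by (simp add: distrib_left)
    ultimately show ?thesis by (intro that[of ?n]) linarith
  qed
  ultimately show False by (meson leD)
qed

text \<open>
  If \<open>R = A P + B F\<close> is a nonzero integer, then \<open>R = B(\<kappa>) F(\<kappa>)\<close>, where \<open>B(\<kappa>)\<close> has absolute value at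
  most 1. So \<open>F(\<kappa>)\<close> is at least as large as \<open>R\<close>, and the \<open>p\<close>-adic absolute value of \<open>R\<close> is at least the
  reciprocal of the ordinary one.
\<close>

lemma v_int_poly_ge:
  assumes P: "irreducible P" "poly (of_int_poly P) \<kappa> = 0" and F: "\<not> P dvd F"
  shows "v (poly (of_int_poly F) \<kappa>) > 0"
    and "- ln (v (poly (of_int_poly F) \<kappa>)) \<le>
      real (degree F) * (real (degree P) * ln 2 + ln (mahler_measure P)) + real (degree P) * ln (mahler_measure F)"
proof -
  have deg: "degree P > 0" using P by (rule degree_pos_if_irreducible_root)
  obtain R A B where R: "R \<noteq> 0" and AB: "[:R:] = A * P + B * F" and le: "\<bar>real_of_int R\<bar> \<le>
    2 ^ (degree F * degree P) * mahler_measure P ^ degree F * mahler_measure F ^ degree P"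
    using ex_bezout_int_le_mahler[OF P(1) deg F] by blast
  let ?b = "2 ^ (degree F * degree P) * mahler_measure P ^ degree F * mahler_measure F ^ degree P"
  from AB have "poly (of_int_poly [:R:]) \<kappa> = poly (of_int_poly (A * P + B * F)) \<kappa>"
    by simp
  hence R_eq: "of_int R = poly (of_int_poly B) \<kappa> * poly (of_int_poly F) \<kappa>"
    by (simp add: of_int_poly_hom.hom_add of_int_poly_hom.hom_mult of_int_hom.map_poly_pCons_hom P(2))
  hence "poly (of_int_poly F) \<kappa> \<noteq> 0" using R by auto
  thus pos: "v (poly (of_int_poly F) \<kappa>) > 0" by (rule v_pos)
  have F0: "F \<noteq> 0" and P0: "P \<noteq> 0" using F P by auto
  have M: "mahler_measure P \<ge> 1" "mahler_measure F \<ge> 1"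
    using mahler_measure_poly_ge_1 F0 P0 by auto
  have b0: "?b > 0" using M by (intro mult_pos_pos zero_less_power) auto
  have "1 / \<bar>real_of_int R\<bar> \<le> v (of_int R)" using R by (rule v_of_int_ge)
  also have "\<dots> = v (poly (of_int_poly B) \<kappa>) * v (poly (of_int_poly F) \<kappa>)"
    by (simp add: R_eq v_mult)
  also have "\<dots> \<le> 1 * v (poly (of_int_poly F) \<kappa>)"
    by (intro mult_right_mono v_int_poly_le_1 v_nonneg)
  finally have 1: "1 / \<bar>real_of_int R\<bar> \<le> v (poly (of_int_poly F) \<kappa>)" by simp
  have "1 / ?b \<le> 1 / \<bar>real_of_int R\<bar>"
    using le R by (intro divide_left_mono) (use b0 in auto)
  with 1 have "1 / ?b \<le> v (poly (of_int_poly F) \<kappa>)" by linarith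
  hence "ln (1 / ?b) \<le> ln (v (poly (of_int_poly F) \<kappa>))" using b0 by (intro ln_mono) auto
  moreover have "ln (1 / b) = - ln b" if "b > 0" for b :: real using that by (simp add: ln_div)
  from this[OF b0] have "ln (1 / ?b) = - ln ?b" .
  moreover have "ln ?b = real (degree F) * (real (degree P) * ln 2 + ln (mahler_measure P)) +
      real (degree P) * ln (mahler_measure F)"
    using M by (simp add: ln_mult_pos ln_realpow distrib_left)
  ultimately show "- ln (v (poly (of_int_poly F) \<kappa>)) \<le>
      real (degree F) * (real (degree P) * ln 2 + ln (mahler_measure P)) + real (degree P) * ln (mahler_measure F)"
    by linarith
qed

end

section \<open>Polynomials in the square of the indeterminate\<close>

abbreviation in_square :: "'a :: comm_ring_1 poly \<Rightarrow> 'a poly" where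
  "in_square f \<equiv> f \<circ>\<^sub>p monom 1 2"

abbreviation reflect :: "'a :: comm_ring_1 poly \<Rightarrow> 'a poly" where
  "reflect f \<equiv> f \<circ>\<^sub>p [:0, -1:]"

abbreviation even_part :: "'a :: comm_ring_1 poly \<Rightarrow> 'a poly" where
  "even_part f \<equiv> poly_square_subst f"

definition odd_part :: "'a :: comm_ring_1 poly \<Rightarrow> 'a poly" where
  "odd_part f = poly_square_subst (poly_shift 1 f)"

lemma coeff_odd_part: "coeff (odd_part f) i = coeff f (2 * i + 1)"
  by (simp add: odd_part_def poly_square_subst_coeff coeff_poly_shift)

lemma coeff_in_square: "coeff (in_square f) n = (if even n then coeff f (n div 2) else 0)"
proof (cases "even n")
  case True
  then obtain m where "n = 2 * m" by (elim evenE)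
  thus ?thesis using coeff_pcompose_monom[of 0 2 f m] by simp
next
  case False
  then obtain m where "n = 2 * m + 1" by (elim oddE)
  thus ?thesis using coeff_pcompose_monom[of 1 2 f m] by simp
qed

lemma even_part_in_square [simp]: "even_part (in_square f + monom 1 1 * in_square g) = f"
proof (rule poly_eqI)
  fix n
  show "coeff (even_part (in_square f + monom 1 1 * in_square g)) n = coeff f n"
    by (cases n) (simp_all add: poly_square_subst_coeff coeff_in_square coeff_monom_mult del: coeff_pcompose_0)
qed

lemma odd_part_in_square [simp]: "odd_part (in_square f + monom 1 1 * in_square g) = g"
proof (rule poly_eqI)
  fix n
  show "coeff (odd_part (in_square f + monom 1 1 * in_square g)) n = coeff g n"
    by (simp add: coeff_odd_part coeff_in_square coeff_monom_mult del: coeff_pcompose_0)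
qed

lemma even_odd_decomposition: "f = in_square (even_part f) + monom 1 1 * in_square (odd_part f)"
proof (rule poly_eqI)
  fix n
  show "coeff f n = coeff (in_square (even_part f) + monom 1 1 * in_square (odd_part f)) n"
  proof (cases "even n")
    case True
    then obtain m where "n = 2 * m" by (elim evenE)
    thus ?thesis by (cases m) (simp_all add: poly_square_subst_coeff coeff_in_square coeff_monom_mult del: coeff_pcompose_0)
  next
    case False
    then obtain m where "n = 2 * m + 1" by (elim oddE)
    thus ?thesis by (simp add: coeff_odd_part coeff_in_square coeff_monom_mult del: coeff_pcompose_0)
  qed
qed

lemma in_square_eq_iff [simp]: "in_square f = in_square g \<longleftrightarrow> f = g"
  using even_part_in_square[of f 0] even_part_in_square[of g 0] by (metis mult_zero_right pcompose_0 add_0_right)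

text \<open>
  Multiplication by an even polynomial preserves the parity of exponents, so it does not mix the even and the odd part.
\<close>

lemma in_square_dvd_iff:
  fixes f :: "'a :: idom_divide poly"
  shows "in_square f dvd in_square g + monom 1 1 * in_square h \<longleftrightarrow> f dvd g \<and> f dvd h"
proof
  assume "in_square f dvd in_square g + monom 1 1 * in_square h"
  then obtain c where c: "in_square g + monom 1 1 * in_square h = in_square f * c" by (elim dvdE)
  have "in_square f * c = in_square f * (in_square (even_part c) + monom 1 1 * in_square (odd_part c))"
    by (subst even_odd_decomposition[of c]) (rule refl)
  also have "\<dots> = in_square (f * even_part c) + monom 1 1 * in_square (f * odd_part c)"
    by (simp only: pcompose_mult distrib_left mult.left_commute)
  finally have eq: "in_square g + monom 1 1 * in_square h =
      in_square (f * even_part c) + monom 1 1 * in_square (f * odd_part c)"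
    using c by (rule trans[rotated])
  have "g = f * even_part c" using arg_cong[OF eq, of even_part] by (simp only: even_part_in_square)
  moreover have "h = f * odd_part c" using arg_cong[OF eq, of odd_part] by (simp only: odd_part_in_square)
  ultimately show "f dvd g \<and> f dvd h" by (metis dvd_triv_left)
next
  assume "f dvd g \<and> f dvd h"
  then obtain a b where "g = f * a" "h = f * b" by (elim conjE dvdE)
  hence "in_square g + monom 1 1 * in_square h = in_square f * (in_square a + monom 1 1 * in_square b)"
    by (simp only: pcompose_mult distrib_left mult.left_commute)
  thus "in_square f dvd in_square g + monom 1 1 * in_square h" by simp
qed

lemma in_square_dvd_in_square_iff:
  fixes f :: "'a :: idom_divide poly"
  shows "in_square f dvd in_square g \<longleftrightarrow> f dvd g"
  using in_square_dvd_iff[of f g 0] by simp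

lemma reflect_reflect [simp]: "reflect (reflect f) = f"
  by (intro poly_eqI) (simp add: coeff_pcompose_linear flip: power_mult_distrib mult.assoc)

lemma reflect_in_square [simp]: "reflect (in_square f) = in_square f"
  by (intro poly_eqI) (simp add: coeff_pcompose_linear coeff_in_square)

lemma reflect_dvd_iff: "reflect f dvd reflect g \<longleftrightarrow> f dvd (g ::  'a :: idom_divide poly)"
proof -
  have imp: "reflect a dvd reflect b" if "a dvd b" for a b :: "'a poly"
    using that by (auto elim!: dvdE simp: pcompose_mult)
  show ?thesis using imp[of f g] imp[of "reflect f" "reflect g"] by auto
qed

lemma in_square_even_part_if_reflect:
  fixes f :: "'a :: {idom, ring_char_0} poly"
  assumes "reflect f = f"
  shows "in_square (even_part f) = f"
proof (rule poly_eqI)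
  fix n
  show "coeff (in_square (even_part f)) n = coeff f n"
  proof (cases "even n")
    case False
    have "coeff f n = (-1) ^ n * coeff f n"
      using coeff_pcompose_linear[of f "-1" n] assms by simp
    with False have "coeff f n = 0" by (simp add: minus_one_power_iff)
    with False show ?thesis by (simp add: coeff_in_square)
  qed (simp add: coeff_in_square poly_square_subst_coeff)
qed

lemma is_unit_in_square_iff: "is_unit (in_square f) \<longleftrightarrow> is_unit (f ::  'a :: idom_divide poly)"
  using in_square_dvd_in_square_iff[of f 1] by simp

lemma irreducible_if_in_square_irreducible:
  fixes f :: "'a :: idom_divide poly"
  assumes "irreducible (in_square f)"
  shows "irreducible f"
proof (rule irreducibleI)
  show "f \<noteq> 0" using assms by auto
  show "\<not> is_unit f" using assms is_unit_in_square_iff[of f] by (auto simp: irreducible_def)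
  fix a b assume "f = a * b"
  hence "in_square f = in_square a * in_square b" by (simp only: pcompose_mult)
  with assms have "is_unit (in_square a) \<or> is_unit (in_square b)" by (auto dest: irreducibleD)
  thus "is_unit a \<or> is_unit b" by (simp only: is_unit_in_square_iff)
qed

section \<open>Digit systems and the Graeffe transform\<close>

text \<open>
  \<open>P2\<close> is, up to sign, the polynomial whose roots are the squares of the roots of \<open>P\<close>. The assumption
  that \<open>P\<close> is not a polynomial in \<open>X\<^sup>2\<close> makes \<open>P(X)\<close> and \<open>P(-X)\<close> coprime; this is what lets
  divisibility and irreducibility pass between \<open>P\<close> and \<open>P2\<close>.
\<close>

locale graeffe_step =
  fixes P P2 :: "int poly"
  assumes irreducible_P: "irreducible P" and coeff_0_P: "coeff P 0 \<noteq> 0" and not_even_P: "reflect P \<noteq> P"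
    and P2: "in_square P2 dvd P * reflect P" "P * reflect P dvd in_square P2"
begin

lemmas P = irreducible_P coeff_0_P not_even_P

lemma irreducible_reflect: "irreducible (reflect P)"
proof (rule irreducibleI)
  show "reflect P \<noteq> 0" using P(2) by (metis coeff_0 coeff_pcompose_linear mult_zero_left mult_1 power_0)
  show "\<not> is_unit (reflect P)" using P(1) reflect_dvd_iff[of P 1] by (auto simp: irreducible_def)
  fix a b assume "reflect P = a * b"
  hence "P = reflect a * reflect b" by (metis pcompose_mult reflect_reflect)
  with P(1) have "is_unit (reflect a) \<or> is_unit (reflect b)" by (auto dest: irreducibleD)
  thus "is_unit a \<or> is_unit b" using reflect_dvd_iff[of _ "1 :: int poly"] by simp
qed

lemma not_dvd_reflect: "\<not> P dvd reflect P"
proof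
  assume dvd: "P dvd reflect P"
  then obtain c where c: "reflect P = P * c" by (elim dvdE)
  have "reflect P dvd P" using dvd reflect_dvd_iff[of P "reflect P"] by simp
  then obtain e where e: "P = reflect P * e" by (elim dvdE)
  have "P \<noteq> 0" using P by auto
  with c e have ce: "c * e = 1" by (metis mult.assoc mult_cancel_left2)
  hence "c \<noteq> 0" "e \<noteq> 0" by auto
  hence "degree c + degree e = degree (c * e)" by (rule Polynomial.degree_mult_eq[symmetric])
  hence "degree c = 0" by (simp add: ce)
  then obtain k where k: "c = [:k:]" by (elim degree_eq_zeroE)
  have "coeff (reflect P) 0 = coeff (P * c) 0" using c by simp
  hence "coeff P 0 = coeff P 0 * k" unfolding coeff_pcompose_linear k by (simp add: mult.commute)
  hence "k = 1" using P(2) by simp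
  with c k P(3) show False by simp
qed

text \<open>
  A polynomial in \<open>X\<^sup>2\<close> that is divisible by \<open>P(X)\<close> is also divisible by \<open>P(-X)\<close>, hence by their product.
\<close>

lemma in_square_P2_dvd_iff: "P dvd in_square f \<longleftrightarrow> P2 dvd f"
proof
  assume dvd: "P dvd in_square f"
  then obtain c where c: "in_square f = P * c" by (elim dvdE)
  have "reflect P dvd reflect (in_square f)" using dvd by (simp only: reflect_dvd_iff)
  hence "reflect P dvd in_square f" by (simp only: reflect_in_square)
  hence "reflect P dvd P * c" by (simp only: c)
  moreover have "\<not> reflect P dvd P" using not_dvd_reflect reflect_dvd_iff[of P "reflect P"] by simp
  moreover have "prime_elem (reflect P)"
    using irreducible_reflect by (rule irreducible_imp_prime_elem_gcd)
  ultimately have "reflect P dvd c" by (simp add: prime_elem_dvd_mult_iff)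
  hence "P * reflect P dvd in_square f" unfolding c by (intro mult_dvd_mono dvd_refl)
  with P2(1) have "in_square P2 dvd in_square f" by (rule dvd_trans)
  thus "P2 dvd f" by (simp only: in_square_dvd_in_square_iff)
next
  assume "P2 dvd f"
  hence "in_square P2 dvd in_square f" by (simp only: in_square_dvd_in_square_iff)
  hence "P * reflect P dvd in_square f" by (rule dvd_trans[OF P2(2)])
  thus "P dvd in_square f" by (rule dvd_mult_left)
qed

lemma P2_nonzero: "P2 \<noteq> 0"
proof
  assume "P2 = 0"
  hence "P * reflect P = 0" using P2(1) by simp
  with P(1) irreducible_reflect show False by auto
qed

lemma irreducible_P2: "irreducible P2"
proof (rule irreducibleI)
  show "P2 \<noteq> 0" by (rule P2_nonzero)
  show "\<not> is_unit P2"
  proof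
    assume "is_unit P2"
    hence "P dvd in_square 1" using in_square_P2_dvd_iff[of 1] by simp
    thus False using P(1) by (simp add: irreducible_def)
  qed
  fix a b assume ab: "P2 = a * b"
  have unit: "is_unit b" if "P2 = a * b" "P dvd in_square a" for a b
  proof -
    have "P2 dvd a" using that(2) by (simp only: in_square_P2_dvd_iff)
    then obtain c where c: "a = P2 * c" by (elim dvdE)
    have "P2 * 1 = a * b" by (rule trans[OF mult_1_right that(1)])
    also have "\<dots> = P2 * (c * b)" unfolding c by (rule mult.assoc)
    finally have "P2 * 1 = P2 * (c * b)" .
    hence "1 = c * b" using mult_left_cancel[OF P2_nonzero] by blast
    thus ?thesis by (metis dvd_triv_right)
  qed
  have "P dvd in_square (a * b)"
    unfolding in_square_P2_dvd_iff ab[symmetric] by (rule dvd_refl)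
  hence "P dvd in_square a \<or> P dvd in_square b"
    using irreducible_imp_prime_elem_gcd[OF P(1)] by (simp only: pcompose_mult prime_elem_dvd_mult_iff)
  moreover have "P2 = b * a" by (rule trans[OF ab mult.commute])
  ultimately show "is_unit a \<or> is_unit b" using unit[OF ab] unit[of b a] by blast
qed

end

definition digit_sum :: "nat \<Rightarrow> nat \<Rightarrow> (nat \<Rightarrow> int poly) \<Rightarrow> int poly" where
  "digit_sum m n f = (\<Sum>i<n. f i * monom 1 (m * i))"

text \<open>
  Digit expansions in base \<open>X ^ m\<close> with digits from \<open>S\<close> that are pairwise incongruent modulo \<open>P\<close>. The
  degree bound on the digits keeps the expansions of length \<open>n\<close> within degree \<open>n m\<close>.
\<close>

definition digit_system :: "int poly \<Rightarrow> nat \<Rightarrow> int poly set \<Rightarrow> bool" where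
  "digit_system P m S \<longleftrightarrow> m > 0 \<and> finite S \<and> S \<noteq> {} \<and> (\<forall>s\<in>S. degree s < m) \<and>
     (\<forall>n f g. f ` {..<n} \<subseteq> S \<longrightarrow> g ` {..<n} \<subseteq> S \<longrightarrow> P dvd digit_sum m n f - digit_sum m n g \<longrightarrow>
       (\<forall>i<n. f i = g i))"

lemma digit_sum_in_square:
  "in_square (digit_sum m n f) = digit_sum (2 * m) n (\<lambda>i. in_square (f i))"
proof -
  have "in_square (monom (1::int) k) = monom 1 (2 * k)" for k
    by (intro poly_eqI) (auto simp: coeff_in_square coeff_monom simp del: coeff_pcompose_0, presburger+)
  thus ?thesis by (simp add: digit_sum_def pcompose_sum pcompose_mult mult_ac)
qed

lemma digit_sum_add_mult:
  "digit_sum m n (\<lambda>i. f i + c * g i) = digit_sum m n f + c * digit_sum m n g"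
  unfolding digit_sum_def sum_distrib_left sum.distrib[symmetric]
  by (intro sum.cong refl) (simp only: distrib_right mult.assoc)

lemma degree_in_square: "degree (in_square f) = 2 * degree (f ::  'a :: idom_divide poly)"
  by (simp add: degree_monom_eq)

text \<open>
  A digit system for the squared roots, with \<open>X\<^sup>2\<close> in place of \<open>X\<close>, is one for the roots: the number of
  digits is the same and the exponent \<open>m\<close> of the base doubles, in accordance with the Mahler measure
  being squared.
\<close>

lemma (in graeffe_step) digit_system_step:
  assumes "digit_system P2 m S"
  shows "digit_system P (2 * m) (in_square ` S)" and "card (in_square ` S) = card S"
proof -
  have S: "m > 0" "finite S" "S \<noteq> {}" "\<And>s. s \<in> S \<Longrightarrow> degree s < m"
    "\<And>n f g. f ` {..<n} \<subseteq> S \<Longrightarrow> g ` {..<n} \<subseteq> S \<Longrightarrow> P2 dvd digit_sum m n f - digit_sum m n g \<Longrightarrow>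
       (\<forall>i<n. f i = g i)"
    using assms unfolding digit_system_def by blast+
  show "card (in_square ` S) = card S" by (intro card_image inj_onI) simp
  show "digit_system P (2 * m) (in_square ` S)"
    unfolding digit_system_def
  proof (intro conjI ballI allI impI)
    fix n f g i
    assume fg: "f ` {..<n} \<subseteq> in_square ` S" "g ` {..<n} \<subseteq> in_square ` S"
      and dvd: "P dvd digit_sum (2 * m) n f - digit_sum (2 * m) n g" and i: "i < n"
    have ev: "in_square (even_part (h i)) = h i \<and> even_part (h i) \<in> S" if "h ` {..<n} \<subseteq> in_square ` S" "i < n" for h i
    proof -
      have "h i \<in> in_square ` S" using that by auto
      then obtain s where "s \<in> S" "h i = in_square s" by blast
      thus ?thesis by (simp add: poly_square_subst)
    qed
    have ds: "digit_sum (2 * m) n h = in_square (digit_sum m n (\<lambda>i. even_part (h i)))"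
      if "h ` {..<n} \<subseteq> in_square ` S" for h
      unfolding digit_sum_in_square using ev[OF that] unfolding digit_sum_def by (intro sum.cong) auto
    have "P dvd in_square (digit_sum m n (\<lambda>i. even_part (f i)) - digit_sum m n (\<lambda>i. even_part (g i)))"
      using dvd unfolding ds[OF fg(1)] ds[OF fg(2)] by (simp only: pcompose_diff)
    hence "P2 dvd digit_sum m n (\<lambda>i. even_part (f i)) - digit_sum m n (\<lambda>i. even_part (g i))"
      by (simp only: in_square_P2_dvd_iff)
    hence "\<forall>i<n. even_part (f i) = even_part (g i)"
      using ev[OF fg(1)] ev[OF fg(2)] by (intro S(5)) auto
    with ev[OF fg(1) i] ev[OF fg(2) i] i show "f i = g i" by metis
  next
    fix s assume "s \<in> in_square ` S"
    then obtain a where a: "a \<in> S" "s = in_square a" by blast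
    show "degree s < 2 * m" using S(4)[OF a(1)] unfolding a(2) degree_in_square by linarith
  qed (use S in auto)
qed

text \<open>
  Modulo a polynomial in \<open>X\<^sup>2\<close>, even and odd parts are independent, so that each new digit consists of
  two old ones. The number of digits is squared and the exponent \<open>m\<close> of the base doubles, while the
  Mahler measure stays the same.
\<close>

lemma digit_system_even:
  assumes "digit_system P' m S"
  defines "S' \<equiv> (\<lambda>(s, t). in_square s + monom 1 1 * in_square t) ` (S \<times> S)"
  shows "digit_system (in_square P') (2 * m) S'" and "card S' = card S ^ 2"
proof -
  have S: "m > 0" "finite S" "S \<noteq> {}" "\<And>s. s \<in> S \<Longrightarrow> degree s < m"
    "\<And>n f g. f ` {..<n} \<subseteq> S \<Longrightarrow> g ` {..<n} \<subseteq> S \<Longrightarrow> P' dvd digit_sum m n f - digit_sum m n g \<Longrightarrow>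
       (\<forall>i<n. f i = g i)"
    using assms(1) unfolding digit_system_def by blast+
  have "inj_on (\<lambda>(s, t). in_square s + monom 1 1 * in_square t) (S \<times> S)"
  proof (rule inj_onI, clarify)
    fix s t s' t' :: "int poly"
    assume eq: "in_square s + monom 1 1 * in_square t = in_square s' + monom 1 1 * in_square t'"
    show "s = s' \<and> t = t'"
      using arg_cong[OF eq, of even_part] arg_cong[OF eq, of odd_part]
      by (simp only: even_part_in_square odd_part_in_square simp_thms)
  qed
  thus "card S' = card S ^ 2"
    unfolding S'_def by (subst card_image) (simp_all add: card_cartesian_product power2_eq_square)
  have S'_cases: "\<exists>a\<in>S. \<exists>b\<in>S. x = in_square a + monom 1 1 * in_square b" if "x \<in> S'" for x
    using that unfolding S'_def by (elim imageE SigmaE) force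
  show "digit_system (in_square P') (2 * m) S'"
    unfolding digit_system_def
  proof (intro conjI ballI allI impI)
    fix n f g i
    assume fg: "f ` {..<n} \<subseteq> S'" "g ` {..<n} \<subseteq> S'"
      and dvd: "in_square P' dvd digit_sum (2 * m) n f - digit_sum (2 * m) n g" and i: "i < n"
    have eo: "even_part (h i) \<in> S \<and> odd_part (h i) \<in> S" if "h ` {..<n} \<subseteq> S'" "i < n" for h i
    proof -
      have "h i \<in> S'" using that by auto
      then obtain s t where "s \<in> S" "t \<in> S" "h i = in_square s + monom 1 1 * in_square t"
        using S'_cases by metis
      thus ?thesis by (simp only: even_part_in_square odd_part_in_square simp_thms)
    qed
    have ds: "digit_sum (2 * m) n h = in_square (digit_sum m n (\<lambda>i. even_part (h i)))
        + monom 1 1 * in_square (digit_sum m n (\<lambda>i. odd_part (h i)))" for h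
    proof -
      have "digit_sum (2 * m) n h = digit_sum (2 * m) n (\<lambda>i. in_square (even_part (h i)) + monom 1 1 * in_square (odd_part (h i)))"
      proof -
        have "h = (\<lambda>i. in_square (even_part (h i)) + monom 1 1 * in_square (odd_part (h i)))"
          by (rule ext) (rule even_odd_decomposition)
        thus ?thesis by (rule arg_cong)
      qed
      also have "\<dots> = digit_sum (2 * m) n (\<lambda>i. in_square (even_part (h i)))
          + monom 1 1 * digit_sum (2 * m) n (\<lambda>i. in_square (odd_part (h i)))"
        by (rule digit_sum_add_mult)
      finally show ?thesis by (simp only: digit_sum_in_square)
    qed
    let ?E = "\<lambda>h. digit_sum m n (\<lambda>i. even_part (h i))" and ?O = "\<lambda>h. digit_sum m n (\<lambda>i. odd_part (h i))"
    have "in_square P' dvd in_square (?E f - ?E g) + monom 1 1 * in_square (?O f - ?O g)"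
    proof -
      have "digit_sum (2 * m) n f - digit_sum (2 * m) n g =
          in_square (?E f - ?E g) + monom 1 1 * in_square (?O f - ?O g)"
        unfolding ds pcompose_diff by (simp only: right_diff_distrib add_diff_add)
      with dvd show ?thesis by (simp only:)
    qed
    hence dvds: "P' dvd ?E f - ?E g" "P' dvd ?O f - ?O g" by (simp_all only: in_square_dvd_iff)
    have "\<forall>i<n. even_part (f i) = even_part (g i)"
      using eo[OF fg(1)] eo[OF fg(2)] dvds(1) by (intro S(5)) auto
    hence eq1: "even_part (f i) = even_part (g i)" using i by (elim allE[of _ i] impE)
    have "\<forall>i<n. odd_part (f i) = odd_part (g i)"
      using eo[OF fg(1)] eo[OF fg(2)] dvds(2) by (intro S(5)) auto
    hence eq2: "odd_part (f i) = odd_part (g i)" using i by (elim allE[of _ i] impE)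
    have "f i = in_square (even_part (f i)) + monom 1 1 * in_square (odd_part (f i))"
      by (rule even_odd_decomposition)
    also have "\<dots> = g i" unfolding eq1 eq2 by (rule even_odd_decomposition[symmetric])
    finally show "f i = g i" .
  next
    fix s assume "s \<in> S'"
    then obtain a b where ab: "a \<in> S" "b \<in> S" "s = in_square a + monom 1 1 * in_square b"
      using S'_cases by metis
    have "degree (in_square a) < 2 * m" using S(4)[OF ab(1)] unfolding degree_in_square by linarith
    moreover have "degree (monom 1 1 * in_square b) \<le> 1 + 2 * degree b"
      using degree_mult_le[of "monom (1::int) 1" "in_square b"] degree_monom_le[of "1::int" 1]
      unfolding degree_in_square by linarith
    ultimately show "degree s < 2 * m" using S(4)[OF ab(2)] unfolding ab(3) by (intro degree_add_less) auto
  qed (use S in \<open>auto simp: S'_def\<close>)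
qed

text \<open>
  The expansions of length \<open>n\<close>, of degree less than \<open>N = n m\<close>, number at least \<open>exp (N (ln M(P) - r))\<close>;
  the defect \<open>r\<close> measures how far they may fall short of \<open>M(P) ^ N\<close>.
\<close>

definition digit_rate :: "int poly \<Rightarrow> real \<Rightarrow> bool" where
  "digit_rate P r \<longleftrightarrow>
     (\<exists>m S. digit_system P m S \<and> real m * (ln (mahler_measure P) - r) \<le> ln (real (card S)))"

lemma (in graeffe_step) digit_rate_step:
  assumes M: "mahler_measure P2 = mahler_measure P ^ 2" and rate: "digit_rate P2 (2 * r)"
  shows "digit_rate P r"
proof -
  obtain m S where S: "digit_system P2 m S" and le: "real m * (ln (mahler_measure P2) - 2 * r) \<le> ln (real (card S))"
    using rate unfolding digit_rate_def by (elim exE conjE)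
  have "P \<noteq> 0" using irreducible_P by auto
  hence "mahler_measure P > 0" using mahler_measure_poly_ge_1[of P] by linarith
  hence "ln (mahler_measure P2) = 2 * ln (mahler_measure P)" unfolding M by (simp add: ln_realpow)
  with le have "real (2 * m) * (ln (mahler_measure P) - r) \<le> ln (real (card (in_square ` S)))"
    unfolding digit_system_step(2)[OF S] by (simp add: algebra_simps)
  with digit_system_step(1)[OF S] show ?thesis unfolding digit_rate_def by (intro exI conjI)
qed

lemma mahler_measure_mult: "mahler_measure (P * Q) = mahler_measure P * mahler_measure Q"
  by (simp only: mahler_measure_def of_int_poly_hom.hom_mult measure_eq_prod)

lemma mahler_measure_1 [simp]: "mahler_measure 1 = 1"
  using mahler_measure_constant[of 1]
  by (simp only: mahler_measure_def of_int_poly_hom.hom_one one_pCons[symmetric] norm_one)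

lemma mahler_measure_power: "mahler_measure (P ^ n) = mahler_measure P ^ n"
  by (induction n) (simp_all only: power_0 power_Suc mahler_measure_mult mahler_measure_1)

text \<open>
  The \<open>k\<close>-th iterate; its roots are the powers of the roots of \<open>P\<close> with exponent \<open>2 ^ k\<close>.
\<close>

definition graeffe :: "int poly \<Rightarrow> nat \<Rightarrow> int poly" where
  "graeffe P k = graeffe_poly_impl P k"

lemma graeffe_0 [simp]: "graeffe P 0 = P"
  by (simp add: graeffe_def graeffe_poly_impl_def)

lemma graeffe_Suc:
  "graeffe P (Suc k) = smult ((-1) ^ degree P) (even_part (graeffe P k * reflect (graeffe P k)))"
  by (simp add: graeffe_def graeffe_poly_impl_def graeffe_one_step_def)

lemma in_square_even_part_reflect_mult:
  fixes f :: "int poly"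
  shows "in_square (even_part (f * reflect f)) = f * reflect f"
  by (rule in_square_even_part_if_reflect) (simp only: pcompose_mult reflect_reflect mult.commute)

lemma in_square_graeffe_Suc:
  "in_square (graeffe P (Suc k)) = smult ((-1) ^ degree P) (graeffe P k * reflect (graeffe P k))"
  unfolding graeffe_Suc pcompose_smult in_square_even_part_reflect_mult by (rule refl)

lemma smult_unit_dvd:
  fixes f :: "int poly"
  shows "smult ((-1) ^ n) f dvd f" "f dvd smult ((-1) ^ n) f"
proof -
  have "(-1 :: int) ^ n * (-1) ^ n = 1" by (simp flip: power_add)
  hence eq: "smult ((-1) ^ n) (smult ((-1) ^ n) f) = f" by (simp only: smult_smult smult_1_left)
  have "smult ((-1) ^ n) f dvd smult ((-1) ^ n) (smult ((-1) ^ n) f)" by (intro dvd_smult dvd_refl)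
  thus "smult ((-1) ^ n) f dvd f" by (simp only: eq)
  show "f dvd smult ((-1) ^ n) f" by (intro dvd_smult dvd_refl)
qed

lemma mahler_measure_graeffe: "mahler_measure (graeffe P k) = mahler_measure P ^ 2 ^ k"
  unfolding graeffe_def by (rule graeffe_poly_impl_mahler)

text \<open>
  That \<open>P'(X)\<close> and \<open>P'(X\<^sup>2)\<close> have the same Mahler measure is seen from the Graeffe transform of the
  latter, which is the square of the former.
\<close>

lemma digit_rate_in_square:
  assumes "P' \<noteq> 0" and rate: "digit_rate P' r"
  shows "digit_rate (in_square P') r"
proof -
  obtain m S where S: "digit_system P' m S" and le: "real m * (ln (mahler_measure P') - r) \<le> ln (real (card S))"
    using rate unfolding digit_rate_def by (elim exE conjE)
  let ?S = "(\<lambda>(s, t). in_square s + monom 1 1 * in_square t) ` (S \<times> S)"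
  note sys = digit_system_even[OF S]
  have "even (degree (in_square P'))" unfolding degree_in_square by simp
  hence sgn: "(-1 :: int) ^ degree (in_square P') = 1" by (rule neg_one_even_power)
  have "graeffe (in_square P') 1 = even_part (in_square P' * in_square P')"
    unfolding One_nat_def graeffe_Suc graeffe_0 sgn reflect_in_square by (rule smult_1_left)
  also have "\<dots> = P' ^ 2"
    by (simp only: pcompose_mult[symmetric] poly_square_subst power2_eq_square)
  finally have "mahler_measure (in_square P') ^ 2 = mahler_measure P' ^ 2"
    using mahler_measure_graeffe[of "in_square P'" 1] by (simp add: mahler_measure_power)
  hence M: "mahler_measure (in_square P') = mahler_measure P'"
    by (rule power2_eq_imp_eq) (rule mahler_measure_ge_0)+
  have S0: "finite S" "S \<noteq> {}" using S unfolding digit_system_def by blast+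
  hence "card S > 0" by (simp add: card_gt_0_iff)
  hence "ln (real (card ?S)) = 2 * ln (real (card S))"
    unfolding sys(2) by (simp add: ln_realpow)
  with le have "real (2 * m) * (ln (mahler_measure (in_square P')) - r) \<le> ln (real (card ?S))"
    unfolding M by (simp add: algebra_simps)
  with sys(1) show ?thesis unfolding digit_rate_def by (intro exI conjI)
qed

section \<open>A dominant coefficient\<close>

text \<open>
  Let \<open>s\<close> be the number of \<open>a\<close> in the list with \<open>|a| < 1\<close>. With coefficients weighted by the powers of
  \<open>w\<close>, a factor \<open>X - a ^ m\<close> with \<open>|a| < 1\<close> acts almost as a shift by one place, and one with
  \<open>|a| \<ge> 1\<close> almost as multiplication by \<open>- a ^ m\<close>; in both cases the relative error is at most \<open>\<theta>\<close>. So
  the whole product acts almost as \<open>C X ^ s\<close>, where \<open>C\<close> collects the large roots. The weight is what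
  copes with roots on the unit circle: it is chosen as \<open>\<rho> ^ m\<close> with \<open>\<rho> < 1\<close>, so that such roots count
  as large.
\<close>

lemma prod_linear_dominant:
  fixes as :: "complex list" and R :: "complex poly" and w \<theta> B :: real and m :: nat
  defines "T \<equiv> (\<lambda>as. (\<Prod>a\<leftarrow>as. [:- (a ^ m), 1:]) * R)"
    and "C \<equiv> (\<lambda>as. \<Prod>a\<leftarrow>as. if cmod a < 1 then 1 else - (a ^ m))"
    and "s \<equiv> (\<lambda>as. length (filter (\<lambda>a. cmod a < 1) as))"
  assumes w: "0 < w" "w \<le> \<theta>" and \<theta>: "\<And>a. a \<in> set as \<Longrightarrow> cmod a < 1 \<Longrightarrow> cmod a ^ m \<le> \<theta> * w"
    and B: "\<And>i. cmod (coeff R i) * w ^ i \<le> B"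
  shows "cmod (coeff (T as) i - C as * coeff (monom 1 (s as) * R) i) * w ^ i
    \<le> cmod (C as) * w ^ s as * B * ((1 + \<theta>) ^ length as - 1)"
  using \<theta>
proof (induction as arbitrary: i)
  case Nil
  show ?case by (simp add: T_def C_def s_def)
next
  case (Cons a as)
  have \<theta>0: "\<theta> > 0" using w by linarith
  have B0: "B \<ge> 0" using B[of 0] by (meson norm_ge_zero mult_nonneg_nonneg order_trans zero_le_power less_imp_le w(1))
  define K where "K = cmod (C as) * w ^ s as * B"
  define L where "L = (1 + \<theta>) ^ length as"
  define U where "U i = coeff (T as) i" for i
  define V where "V i = C as * coeff (monom 1 (s as) * R) i" for i
  have K0: "K \<ge> 0" unfolding K_def using B0 w by (intro mult_nonneg_nonneg) auto
  have L1: "L \<ge> 1" unfolding L_def using \<theta>0 by (intro one_le_power) auto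
  have IH: "cmod (U i - V i) * w ^ i \<le> K * (L - 1)" for i
    unfolding U_def V_def K_def L_def using Cons.IH[of i] Cons.prems by (simp add: mult.assoc)
  have V_le: "cmod (V i) * w ^ i \<le> K" for i
  proof (cases "s as \<le> i")
    case True
    have "cmod (V i) * w ^ i = cmod (C as) * w ^ s as * (cmod (coeff R (i - s as)) * w ^ (i - s as))"
      using True unfolding V_def by (simp add: coeff_monom_mult norm_mult flip: power_add)
    also have "\<dots> \<le> cmod (C as) * w ^ s as * B"
      using B w by (intro mult_left_mono) auto
    finally show ?thesis by (simp add: K_def)
  next
    case False
    thus ?thesis using K0 by (simp add: V_def coeff_monom_mult)
  qed
  have U_le: "cmod (U i) * w ^ i \<le> K * L" for i
  proof -
    have "cmod (U i) \<le> cmod (U i - V i) + cmod (V i)" using norm_triangle_sub[of "U i" "V i"] by linarith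
    hence "cmod (U i) * w ^ i \<le> (cmod (U i - V i) + cmod (V i)) * w ^ i"
      using w by (intro mult_right_mono) auto
    also have "\<dots> \<le> K * (L - 1) + K" using IH[of i] V_le[of i] by (simp add: distrib_right)
    finally show ?thesis by (simp add: algebra_simps)
  qed
  define U1 where "U1 = (if i = 0 then 0 else U (i - 1))"
  define V1 where "V1 = (if i = 0 then 0 else V (i - 1))"
  have T_Cons: "coeff (T (a # as)) i = U1 - a ^ m * U i"
  proof -
    have "T (a # as) = monom 1 1 * T as - smult (a ^ m) (T as)"
    proof -
      have "[:- (a ^ m), 1:] = monom 1 1 - [:a ^ m:]" by (simp add: monom_altdef)
      hence "T (a # as) = (monom 1 1 - [:a ^ m:]) * T as"
        unfolding T_def by (simp only: list.map prod_list.Cons mult.assoc)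
      thus ?thesis by (simp add: left_diff_distrib)
    qed
    thus ?thesis by (cases i) (simp_all add: coeff_monom_mult U_def U1_def)
  qed
  have U1_le: "cmod U1 * w ^ i \<le> w * (K * L)"
  proof (cases i)
    case 0
    thus ?thesis using K0 L1 w by (simp add: U1_def)
  next
    case (Suc j)
    thus ?thesis using mult_left_mono[OF U_le[of j], of w] w by (simp add: U1_def mult_ac)
  qed
  show ?case
  proof (cases "cmod a < 1")
    case True
    have d1: "cmod (U1 - V1) * w ^ i \<le> w * (K * (L - 1))"
    proof (cases i)
      case 0
      thus ?thesis using K0 L1 w by (simp add: U1_def V1_def)
    next
      case (Suc j)
      thus ?thesis using mult_left_mono[OF IH[of j], of w] w by (simp add: U1_def V1_def mult_ac)
    qed
    have s: "s (a # as) = Suc (s as)" and C: "C (a # as) = C as" using True by (simp_all add: s_def C_def)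
    have V_eq: "C (a # as) * coeff (monom 1 (s (a # as)) * R) i = V1"
      unfolding s C by (cases i) (simp_all add: coeff_monom_mult V1_def V_def)
    have "cmod (a ^ m * U i) * w ^ i = cmod a ^ m * (cmod (U i) * w ^ i)"
      by (simp add: norm_mult norm_power)
    also have "\<dots> \<le> (\<theta> * w) * (K * L)"
      using Cons.prems[of a] True U_le[of i] w \<theta>0 by (intro mult_mono[of _ _ _ "K * L"]) auto
    finally have d2: "cmod (a ^ m * U i) * w ^ i \<le> (\<theta> * w) * (K * L)" .
    have "cmod (U1 - a ^ m * U i - V1) \<le> cmod (U1 - V1) + cmod (a ^ m * U i)"
      using norm_triangle_ineq4[of "U1 - V1" "a ^ m * U i"] by (simp add: algebra_simps)
    hence "cmod (U1 - a ^ m * U i - V1) * w ^ i \<le> (cmod (U1 - V1) + cmod (a ^ m * U i)) * w ^ i"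
      using w by (intro mult_right_mono) auto
    also have "\<dots> \<le> w * (K * (L - 1)) + (\<theta> * w) * (K * L)"
      using d1 d2 by (simp add: distrib_right)
    also have "\<dots> = (K * w) * ((1 + \<theta>) * L - 1)" by (simp add: algebra_simps)
    finally show ?thesis
      unfolding T_Cons V_eq unfolding s C K_def L_def by (simp add: mult_ac)
  next
    case False
    have s: "s (a # as) = s as" and C: "C (a # as) = - (a ^ m) * C as" using False by (simp_all add: s_def C_def)
    have V_eq: "C (a # as) * coeff (monom 1 (s (a # as)) * R) i = - (a ^ m) * V i"
      unfolding s C by (simp add: V_def)
    define A where "A = cmod a ^ m"
    have A1: "A \<ge> 1" unfolding A_def using False by (intro one_le_power) simp
    have "U1 - a ^ m * U i - (- (a ^ m) * V i) = U1 - a ^ m * (U i - V i)" by (simp add: algebra_simps)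
    hence "cmod (U1 - a ^ m * U i - (- (a ^ m) * V i)) = cmod (U1 - a ^ m * (U i - V i))"
      by (rule arg_cong)
    also have "\<dots> \<le> cmod U1 + cmod (a ^ m * (U i - V i))" by (rule norm_triangle_ineq4)
    also have "\<dots> = cmod U1 + A * cmod (U i - V i)" by (simp only: norm_mult norm_power A_def)
    finally have "cmod (U1 - a ^ m * U i - (- (a ^ m) * V i)) \<le> cmod U1 + A * cmod (U i - V i)" .
    hence "cmod (U1 - a ^ m * U i - (- (a ^ m) * V i)) * w ^ i \<le> (cmod U1 + A * cmod (U i - V i)) * w ^ i"
      using w by (intro mult_right_mono) auto
    also have "\<dots> = cmod U1 * w ^ i + A * (cmod (U i - V i) * w ^ i)" by (simp add: algebra_simps)
    also have "\<dots> \<le> w * (K * L) + A * (K * (L - 1))"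
      using U1_le IH[of i] A1 by (intro add_mono mult_left_mono) auto
    also have "w * (K * L) \<le> (A * \<theta>) * (K * L)"
    proof (rule mult_right_mono)
      have "1 * \<theta> \<le> A * \<theta>" using A1 \<theta>0 by (intro mult_right_mono) auto
      thus "w \<le> A * \<theta>" using w by linarith
    qed (use K0 L1 in auto)
    also have "(A * \<theta>) * (K * L) + A * (K * (L - 1)) = (A * K) * ((1 + \<theta>) * L - 1)"
      by (simp add: algebra_simps)
    finally show ?thesis
      unfolding T_Cons V_eq unfolding s C K_def L_def A_def by (simp add: norm_mult norm_power mult_ac)
  qed
qed

text \<open>
  The weighted maximum of the coefficients of \<open>R\<close> is attained at some \<open>j\<close>. At the place \<open>s + j\<close> the
  product has a coefficient of about \<open>C\<close> times the \<open>j\<close>-th coefficient of \<open>R\<close>, and the weights cancel.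
\<close>

lemma large_coeff_of_multiple:
  fixes as :: "complex list" and R :: "complex poly" and w \<theta> :: real and m :: nat
  assumes w: "0 < w" "w \<le> \<theta>" and \<theta>: "\<And>a. a \<in> set as \<Longrightarrow> cmod a < 1 \<Longrightarrow> cmod a ^ m \<le> \<theta> * w"
    and small: "(1 + \<theta>) ^ length as \<le> 3 / 2"
    and R: "R \<noteq> 0" "\<And>i. coeff R i \<noteq> 0 \<Longrightarrow> cmod (coeff R i) \<ge> 1"
  shows "\<exists>i. cmod (coeff ((\<Prod>a\<leftarrow>as. [:- (a ^ m), 1:]) * R) i) \<ge> (\<Prod>a\<leftarrow>as. max 1 (cmod a)) ^ m / 2"
proof -
  define C where "C = (\<Prod>a\<leftarrow>as. if cmod a < 1 then 1 else - (a ^ m))"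
  define s where "s = length (filter (\<lambda>a. cmod a < 1) as)"
  define B where "B = Max ((\<lambda>i. cmod (coeff R i) * w ^ i) ` {..degree R})"
  have "B \<in> (\<lambda>i. cmod (coeff R i) * w ^ i) ` {..degree R}" unfolding B_def by (intro Max_in) auto
  then obtain j where j: "B = cmod (coeff R j) * w ^ j" by blast
  have B: "cmod (coeff R i) * w ^ i \<le> B" if "i \<le> degree R" for i
    unfolding B_def using that by (intro Max_ge) auto
  have "cmod (coeff R (degree R)) * w ^ degree R > 0" using R(1) w by simp
  with B[of "degree R"] have B0: "B > 0" by simp
  have B': "cmod (coeff R i) * w ^ i \<le> B" for i
    using B[of i] B0 by (cases "i \<le> degree R") (auto simp: coeff_eq_0)
  have "coeff R j \<noteq> 0" using B0 j by auto
  hence Rj: "cmod (coeff R j) \<ge> 1" by (rule R(2))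
  define i where "i = s + j"
  define T where "T = coeff ((\<Prod>a\<leftarrow>as. [:- (a ^ m), 1:]) * R) i"
  have coeff_eq: "coeff (monom 1 s * R) i = coeff R j" by (simp add: coeff_monom_mult i_def)
  have "cmod (T - C * coeff R j) * w ^ i \<le> cmod C * w ^ s * B * ((1 + \<theta>) ^ length as - 1)"
    using prod_linear_dominant[OF w \<theta> B', of as i] unfolding T_def C_def s_def[symmetric] coeff_eq by blast
  also have "\<dots> \<le> cmod C * w ^ s * B * (1 / 2)"
    using small B0 w by (intro mult_left_mono) auto
  also have "\<dots> = (cmod (C * coeff R j) / 2) * w ^ i"
    by (simp add: j i_def power_add norm_mult)
  finally have "cmod (T - C * coeff R j) \<le> cmod (C * coeff R j) / 2"
    using w by (simp add: mult_le_cancel_right)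
  moreover have "cmod (C * coeff R j) \<le> cmod T + cmod (T - C * coeff R j)"
    using norm_triangle_sub[of "C * coeff R j" T] by (simp add: norm_minus_commute)
  ultimately have "cmod T \<ge> cmod (C * coeff R j) / 2" by linarith
  moreover have "cmod (C * coeff R j) \<ge> cmod C" using mult_left_mono[OF Rj, of "cmod C"] by (simp add: norm_mult)
  moreover have "cmod C = (\<Prod>a\<leftarrow>as. max 1 (cmod a)) ^ m"
    unfolding C_def
  proof (induction as)
    case (Cons a as)
    have "cmod (if cmod a < 1 then 1 else - (a ^ m)) = max 1 (cmod a) ^ m"
      by (simp add: norm_power max_def)
    thus ?case using Cons by (simp only: list.map prod_list.Cons norm_mult power_mult_distrib)
  qed simp
  ultimately have "cmod T \<ge> (\<Prod>a\<leftarrow>as. max 1 (cmod a)) ^ m / 2" by linarith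
  thus ?thesis unfolding T_def by blast
qed

section \<open>Graeffe iterates and the number of digit expansions\<close>

lemma finite_int_polys_bounded:
  "finite {F :: int poly. degree F \<le> n \<and> (\<forall>i. \<bar>coeff F i\<bar> \<le> c)}"
proof (rule finite_subset)
  show "{F :: int poly. degree F \<le> n \<and> (\<forall>i. \<bar>coeff F i\<bar> \<le> c)} \<subseteq>
      Poly ` {xs. set xs \<subseteq> {-c..c} \<and> length xs = Suc n}"
  proof
    fix F :: "int poly" assume F: "F \<in> {F. degree F \<le> n \<and> (\<forall>i. \<bar>coeff F i\<bar> \<le> c)}"
    have "F = Poly (map (coeff F) [0..<Suc n])"
    proof (rule poly_eqI)
      fix i
      show "coeff F i = coeff (Poly (map (coeff F) [0..<Suc n])) i"
      proof (cases "i < Suc n")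
        case True
        thus ?thesis by (simp add: nth_default_def del: upt_Suc)
      next
        case False
        with F have "coeff F i = 0" by (intro coeff_eq_0) auto
        with False show ?thesis by (simp add: nth_default_def del: upt_Suc)
      qed
    qed
    moreover have "-c \<le> coeff F i \<and> coeff F i \<le> c" for i
    proof -
      have "\<bar>coeff F i\<bar> \<le> c" using F by blast
      thus ?thesis by linarith
    qed
    hence "set (map (coeff F) [0..<Suc n]) \<subseteq> {-c..c}" by auto
    ultimately show "F \<in> Poly ` {xs. set xs \<subseteq> {-c..c} \<and> length xs = Suc n}"
      by (intro image_eqI[of _ _ "map (coeff F) [0..<Suc n]"]) (simp_all del: upt_Suc)
  qed
  show "finite (Poly ` {xs. set xs \<subseteq> {-c..c} \<and> length xs = Suc n})"
    by (intro finite_imageI finite_lists_length_eq) simp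
qed

text \<open>
  Northcott's finiteness property, by Mignotte's bound for the coefficients.
\<close>

lemma finite_int_polys_mahler_bounded:
  "finite {F :: int poly. degree F \<le> n \<and> mahler_measure F \<le> c}"
proof (rule finite_subset)
  let ?b = "\<lceil>2 ^ n * c\<rceil>"
  show "{F :: int poly. degree F \<le> n \<and> mahler_measure F \<le> c} \<subseteq>
    {F. degree F \<le> n \<and> (\<forall>i. \<bar>coeff F i\<bar> \<le> ?b)}"
  proof clarify
    fix F :: "int poly" and i assume F: "degree F \<le> n" "mahler_measure F \<le> c"
    have "real_of_int \<bar>coeff F i\<bar> \<le> real (degree F choose i) * mahler_measure F"
      using Mignotte_bound[of F i] by simp
    also have "\<dots> \<le> 2 ^ n * c"
    proof (rule mult_mono)
      have "degree F choose i \<le> 2 ^ degree F" by (rule binomial_le_pow2)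
      also have "(2::nat) ^ degree F \<le> 2 ^ n" using F(1) by (intro power_increasing) auto
      finally have "real (degree F choose i) \<le> real (2 ^ n)" by (simp only: of_nat_le_iff)
      thus "real (degree F choose i) \<le> 2 ^ n" by simp
    qed (use F(2) mahler_measure_ge_0 in auto)
    finally show "\<bar>coeff F i\<bar> \<le> ?b" by linarith
  qed
qed (rule finite_int_polys_bounded)

lemma of_int_poly_graeffe:
  "(of_int_poly (graeffe P k) :: complex poly) =
    smult (of_int (lead_coeff P) ^ 2 ^ k) (\<Prod>a\<leftarrow>complex_roots_int P. [:- (a ^ 2 ^ k), 1:])"
proof -
  interpret inj_idom_hom complex_of_int by (standard, auto)
  have "(of_int_poly (graeffe P k) :: complex poly) = graeffe_poly_impl (of_int_poly P) k"
    unfolding graeffe_def by (rule of_int_hom.graeffe_poly_impl_hom)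
  also have "\<dots> = graeffe_poly (of_int (lead_coeff P)) (complex_roots_int P) k"
    by (rule graeffe_poly_impl) (rule complex_roots_int(1)[symmetric])
  finally show ?thesis unfolding graeffe_poly_def .
qed

lemma coeff_0_graeffe:
  assumes "coeff P 0 \<noteq> 0"
  shows "coeff (graeffe P k) 0 \<noteq> 0"
proof (induction k)
  case (Suc k)
  have "coeff (graeffe P (Suc k)) 0 = coeff (in_square (graeffe P (Suc k))) 0"
    by (simp only: coeff_in_square) simp
  also have "\<dots> = (-1) ^ degree P * (coeff (graeffe P k) 0 * coeff (graeffe P k) 0)"
    unfolding in_square_graeffe_Suc coeff_smult coeff_mult_0 coeff_pcompose_linear by simp
  finally show ?case using Suc by simp
qed (use assms in simp)

lemma degree_graeffe: "degree (graeffe P k) = degree P"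
proof (induction k)
  case (Suc k)
  have "2 * degree (graeffe P (Suc k)) = degree (in_square (graeffe P (Suc k)))"
    by (rule degree_in_square[symmetric])
  also have "\<dots> = degree (graeffe P k * reflect (graeffe P k))"
    unfolding in_square_graeffe_Suc degree_smult_eq by simp
  also have "\<dots> = 2 * degree (graeffe P k)"
  proof (cases "graeffe P k = 0")
    case False
    have "degree (reflect (graeffe P k)) = degree (graeffe P k)" by (simp add: degree_pcompose)
    moreover have "reflect (graeffe P k) \<noteq> 0"
    proof
      assume "reflect (graeffe P k) = 0"
      hence "reflect (reflect (graeffe P k)) = reflect 0" by (rule arg_cong)
      with False show False by (simp only: reflect_reflect pcompose_0)
    qed
    ultimately show ?thesis using Polynomial.degree_mult_eq[OF False, of "reflect (graeffe P k)"] by linarith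
  qed simp
  finally show ?case using Suc by simp
qed simp

lemma large_coeff_of_graeffe_multiple:
  fixes P :: "int poly"
  shows "\<exists>k0. \<forall>k\<ge>k0. \<forall>R. R \<noteq> 0 \<longrightarrow>
    (\<exists>i. real_of_int \<bar>coeff (graeffe P k * R) i\<bar> \<ge> mahler_measure P ^ 2 ^ k / 2)"
proof -
  define as where "as = complex_roots_int P"
  define \<sigma> where "\<sigma> = Max (insert 0 (cmod ` {a \<in> set as. cmod a < 1}))"
  have "\<sigma> \<in> insert 0 (cmod ` {a \<in> set as. cmod a < 1})" unfolding \<sigma>_def by (intro Max_in) auto
  hence \<sigma>: "0 \<le> \<sigma>" "\<sigma> < 1" by auto
  have \<sigma>_ge: "cmod a \<le> \<sigma>" if "a \<in> set as" "cmod a < 1" for a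
    unfolding \<sigma>_def using that by (intro Max_ge) auto
  \<comment> \<open>\<open>\<rho>\<close> separates the roots inside the unit circle from the circle. The number \<open>q\<close> is chosen so that
    \<open>\<sigma> \<le> q \<rho>\<close> and \<open>\<rho> \<le> q < 1\<close>; the weight \<open>\<rho> ^ m\<close> then has relative error \<open>q ^ m\<close>.\<close>
  define \<rho> where "\<rho> = (\<sigma> + 1) / 2"
  have \<rho>: "0 < \<rho>" "\<sigma> < \<rho>" "\<rho> < 1" using \<sigma> by (auto simp: \<rho>_def)
  define q where "q = max \<rho> (\<sigma> / \<rho>)"
  have q: "0 < q" "q < 1" "\<rho> \<le> q" using \<rho> by (auto simp: q_def)
  have "\<sigma> / \<rho> \<le> q" by (simp add: q_def)
  hence \<sigma>q: "\<sigma> \<le> q * \<rho>" using \<rho> by (simp add: divide_le_eq)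
  have "(\<lambda>m. (1 + q ^ m) ^ length as) \<longlonglongrightarrow> (1 + 0) ^ length as"
    using q by (intro tendsto_intros LIMSEQ_realpow_zero) auto
  hence "(\<lambda>m. (1 + q ^ m) ^ length as) \<longlonglongrightarrow> 1" by simp
  hence "eventually (\<lambda>m. (1 + q ^ m) ^ length as < 3 / 2) sequentially"
    by (rule order_tendstoD) simp
  then obtain k0 where k0: "\<And>m. m \<ge> k0 \<Longrightarrow> (1 + q ^ m) ^ length as < 3 / 2"
    by (auto simp: eventually_sequentially)
  have "\<exists>i. real_of_int \<bar>coeff (graeffe P k * R) i\<bar> \<ge> mahler_measure P ^ 2 ^ k / 2"
    if k: "k \<ge> k0" and R: "R \<noteq> 0" for k R
  proof -
    define m where "m = (2::nat) ^ k"
    have "k < m" unfolding m_def by (rule less_exp)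
    hence "m \<ge> k0" using k by linarith
    note small = k0[OF this]
    let ?R = "of_int_poly R :: complex poly"
    let ?T = "(\<Prod>a\<leftarrow>as. [:- (a ^ m), 1:]) * ?R"
    have "\<exists>i. cmod (coeff ?T i) \<ge> (\<Prod>a\<leftarrow>as. max 1 (cmod a)) ^ m / 2"
    proof (rule large_coeff_of_multiple[where w = "\<rho> ^ m" and \<theta> = "q ^ m"])
      show "0 < \<rho> ^ m" using \<rho> by simp
      show "\<rho> ^ m \<le> q ^ m" using q \<rho> by (intro power_mono) auto
      show "cmod a ^ m \<le> q ^ m * \<rho> ^ m" if "a \<in> set as" "cmod a < 1" for a
        using \<sigma>_ge[OF that] \<sigma>q by (subst power_mult_distrib[symmetric], intro power_mono) auto
      show "(1 + q ^ m) ^ length as \<le> 3 / 2" using small by simp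
      show "?R \<noteq> 0" using R by simp
      show "cmod (coeff ?R i) \<ge> 1" if "coeff ?R i \<noteq> 0" for i
      proof -
        have "coeff R i \<noteq> 0" using that by auto
        hence "\<bar>coeff R i\<bar> \<ge> 1" by linarith
        hence "real_of_int \<bar>coeff R i\<bar> \<ge> 1" by linarith
        thus ?thesis by simp
      qed
    qed
    then obtain i where i: "cmod (coeff ?T i) \<ge> (\<Prod>a\<leftarrow>as. max 1 (cmod a)) ^ m / 2" by blast
    define c where "c = \<bar>real_of_int (lead_coeff P)\<bar>"
    have "complex_of_int (coeff (graeffe P k * R) i) = coeff (of_int_poly (graeffe P k * R)) i" by simp
    also have "of_int_poly (graeffe P k * R) = smult (of_int (lead_coeff P) ^ m) ?T"
      by (simp only: of_int_poly_hom.hom_mult of_int_poly_graeffe as_def m_def mult_smult_left)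
    finally have "cmod (complex_of_int (coeff (graeffe P k * R) i)) = cmod (of_int (lead_coeff P) ^ m * coeff ?T i)"
      by (simp only: coeff_smult)
    hence "real_of_int \<bar>coeff (graeffe P k * R) i\<bar> = c ^ m * cmod (coeff ?T i)"
      unfolding norm_mult norm_power norm_of_int c_def by simp
    also have "\<dots> \<ge> c ^ m * ((\<Prod>a\<leftarrow>as. max 1 (cmod a)) ^ m / 2)"
      using i by (intro mult_left_mono) (auto simp: c_def)
    also have "c ^ m * ((\<Prod>a\<leftarrow>as. max 1 (cmod a)) ^ m / 2) = mahler_measure P ^ m / 2"
      unfolding mahler_measure_def mahler_measure_poly_def c_def as_def complex_roots_int_def
      by (simp add: power_mult_distrib)
    finally show ?thesis unfolding m_def by blast
  qed
  thus ?thesis by blast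
qed

text \<open>
  The digits are the integers below half of the dominant coefficient: the difference of two expansions
  has smaller coefficients than any nonzero multiple of the polynomial. The factor one half accounts
  for the defect \<open>ln 2\<close>.
\<close>

lemma digit_rate_graeffe:
  assumes "P \<noteq> 0"
  shows "\<exists>k0. \<forall>k\<ge>k0. digit_rate (graeffe P k) (ln 2)"
proof -
  obtain k0 where k0: "\<And>k R. k \<ge> k0 \<Longrightarrow> R \<noteq> 0 \<Longrightarrow>
      \<exists>i. real_of_int \<bar>coeff (graeffe P k * R) i\<bar> \<ge> mahler_measure P ^ 2 ^ k / 2"
    using large_coeff_of_graeffe_multiple by metis
  have "digit_rate (graeffe P k) (ln 2)" if k: "k \<ge> k0" for k
  proof -
    define M where "M = mahler_measure P ^ 2 ^ k"
    have M: "M \<ge> 1" unfolding M_def using mahler_measure_poly_ge_1[OF assms] by (rule one_le_power)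
    define B where "B = nat \<lceil>M / 2\<rceil>"
    have B: "real B \<ge> M / 2" "real B < M / 2 + 1" "B > 0" using M unfolding B_def by linarith+
    define S where "S = (\<lambda>b. [:int b:]) ` {..<B}"
    have card_S: "card S = B" unfolding S_def by (subst card_image) (auto intro: inj_onI)
    have coeff_ds: "coeff (digit_sum 1 n f) i = (if i < n then coeff (f i) 0 else 0)"
      if "f ` {..<n} \<subseteq> S" for f n i
    proof -
      have *: "coeff (f j * monom 1 (1 * j)) i = (if j = i then coeff (f j) 0 else 0)" if "j < n" for j
      proof -
        have "f j \<in> S" using that \<open>f ` {..<n} \<subseteq> S\<close> by blast
        then obtain b where b: "f j = [:int b:]" unfolding S_def by blast
        show ?thesis unfolding b by simp
      qed
      have "coeff (digit_sum 1 n f) i = (\<Sum>j<n. coeff (f j * monom 1 (1 * j)) i)"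
        unfolding digit_sum_def by (rule coeff_sum)
      also have "\<dots> = (\<Sum>j<n. if j = i then coeff (f j) 0 else 0)"
        by (rule sum.cong) (use * in auto)
      also have "\<dots> = (if i < n then coeff (f i) 0 else 0)" by simp
      finally show ?thesis .
    qed
    have digit: "\<exists>b<B. f i = [:int b:]" if "f ` {..<n} \<subseteq> S" "i < n" for f n i
    proof -
      have "f i \<in> S" using that by blast
      thus ?thesis unfolding S_def by blast
    qed
    have "digit_system (graeffe P k) 1 S"
      unfolding digit_system_def
    proof (intro conjI ballI allI impI)
      show "finite S" "S \<noteq> {}" using B(3) by (auto simp: S_def)
      fix s assume "s \<in> S" thus "degree s < 1" by (auto simp: S_def)
    next
      fix n f g i
      assume fg: "f ` {..<n} \<subseteq> S" "g ` {..<n} \<subseteq> S" and i: "i < n"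
        and dvd: "graeffe P k dvd digit_sum 1 n f - digit_sum 1 n g"
      define D where "D = digit_sum 1 n f - digit_sum 1 n g"
      have coeff_D: "coeff D j = (if j < n then coeff (f j) 0 - coeff (g j) 0 else 0)" for j
        unfolding D_def coeff_diff coeff_ds[OF fg(1)] coeff_ds[OF fg(2)] by simp
      have D_small: "real_of_int \<bar>coeff D j\<bar> < M / 2" for j
      proof (cases "j < n")
        case True
        obtain b c where "b < B" "f j = [:int b:]" "c < B" "g j = [:int c:]"
          using digit[OF fg(1) True] digit[OF fg(2) True] by blast
        hence "\<bar>coeff D j\<bar> \<le> int B - 1" unfolding coeff_D using True by simp
        hence "real_of_int \<bar>coeff D j\<bar> \<le> real B - 1" by linarith
        with B(2) show ?thesis by linarith
      next
        case False thus ?thesis unfolding coeff_D using M by simp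
      qed
      have "D = 0"
      proof (rule ccontr)
        assume "D \<noteq> 0"
        obtain R where R: "D = graeffe P k * R" using dvd unfolding D_def[symmetric] by (elim dvdE)
        with \<open>D \<noteq> 0\<close> have "R \<noteq> 0" by auto
        from k0[OF k this] D_small show False unfolding R[symmetric] M_def[symmetric] by (meson leD)
      qed
      hence "coeff D i = 0" by simp
      hence eq: "coeff (f i) 0 = coeff (g i) 0" using i unfolding coeff_D by simp
      obtain b c where "f i = [:int b:]" "g i = [:int c:]"
        using digit[OF fg(1) i] digit[OF fg(2) i] by blast
      with eq show "f i = g i" by simp
    qed simp
    moreover have "ln (M / 2) \<le> ln (real B)" using B(1) M by (intro ln_mono) auto
    hence "real 1 * (ln (mahler_measure (graeffe P k)) - ln 2) \<le> ln (real (card S))"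
      unfolding card_S mahler_measure_graeffe M_def[symmetric] using M by (simp add: ln_div)
    ultimately show ?thesis unfolding digit_rate_def by (intro exI conjI)
  qed
  thus ?thesis by blast
qed

lemma graeffe_chain:
  assumes P: "irreducible P" "coeff P 0 \<noteq> 0"
    and "\<And>i. i < k \<Longrightarrow> reflect (graeffe P i) \<noteq> graeffe P i"
  shows "irreducible (graeffe P k)" and "digit_rate (graeffe P k) (2 ^ k * r) \<Longrightarrow> digit_rate P r"
proof -
  have "irreducible (graeffe P k) \<and> (\<forall>r. digit_rate (graeffe P k) (2 ^ k * r) \<longrightarrow> digit_rate P r)"
    using assms(3)
  proof (induction k)
    case 0
    show ?case using P by simp
  next
    case (Suc k)
    have IH: "irreducible (graeffe P k)" "\<And>r. digit_rate (graeffe P k) (2 ^ k * r) \<Longrightarrow> digit_rate P r"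
      using Suc by auto
    interpret graeffe_step "graeffe P k" "graeffe P (Suc k)"
    proof
      show "irreducible (graeffe P k)" by (rule IH(1))
      show "coeff (graeffe P k) 0 \<noteq> 0" using P(2) by (rule coeff_0_graeffe)
      show "reflect (graeffe P k) \<noteq> graeffe P k" using Suc.prems by simp
      show "in_square (graeffe P (Suc k)) dvd graeffe P k * reflect (graeffe P k)"
        "graeffe P k * reflect (graeffe P k) dvd in_square (graeffe P (Suc k))"
        unfolding in_square_graeffe_Suc by (rule smult_unit_dvd)+
    qed
    have "digit_rate P r" if "digit_rate (graeffe P (Suc k)) (2 ^ Suc k * r)" for r
    proof (rule IH(2), rule digit_rate_step)
      show "mahler_measure (graeffe P (Suc k)) = mahler_measure (graeffe P k) ^ 2"
        unfolding mahler_measure_graeffe power_mult[symmetric] by (simp only: power_Suc mult.commute)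
      show "digit_rate (graeffe P (Suc k)) (2 * (2 ^ k * r))"
        using that by (simp only: power_Suc mult.assoc)
    qed
    with irreducible_P2 show ?case by blast
  qed
  thus "irreducible (graeffe P k)" "digit_rate (graeffe P k) (2 ^ k * r) \<Longrightarrow> digit_rate P r" by blast+
qed

text \<open>
  Every Graeffe step halves the defect when it is pulled back, so a defect of \<open>ln 2\<close> for a late iterate
  is arbitrarily small for \<open>P\<close>. The pull-back stops at an iterate that is a polynomial in \<open>X\<^sup>2\<close>. Such an
  iterate comes from a polynomial of half the degree, to which the induction hypothesis applies.
\<close>

theorem digit_rate_irreducible:
  assumes "irreducible P" "degree P > 0" "coeff P 0 \<noteq> 0" "\<epsilon> > 0"
  shows "digit_rate P \<epsilon>"
  using assms
proof (induction "degree P" arbitrary: P \<epsilon> rule: less_induct)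
  case less
  have P0: "P \<noteq> 0" using less.prems(3) by auto
  show ?case
  proof (cases "\<exists>k. reflect (graeffe P k) = graeffe P k")
    case True
    define k where "k = (LEAST k. reflect (graeffe P k) = graeffe P k)"
    have k: "reflect (graeffe P k) = graeffe P k" unfolding k_def using True by (rule LeastI_ex)
    have odd: "reflect (graeffe P i) \<noteq> graeffe P i" if "i < k" for i
      using not_less_Least that unfolding k_def by blast
    have chain: "irreducible (graeffe P k)" "digit_rate (graeffe P k) (2 ^ k * \<epsilon>) \<Longrightarrow> digit_rate P \<epsilon>"
      using graeffe_chain[OF less.prems(1,3), of k] odd by blast+
    define P' where "P' = even_part (graeffe P k)"
    have sq: "in_square P' = graeffe P k"
      unfolding P'_def using k by (rule in_square_even_part_if_reflect)
    have "2 * degree P' = degree P" using degree_in_square[of P'] unfolding sq degree_graeffe by simp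
    hence deg: "degree P' < degree P" "degree P' > 0" using less.prems(2) by linarith+
    have irr: "irreducible P'"
      using chain(1) unfolding sq[symmetric] by (rule irreducible_if_in_square_irreducible)
    have c0: "coeff P' 0 \<noteq> 0"
      using coeff_0_graeffe[OF less.prems(3), of k] unfolding sq[symmetric] coeff_in_square by simp
    have "digit_rate P' (2 ^ k * \<epsilon>)"
      using less.prems(4) by (intro less.hyps deg irr c0) simp
    hence "digit_rate (graeffe P k) (2 ^ k * \<epsilon>)"
      unfolding sq[symmetric] using irr by (intro digit_rate_in_square) auto
    thus ?thesis by (rule chain(2))
  next
    case False
    obtain k0 where k0: "\<And>k. k \<ge> k0 \<Longrightarrow> digit_rate (graeffe P k) (ln 2)"
      using digit_rate_graeffe[OF P0] by blast
    obtain k1 where k1: "ln 2 / \<epsilon> < 2 ^ k1" using real_arch_pow[of 2] by auto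
    define k where "k = max k0 k1"
    have "(2::real) ^ k1 \<le> 2 ^ k" unfolding k_def by (intro power_increasing) auto
    with k1 have "ln 2 / \<epsilon> \<le> 2 ^ k" by linarith
    hence le: "ln 2 \<le> 2 ^ k * \<epsilon>" using less.prems(4) by (simp add: divide_le_eq)
    have mono: "digit_rate Q r'" if rate: "digit_rate Q r" and le': "r \<le> r'" for Q r r'
    proof -
      obtain m S where mS: "digit_system Q m S" "real m * (ln (mahler_measure Q) - r) \<le> ln (real (card S))"
        using rate unfolding digit_rate_def by (elim exE conjE)
      have "real m * (ln (mahler_measure Q) - r') \<le> real m * (ln (mahler_measure Q) - r)"
        using le' by (intro mult_left_mono) auto
      with mS(2) have "real m * (ln (mahler_measure Q) - r') \<le> ln (real (card S))" by linarith
      with mS(1) show ?thesis unfolding digit_rate_def by (intro exI conjI)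
    qed
    have "digit_rate (graeffe P k) (2 ^ k * \<epsilon>)"
    proof (rule mono)
      show "digit_rate (graeffe P k) (ln 2)" by (rule k0) (simp add: k_def)
    qed (rule le)
    moreover have "reflect (graeffe P i) \<noteq> graeffe P i" for i using False by blast
    ultimately show ?thesis by (intro graeffe_chain(2)[OF less.prems(1,3)])
  qed
qed

section \<open>Kronecker's theorem\<close>

lemma graeffe_root:
  fixes x :: "'a :: field_char_0"
  assumes "poly (of_int_poly (graeffe P k)) x = 0"
  shows "poly (of_int_poly (graeffe P (k + l))) (x ^ 2 ^ l) = 0"
proof (induction l)
  case 0
  show ?case using assms by simp
next
  case (Suc l)
  let ?y = "x ^ 2 ^ l" and ?G = "graeffe P (k + l)"
  have "poly (of_int_poly (graeffe P (Suc (k + l)))) (?y ^ 2)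
      = poly (of_int_poly (in_square (graeffe P (Suc (k + l))))) ?y"
    by (simp add: of_int_hom.map_poly_pcompose poly_pcompose poly_monom)
  also have "\<dots> = 0"
    unfolding in_square_graeffe_Suc
    by (simp only: of_int_hom.map_poly_hom_smult of_int_poly_hom.hom_mult poly_smult poly_mult Suc mult_zero_left mult_zero_right)
  finally show ?case by (simp only: add_Suc_right power_Suc2 power_mult)
qed

text \<open>
  The Graeffe iterates all have Mahler measure 1, so two of them agree. Then a power map sends the
  finite set of roots of this iterate into itself, and the orbit of a power of \<open>x\<close> under it repeats
  itself.
\<close>

theorem kronecker_root_of_unity:
  fixes x :: "'a :: field_char_0"
  assumes P: "P \<noteq> 0" "poly (of_int_poly P) x = 0" and x: "x \<noteq> 0" and M: "mahler_measure P = 1"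
  shows "x \<in> roots_of_unity"
proof -
  let ?A = "{F :: int poly. degree F \<le> degree P \<and> mahler_measure F \<le> 1}"
  have "graeffe P k \<in> ?A" for k by (simp add: degree_graeffe mahler_measure_graeffe M)
  hence "range (graeffe P) \<subseteq> ?A" by blast
  hence "finite (range (graeffe P))" using finite_int_polys_mahler_bounded by (rule finite_subset)
  hence "\<not> inj (graeffe P)" using finite_imageD infinite_UNIV_nat by blast
  then obtain i j where ij: "i < j" "graeffe P i = graeffe P j"
    by (metis injI linorder_neqE_nat)
  define l where "l = j - i"
  have l: "l > 0" "i + l = j" using ij by (simp_all add: l_def)
  define Z where "Z = {z :: 'a. poly (of_int_poly (graeffe P i)) z = 0}"
  have "graeffe P i \<noteq> 0"
  proof
    assume "graeffe P i = 0"
    hence "mahler_measure (graeffe P i) = 0" by (simp add: mahler_measure_def)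
    thus False by (simp add: mahler_measure_graeffe M)
  qed
  hence "finite Z" unfolding Z_def by (intro poly_roots_finite) simp
  have step: "z ^ 2 ^ l \<in> Z" if "z \<in> Z" for z
    using graeffe_root[of P i z l] that unfolding l(2) ij(2)[symmetric] Z_def by simp
  define z where "z = x ^ 2 ^ i"
  have "z \<in> Z" using graeffe_root[of P 0 x i] P(2) unfolding Z_def z_def by simp
  have orbit: "z ^ (2 ^ l) ^ n \<in> Z" for n
  proof (induction n)
    case (Suc n)
    have "z ^ (2 ^ l) ^ Suc n = (z ^ (2 ^ l) ^ n) ^ 2 ^ l" by (simp only: power_Suc2 power_mult)
    with step[OF Suc] show ?case by (simp only:)
  qed (use \<open>z \<in> Z\<close> in simp)
  hence "range (\<lambda>n. z ^ (2 ^ l) ^ n) \<subseteq> Z" by blast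
  hence "finite (range (\<lambda>n. z ^ (2 ^ l) ^ n))" using \<open>finite Z\<close> by (rule finite_subset)
  hence "\<not> inj (\<lambda>n. z ^ (2 ^ l) ^ n)" using finite_imageD infinite_UNIV_nat by blast
  then obtain a b where ab: "a < b" "z ^ (2 ^ l) ^ a = z ^ (2 ^ l) ^ b"
    by (metis (mono_tags, lifting) injI linorder_neqE_nat)
  have "(1::nat) < 2 ^ l" using l(1) by (intro one_less_power) auto
  hence lt: "((2::nat) ^ l) ^ a < (2 ^ l) ^ b" using ab(1) by (intro power_strict_increasing) auto
  define e where "e = (2 ^ l) ^ b - ((2::nat) ^ l) ^ a"
  have e: "(2 ^ l) ^ b = ((2::nat) ^ l) ^ a + e" "e > 0" using lt by (simp_all add: e_def)
  have "z ^ (2 ^ l) ^ a * z ^ e = z ^ (2 ^ l) ^ a * 1" using ab(2) unfolding e(1) power_add by simp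
  moreover have "z ^ (2 ^ l) ^ a \<noteq> 0" using x by (simp add: z_def)
  ultimately have "z ^ e = 1" using mult_left_cancel[of "z ^ (2 ^ l) ^ a" "z ^ e" 1] by blast
  hence "x ^ (2 ^ i * e) = 1" by (simp only: z_def power_mult)
  moreover have "2 ^ i * e > 0" using e(2) by simp
  ultimately show ?thesis unfolding roots_of_unity_def by blast
qed

section \<open>Small values by the pigeonhole principle\<close>

text \<open>
  Instead of counting classes modulo \<open>P\<close> and \<open>q\<close>, one counts pairs \<open>(a, r)\<close>, where \<open>r\<close> is a polynomial of
  degree less than \<open>N - degree P\<close> with coefficients reduced modulo \<open>q\<close>, and looks at \<open>a + P r\<close> modulo
  \<open>q\<close>. Since \<open>P\<close> is primitive, \<open>r\<close> can be recovered from \<open>P r\<close> modulo \<open>q\<close>, so that a collision involves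
  two different elements of \<open>A\<close>.
\<close>

lemma pigeonhole_mod_primitive:
  fixes P :: "int poly" and A :: "int poly set" and q :: nat
  assumes P: "content P = 1" and q: "q > 0"
    and A: "finite A" "\<And>a. a \<in> A \<Longrightarrow> degree a < N" and N: "degree P \<le> N" and card: "card A > q ^ degree P"
  shows "\<exists>a\<in>A. \<exists>b\<in>A. \<exists>R S. a \<noteq> b \<and> a - b = P * R + smult (int q) S"
proof -
  define d where "d = degree P"
  define D where "D = {..<N - d} \<rightarrow>\<^sub>E {0..<int q}"
  define poly_of where "poly_of r = (\<Sum>i<N - d. monom (r i) i)" for r :: "nat \<Rightarrow> int"
  have coeff_poly_of: "coeff (poly_of r) i = (if i < N - d then r i else 0)" for r i
    unfolding poly_of_def coeff_sum by simp
  define \<phi> where "\<phi> = (\<lambda>(a, r). restrict (\<lambda>i. coeff (a + P * poly_of r) i mod int q) {..<N})"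
  have fin: "finite (A \<times> D)" unfolding D_def using A(1) by (intro finite_cartesian_product finite_PiE) auto
  have "\<not> inj_on \<phi> (A \<times> D)"
  proof
    assume inj: "inj_on \<phi> (A \<times> D)"
    have "\<phi> ` (A \<times> D) \<subseteq> {..<N} \<rightarrow>\<^sub>E {0..<int q}"
      using q unfolding \<phi>_def by (intro image_subsetI) (auto split: prod.splits)
    hence "card (A \<times> D) \<le> card ({..<N} \<rightarrow>\<^sub>E {0..<int q})"
    proof (rule card_inj_on_le[OF inj])
      show "finite ({..<N} \<rightarrow>\<^sub>E {0..<int q})" by (intro finite_PiE) auto
    qed
    moreover have "card D = q ^ (N - d)" "card ({..<N} \<rightarrow>\<^sub>E {0..<int q}) = q ^ N"
      unfolding D_def by (simp_all add: card_PiE)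
    ultimately have "card A * q ^ (N - d) \<le> q ^ N" by (simp only: card_cartesian_product)
    moreover have "q ^ N = q ^ d * q ^ (N - d)" using N by (simp add: d_def flip: power_add)
    ultimately have "card A * q ^ (N - d) \<le> q ^ d * q ^ (N - d)" by linarith
    hence "card A \<le> q ^ d" using q by simp
    with card show False by (simp add: d_def)
  qed
  then obtain x y where xy: "x \<in> A \<times> D" "y \<in> A \<times> D" "\<phi> x = \<phi> y" "x \<noteq> y"
    unfolding inj_on_def by blast
  obtain a r b s where "x = (a, r)" "y = (b, s)" by (cases x, cases y)
  with xy have ars: "a \<in> A" "r \<in> D" "b \<in> A" "s \<in> D" "(a, r) \<noteq> (b, s)" "\<phi> (a, r) = \<phi> (b, s)"
    by auto
  define W where "W = (a + P * poly_of r) - (b + P * poly_of s)"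
  have deg_lt: "coeff (a + P * poly_of r) i = 0" if "i \<ge> N" "a \<in> A" for a r i
  proof -
    have "coeff (P * poly_of r) i = 0"
    proof (cases "poly_of r = 0")
      case False
      have "degree (poly_of r) < N - d"
      proof (rule ccontr)
        assume "\<not> degree (poly_of r) < N - d"
        hence "lead_coeff (poly_of r) = 0" by (simp only: coeff_poly_of if_False)
        with False show False by simp
      qed
      hence "degree (P * poly_of r) < N"
        using degree_mult_le[of P "poly_of r"] unfolding d_def by linarith
      thus ?thesis using that(1) by (intro coeff_eq_0) linarith
    qed simp
    moreover have "coeff a i = 0" using A(2)[OF that(2)] that(1) by (intro coeff_eq_0) linarith
    ultimately show ?thesis by simp
  qed
  have "int q dvd coeff W i" for i
  proof (cases "i < N")
    case True
    have "\<phi> (a, r) i = \<phi> (b, s) i" using ars(6) by (rule fun_cong)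
    hence "coeff (a + P * poly_of r) i mod int q = coeff (b + P * poly_of s) i mod int q"
      using True unfolding \<phi>_def by simp
    thus ?thesis unfolding W_def coeff_diff by (simp only: mod_eq_dvd_iff)
  next
    case False
    hence "i \<ge> N" by simp
    hence "coeff W i = 0"
      unfolding W_def coeff_diff[of "_ + _"]
      using deg_lt[OF \<open>i \<ge> N\<close> ars(1), of r] deg_lt[OF \<open>i \<ge> N\<close> ars(3), of s] by (simp only: diff_self)
    thus ?thesis by simp
  qed
  hence "[:int q:] dvd W" by (simp only: const_poly_dvd_iff) blast
  then obtain S where S: "W = smult (int q) S" by (elim dvdE) simp
  have ab: "a - b = P * (poly_of s - poly_of r) + smult (int q) S"
    unfolding S[symmetric] W_def by (simp add: right_diff_distrib)
  \<comment> \<open>If \<open>a\<close> and \<open>b\<close> were equal, then \<open>q\<close> would divide \<open>P\<close> times the difference of two reduced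
    polynomials, hence, by Gauss, this difference, which would be zero.\<close>
  have "a \<noteq> b"
  proof
    assume "a = b"
    define V where "V = poly_of r - poly_of s"
    have "0 = P * (poly_of s - poly_of r) + smult (int q) S" using ab unfolding \<open>a = b\<close> by simp
    hence "P * V = smult (int q) S" unfolding V_def right_diff_distrib by (simp only: algebra_simps)
    hence "P * V = [:int q:] * S"
      by (simp only: mult_pCons_left mult_zero_left pCons_0_0 add_0_right)
    hence "[:int q:] dvd P * V" by (rule dvdI)
    hence "int q dvd content (P * V)" by (simp only: const_poly_dvd_iff_dvd_content)
    hence "int q dvd content V" by (simp only: content_mult P mult_1)
    hence dvd: "int q dvd coeff V i" for i by (rule dvd_trans) (rule content_dvd_coeff)
    have "r i = s i" for i
    proof (cases "i \<in> {..<N - d}")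
      case True
      have "r i \<in> {0..<int q}" by (rule PiE_mem[OF ars(2)[unfolded D_def] True])
      moreover have "s i \<in> {0..<int q}" by (rule PiE_mem[OF ars(4)[unfolded D_def] True])
      ultimately have lt: "\<bar>r i - s i\<bar> < \<bar>int q\<bar>"
        unfolding atLeastLessThan_iff abs_of_nat by linarith
      have "coeff V i = r i - s i" using True unfolding V_def coeff_diff coeff_poly_of by simp
      with dvd[of i] have q_dvd: "int q dvd r i - s i" by simp
      show ?thesis
      proof (rule ccontr)
        assume "r i \<noteq> s i"
        hence "r i - s i \<noteq> 0" by simp
        from dvd_imp_le_int[OF this q_dvd] lt show False by linarith
      qed
    next
      case False
      have "r i = undefined" by (rule PiE_arb[OF ars(2)[unfolded D_def] False])
      moreover have "s i = undefined" by (rule PiE_arb[OF ars(4)[unfolded D_def] False])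
      ultimately show ?thesis by simp
    qed
    hence "r = s" by (rule ext)
    hence "(a, r) = (b, s)" using \<open>a = b\<close> by blast
    with ars(5) show False by (rule notE)
  qed
  hence "a \<noteq> b \<and> a - b = P * (poly_of s - poly_of r) + smult (int q) S" using ab by (rule conjI)
  hence "\<exists>R S. a \<noteq> b \<and> a - b = P * R + smult (int q) S"
    by (rule exI[of "\<lambda>S. a \<noteq> b \<and> a - b = P * (poly_of s - poly_of r) + smult (int q) S", THEN exI[of "\<lambda>R. \<exists>S. a \<noteq> b \<and> a - b = P * R + smult (int q) S"]])
  thus ?thesis by (rule bexI[OF bexI[OF _ ars(3)] ars(1)])
qed

lemma mahler_measure_le_height:
  assumes "\<And>i. real_of_int \<bar>coeff F i\<bar> \<le> H"
  shows "mahler_measure F \<le> real (degree F + 1) * H"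
proof -
  have H0: "H \<ge> 0" using assms[of 0] by linarith
  have "mahler_measure F \<le> sqrt (real_of_int (\<Sum>a\<leftarrow>coeffs F. a * a))"
    by (rule Landau_inequality_mahler_measure)
  also have "\<dots> \<le> sqrt ((real (degree F + 1) * H) ^ 2)"
  proof (rule real_sqrt_le_mono)
    have "real_of_int (\<Sum>a\<leftarrow>coeffs F. a * a) = (\<Sum>a\<leftarrow>coeffs F. (real_of_int \<bar>a\<bar>) ^ 2)"
      by (simp add: of_int_hom.hom_sum_list o_def power2_eq_square)
    also have "\<dots> \<le> (\<Sum>a\<leftarrow>coeffs F. H ^ 2)"
    proof (rule sum_list_mono)
      fix a assume "a \<in> set (coeffs F)"
      then obtain i where "a = coeff F i" by (auto simp: coeffs_def split: if_splits)
      thus "(real_of_int \<bar>a\<bar>) ^ 2 \<le> H ^ 2" using assms[of i] by (intro power_mono) auto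
    qed
    also have "\<dots> = real (length (coeffs F)) * H ^ 2" by (simp add: sum_list_triv)
    also have "\<dots> \<le> real (degree F + 1) * H ^ 2"
      by (cases "F = 0") (auto intro!: mult_right_mono simp: length_coeffs)
    also have "\<dots> \<le> real (degree F + 1) ^ 2 * H ^ 2"
      by (intro mult_right_mono self_le_power) auto
    finally show "real_of_int (\<Sum>a\<leftarrow>coeffs F. a * a) \<le> (real (degree F + 1) * H) ^ 2"
      by (simp only: power_mult_distrib)
  qed
  also have "\<dots> = real (degree F + 1) * H" using H0 by (simp add: real_sqrt_abs)
  finally show ?thesis .
qed

text \<open>
  If \<open>F\<close> divides \<open>Q + b P\<close> and \<open>Q + c P\<close>, then it divides \<open>(b - c) P\<close>. Hence each \<open>F\<close> excludes at most
  one value of \<open>b\<close>.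
\<close>

lemma ex_shift_avoiding_factors:
  fixes P Q :: "int poly" and \<F> :: "int poly set"
  assumes P: "irreducible P" and fin: "finite \<F>"
    and \<F>: "\<And>F. F \<in> \<F> \<Longrightarrow> irreducible F \<and> degree F > 0 \<and> \<not> P dvd F"
  shows "\<exists>b\<le>card \<F>. \<forall>F\<in>\<F>. \<not> F dvd Q + smult (int b) P"
proof (rule ccontr)
  assume "\<not> ?thesis"
  hence "\<forall>b. \<exists>F. b \<le> card \<F> \<longrightarrow> F \<in> \<F> \<and> F dvd Q + smult (int b) P" by blast
  from choice[OF this] obtain f where f: "\<And>b. b \<le> card \<F> \<Longrightarrow> f b \<in> \<F> \<and> f b dvd Q + smult (int b) P"
    by blast
  have "inj_on f {..card \<F>}"
  proof (rule inj_onI, rule ccontr)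
    fix b c assume bc: "b \<in> {..card \<F>}" "c \<in> {..card \<F>}" "f b = f c" "b \<noteq> c"
    define F where "F = f b"
    have F: "F \<in> \<F>" "F dvd Q + smult (int b) P" "F dvd Q + smult (int c) P"
      using f[of b] f[of c] bc unfolding F_def by auto
    have "F dvd (Q + smult (int b) P) - (Q + smult (int c) P)" using F(2,3) by (rule dvd_diff)
    also have "(Q + smult (int b) P) - (Q + smult (int c) P) = [:int b - int c:] * P"
      by (simp add: smult_diff_left)
    finally have dvd: "F dvd [:int b - int c:] * P" .
    have "prime_elem F" using \<F>[OF F(1)] by (intro irreducible_imp_prime_elem_gcd) blast
    hence "F dvd [:int b - int c:] \<or> F dvd P" using dvd by (rule prime_elem_dvd_multD)
    moreover have "\<not> F dvd [:int b - int c:]"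
    proof
      assume "F dvd [:int b - int c:]"
      hence "degree F \<le> degree [:int b - int c:]" using bc(4) by (intro dvd_imp_degree_le) auto
      with \<F>[OF F(1)] show False by simp
    qed
    moreover have "\<not> F dvd P"
    proof
      assume "F dvd P"
      then obtain G where G: "P = F * G" by (elim dvdE)
      have "is_unit F \<or> is_unit G" using irreducibleD[OF P G] .
      moreover have "\<not> is_unit F" using \<F>[OF F(1)] by (simp add: irreducible_def)
      ultimately have "P dvd F" unfolding G by (metis dvd_refl mult_unit_dvd_iff)
      with \<F>[OF F(1)] show False by blast
    qed
    ultimately show False by blast
  qed
  hence "card {..card \<F>} \<le> card \<F>" using f fin by (intro card_inj_on_le[of f]) auto
  thus False by simp
qed

lemma eventually_log_less_linear:
  fixes \<alpha> \<beta> \<gamma> :: real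
  assumes "\<alpha> > 0" "\<gamma> > 0"
  shows "eventually (\<lambda>n :: nat. \<beta> + \<gamma> * ln (real n) < \<alpha> * real n) sequentially"
  using assms by real_asymp

context padic_unit
begin

context
  fixes P :: "int poly"
  assumes irreducible_P: "irreducible P" and P_\<kappa>: "poly (of_int_poly P) \<kappa> = 0"
begin

text \<open>
  The small values of integer polynomials at \<open>\<kappa>\<close>. The constant \<open>c\<close> does not depend on \<open>n\<close> or \<open>k\<close>, so the
  coefficients grow only linearly in the degree. A difference of two expansions that is congruent to a
  multiple of \<open>P\<close> modulo \<open>p ^ k\<close> takes a value divisible by \<open>p ^ k\<close>.
\<close>

lemma ex_small_value:
  assumes "\<epsilon> > 0"
  shows "\<exists>m c. m > 0 \<and> (\<forall>n k. n * m \<ge> degree P \<longrightarrow>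
    real k * real (degree P) * ln (real p) < real (n * m) * (ln (mahler_measure P) - \<epsilon>) \<longrightarrow>
    (\<exists>Q. \<not> P dvd Q \<and> degree Q \<le> n * m \<and> (\<forall>i. real_of_int \<bar>coeff Q i\<bar> \<le> real n * c) \<and>
      v (poly (of_int_poly Q) \<kappa>) \<le> inverse (real p ^ k)))"
proof -
  have deg: "degree P > 0" using irreducible_P P_\<kappa> by (rule degree_pos_if_irreducible_root)
  have c0: "coeff P 0 \<noteq> 0"
  proof
    assume "coeff P 0 = 0"
    hence "poly (of_int_poly P) (0 :: 'a) = 0" by (simp add: poly_0_coeff_0)
    hence "P dvd [:0, 1:]"
      by (intro irreducible_int_poly_dvd_if_common_root[OF irreducible_P, of "0 :: 'a"])
         (simp_all add: of_int_hom.map_poly_pCons_hom)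
    then obtain G where "[:0, 1:] = P * G" by (elim dvdE)
    hence "poly (of_int_poly [:0, 1:]) \<kappa> = poly (of_int_poly (P * G)) \<kappa>" by (rule arg_cong)
    hence "\<kappa> = 0" by (simp add: of_int_poly_hom.hom_mult P_\<kappa> of_int_hom.map_poly_pCons_hom)
    with v_\<kappa> show False using v_eq_0_iff[of 0] by simp
  qed
  obtain m S where S: "digit_system P m S"
    and rate: "real m * (ln (mahler_measure P) - \<epsilon>) \<le> ln (real (card S))"
    using digit_rate_irreducible[OF irreducible_P deg c0 assms] unfolding digit_rate_def by (elim exE conjE)
  have m: "m > 0" and fin: "finite S" "S \<noteq> {}" and deg_S: "\<And>s. s \<in> S \<Longrightarrow> degree s < m"
    and sep: "\<And>n f g. f ` {..<n} \<subseteq> S \<Longrightarrow> g ` {..<n} \<subseteq> S \<Longrightarrow> P dvd digit_sum m n f - digit_sum m n g \<Longrightarrow>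
       (\<forall>i<n. f i = g i)"
    using S unfolding digit_system_def by blast+
  have card_S: "card S > 0" using fin by (simp add: card_gt_0_iff)
  define c where "c = Max ((\<lambda>(s, i). real_of_int \<bar>coeff s i\<bar>) ` (S \<times> {..m}))"
  have c: "real_of_int \<bar>coeff s i\<bar> \<le> c" if "s \<in> S" for s i
  proof (cases "i \<le> m")
    case True
    thus ?thesis unfolding c_def using fin that by (intro Max_ge) (auto intro!: image_eqI[of _ _ "(s, i)"])
  next
    case False
    obtain s0 where "s0 \<in> S" using fin by blast
    hence "real_of_int \<bar>coeff s0 0\<bar> \<le> c"
      unfolding c_def using fin by (intro Max_ge) (auto intro!: image_eqI[of _ _ "(s0, 0)"])
    moreover have "coeff s i = 0" using False deg_S[OF that] by (intro coeff_eq_0) linarith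
    ultimately show ?thesis by simp
  qed
  have "\<exists>Q. \<not> P dvd Q \<and> degree Q \<le> n * m \<and> (\<forall>i. real_of_int \<bar>coeff Q i\<bar> \<le> real n * (2 * c)) \<and>
      v (poly (of_int_poly Q) \<kappa>) \<le> inverse (real p ^ k)"
    if nm: "n * m \<ge> degree P"
      and k: "real k * real (degree P) * ln (real p) < real (n * m) * (ln (mahler_measure P) - \<epsilon>)" for n k
  proof -
    define D where "D = {..<n} \<rightarrow>\<^sub>E S"
    have imgD: "f ` {..<n} \<subseteq> S" if "f \<in> D" for f using that unfolding D_def by auto
    have inj: "inj_on (digit_sum m n) D"
    proof (rule inj_onI)
      fix f g assume fg: "f \<in> D" "g \<in> D" "digit_sum m n f = digit_sum m n g"
      have "\<forall>i<n. f i = g i" using fg by (intro sep imgD) simp_all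
      thus "f = g" using fg unfolding D_def by (intro PiE_ext[of f]) auto
    qed
    let ?A = "digit_sum m n ` D"
    have "card ?A = card S ^ n" using inj by (simp add: card_image D_def card_PiE)
    have p0: "real p > 0" using prime_gt_0_nat[OF prime_p] by simp
    have "real n * ln (real (card S)) \<ge> real n * (real m * (ln (mahler_measure P) - \<epsilon>))"
      using rate by (intro mult_left_mono) auto
    with k have "real k * real (degree P) * ln (real p) < real n * ln (real (card S))" by simp
    hence "ln ((real p ^ k) ^ degree P) < ln (real (card S) ^ n)"
      using p0 card_S by (simp add: ln_realpow mult_ac)
    hence "(real p ^ k) ^ degree P < real (card S) ^ n" using p0 card_S by (subst (asm) ln_less_cancel_iff) auto
    hence "real ((p ^ k) ^ degree P) < real (card S ^ n)" by simp
    hence card_A: "(p ^ k) ^ degree P < card ?A" unfolding \<open>card ?A = card S ^ n\<close> by (simp only: of_nat_less_iff)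
    have deg_ds: "degree (digit_sum m n f) < n * m" if "f \<in> D" for f
    proof -
      have "n * m > 0" using nm deg by linarith
      have "coeff (digit_sum m n f) i = 0" if i: "i \<ge> n * m" for i
      proof -
        have "coeff (f j * monom 1 (m * j)) i = 0" if j: "j < n" for j
        proof (rule coeff_eq_0)
          have "degree (f j) < m" using deg_S imgD[OF \<open>f \<in> D\<close>] j by blast
          moreover have "degree (f j * monom 1 (m * j)) \<le> degree (f j) + m * j"
            using degree_mult_le[of "f j" "monom 1 (m * j)"] degree_monom_le[of "1 :: int" "m * j"] by linarith
          moreover have "m * (j + 1) \<le> m * n" using j by (intro mult_le_mono2) simp
          ultimately show "degree (f j * monom 1 (m * j)) < i"
            using i by (simp add: mult.commute[of n m])
        qed
        thus ?thesis unfolding digit_sum_def coeff_sum by simp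
      qed
      thus ?thesis using \<open>n * m > 0\<close> by (intro degree_lessI) auto
    qed
    have "content P = 1" using irreducible_imp_primitive[OF irreducible_P] deg by (simp add: primitive_iff_content_eq_1)
    moreover have "p ^ k > 0" using prime_gt_0_nat[OF prime_p] by simp
    moreover have "finite ?A" unfolding D_def using fin by (intro finite_imageI finite_PiE) auto
    moreover have "\<And>a. a \<in> ?A \<Longrightarrow> degree a < n * m" using deg_ds by blast
    ultimately obtain a b R T where ab: "a \<in> ?A" "b \<in> ?A" "a \<noteq> b" "a - b = P * R + smult (int (p ^ k)) T"
      using pigeonhole_mod_primitive[of P "p ^ k" ?A "n * m"] nm card_A by blast
    obtain f g where fg: "f \<in> D" "a = digit_sum m n f" "g \<in> D" "b = digit_sum m n g" using ab(1,2) by blast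
    have not_dvd: "\<not> P dvd a - b"
    proof
      assume "P dvd a - b"
      hence "\<forall>i<n. f i = g i" unfolding fg by (intro sep imgD fg)
      hence "f = g" using fg(1,3) unfolding D_def by (intro PiE_ext[of f]) auto
      with ab(3) fg show False by simp
    qed
    have coeff_ds: "real_of_int \<bar>coeff (digit_sum m n f) i\<bar> \<le> real n * c" if "f \<in> D" for f i
    proof -
      have "real_of_int \<bar>coeff (digit_sum m n f) i\<bar> \<le> (\<Sum>j<n. real_of_int \<bar>coeff (f j * monom 1 (m * j)) i\<bar>)"
        unfolding digit_sum_def coeff_sum using sum_abs[of "\<lambda>j. real_of_int (coeff (f j * monom 1 (m * j)) i)" "{..<n}"]
        by simp
      also have "\<dots> \<le> (\<Sum>j<n. c)"
      proof (rule sum_mono)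
        fix j assume "j \<in> {..<n}"
        hence fj: "f j \<in> S" using imgD[OF that] by blast
        have "coeff (f j * monom 1 (m * j)) i = (if m * j \<le> i then coeff (f j) (i - m * j) else 0)"
          using coeff_monom_mult[of "1 :: int" "m * j" "f j" i] by (simp only: mult.commute[of "f j"] mult_1)
        thus "real_of_int \<bar>coeff (f j * monom 1 (m * j)) i\<bar> \<le> c"
          using c[OF fj, of "i - m * j"] c[OF fj, of 0] by (cases "m * j \<le> i") simp_all
      qed
      also have "\<dots> = real n * c" by simp
      finally show ?thesis .
    qed
    have "poly (of_int_poly (a - b)) \<kappa> = of_int (int p ^ k) * poly (of_int_poly T) \<kappa>"
      unfolding ab(4) by (simp add: of_int_poly_hom.hom_add of_int_poly_hom.hom_mult of_int_hom.map_poly_hom_smult P_\<kappa>)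
    hence "v (poly (of_int_poly (a - b)) \<kappa>) = v (of_int (int p ^ k)) * v (poly (of_int_poly T) \<kappa>)"
      by (simp only: v_mult)
    also have "\<dots> \<le> v (of_int (int p ^ k)) * 1"
      by (intro mult_left_mono v_int_poly_le_1 v_nonneg)
    also have "\<dots> = inverse (real p ^ k)" by (simp only: v_p_power mult_1_right)
    finally have v_le: "v (poly (of_int_poly (a - b)) \<kappa>) \<le> inverse (real p ^ k)" .
    have "degree (a - b) < n * m" using deg_ds fg by (intro degree_diff_less) auto
    moreover have "real_of_int \<bar>coeff (a - b) i\<bar> \<le> real n * (2 * c)" for i
    proof -
      have "real_of_int \<bar>coeff (a - b) i\<bar> \<le> real_of_int \<bar>coeff a i\<bar> + real_of_int \<bar>coeff b i\<bar>"
        unfolding coeff_diff by linarith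
      also have "\<dots> \<le> real n * c + real n * c" unfolding fg by (intro add_mono coeff_ds fg)
      also have "\<dots> = real n * (2 * c)" by (simp add: algebra_simps)
      finally show ?thesis .
    qed
    ultimately show ?thesis using not_dvd v_le by (intro exI[of _ "a - b"]) auto
  qed
  with m show ?thesis by blast
qed

text \<open>
  Degree, \<open>ln M\<close> and \<open>- ln |F(\<kappa>)|\<close> are additive in \<open>F\<close>, so the bounds for the irreducible factors add
  up.
\<close>

lemma neg_ln_value_le_of_factors:
  assumes C: "C \<ge> 0"
    and fac: "\<And>F. irreducible F \<Longrightarrow> F dvd Q \<Longrightarrow> - ln (v (poly (of_int_poly F) \<kappa>)) \<le> A * real (degree F) + C * ln (mahler_measure F)"
    and Q: "\<not> P dvd Q"
  shows "- ln (v (poly (of_int_poly Q) \<kappa>)) \<le> A * real (degree Q) + C * ln (mahler_measure Q)"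
  using fac Q
proof (induction Q rule: prime_divisors_induct)
  case (unit Q)
  then obtain Q' where Q': "Q * Q' = 1" by (metis dvdE)
  hence "degree Q + degree Q' = degree (1 :: int poly)"
    using Polynomial.degree_mult_eq[of Q Q'] by (metis mult_zero_left mult_zero_right zero_neq_one)
  hence deg: "degree Q = 0" by simp
  have ev: "v (poly (of_int_poly Q) \<kappa>) * v (poly (of_int_poly Q') \<kappa>) = 1"
    using arg_cong[OF Q', of "\<lambda>q. v (poly (of_int_poly q) \<kappa>)"]
    by (simp only: of_int_poly_hom.hom_mult poly_mult v_mult of_int_poly_hom.hom_one poly_1 v_1)
  have "v (poly (of_int_poly Q) \<kappa>) * v (poly (of_int_poly Q') \<kappa>) \<le> v (poly (of_int_poly Q) \<kappa>) * 1"
    by (intro mult_left_mono v_int_poly_le_1 v_nonneg)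
  hence "ln 1 \<le> ln (v (poly (of_int_poly Q) \<kappa>))" unfolding ev by (intro ln_mono) auto
  moreover have "Q \<noteq> 0" using Q' by auto
  hence "C * ln (mahler_measure Q) \<ge> 0" using C mahler_measure_poly_ge_1[of Q] by simp
  ultimately show ?case unfolding deg by simp
next
  case (factor F Q)
  have irr: "irreducible F" using factor.hyps by (intro algebraic_semidom_class.prime_elem_imp_irreducible prime_imp_prime_elem)
  have not: "\<not> P dvd F" "\<not> P dvd Q" using factor.prems(2) by (auto intro: dvd_mult dvd_mult2)
  hence nz: "F \<noteq> 0" "Q \<noteq> 0" by auto
  have 1: "- ln (v (poly (of_int_poly F) \<kappa>)) \<le> A * real (degree F) + C * ln (mahler_measure F)"
    using irr by (intro factor.prems(1)) auto
  have 2: "- ln (v (poly (of_int_poly Q) \<kappa>)) \<le> A * real (degree Q) + C * ln (mahler_measure Q)"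
    by (intro factor.IH factor.prems(1) not) (auto intro: dvd_mult)
  have pos: "v (poly (of_int_poly F) \<kappa>) > 0" "v (poly (of_int_poly Q) \<kappa>) > 0"
    using v_int_poly_ge(1)[OF irreducible_P P_\<kappa>] not by blast+
  have M: "mahler_measure F > 0" "mahler_measure Q > 0"
    using mahler_measure_poly_ge_1[OF nz(1)] mahler_measure_poly_ge_1[OF nz(2)] by linarith+
  have "ln (v (poly (of_int_poly (F * Q)) \<kappa>)) = ln (v (poly (of_int_poly F) \<kappa>)) + ln (v (poly (of_int_poly Q) \<kappa>))"
    using ln_mult_pos[OF pos] by (simp only: of_int_poly_hom.hom_mult poly_mult v_mult)
  moreover have "ln (mahler_measure (F * Q)) = ln (mahler_measure F) + ln (mahler_measure Q)"
    using ln_mult_pos[OF M] by (simp only: mahler_measure_mult)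
  moreover have "degree (F * Q) = degree F + degree Q" using nz by (rule Polynomial.degree_mult_eq)
  ultimately show ?case using 1 2 by (simp add: algebra_simps)
qed simp

end

end

section \<open>Selection of an irreducible factor\<close>

lemma mahler_measure_const: "mahler_measure [:c:] = \<bar>real_of_int c\<bar>"
  unfolding mahler_measure_def of_int_hom.map_poly_pCons_hom map_poly_0 mahler_measure_constant by simp

lemma abs_lead_coeff_le_mahler_measure: "\<bar>real_of_int (lead_coeff F)\<bar> \<le> mahler_measure F"
proof -
  have "1 \<le> (\<Prod>a\<leftarrow>complex_roots_int F. max 1 (cmod a))" by (rule prod_list_ge1) auto
  hence "\<bar>real_of_int (lead_coeff F)\<bar> * 1 \<le> \<bar>real_of_int (lead_coeff F)\<bar> * (\<Prod>a\<leftarrow>complex_roots_int F. max 1 (cmod a))"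
    by (rule mult_left_mono) simp
  thus ?thesis unfolding mahler_measure_via_roots by simp
qed

context padic_unit
begin

text \<open>
  Suppose that no irreducible factor is good. A factor with \<open>ln M(F) > degree F / T\<close> has
  \<open>- ln |F(\<kappa>)| \<le> C ln M(F)\<close> by Liouville's inequality, for a constant \<open>C\<close> that depends only on \<open>T\<close> and \<open>P\<close>. The
  others have degree greater than \<open>T\<close>, because the finitely many exceptions were excluded by the choice
  of \<open>Q\<close>, and so they satisfy \<open>- ln |F(\<kappa>)| < (h - 1 / T) degree F\<close>. Summing over the factors of \<open>Q\<close>
  contradicts \<open>- ln |Q(\<kappa>)| \<ge> (h - 1 / (2 T)) N - ln p\<close>, as \<open>ln M(Q)\<close> grows only logarithmically in
  the degree bound \<open>N\<close>.
\<close>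

lemma ex_good_factor:
  fixes P :: "int poly" and T :: real
  assumes P: "irreducible P" "poly (of_int_poly P) \<kappa> = 0"
  defines "h \<equiv> ln (mahler_measure P) / real (degree P)"
  assumes T: "T > 0" "1 / T < h"
  shows "\<exists>F. irreducible F \<and> lead_coeff F > 0 \<and> \<not> P dvd F \<and> real (degree F) > T \<and>
    ln (mahler_measure F) \<le> real (degree F) / T \<and>
    - ln (v (poly (of_int_poly F) \<kappa>)) \<ge> (h - 1 / T) * real (degree F)"
proof (rule ccontr)
  assume contra: "\<not> ?thesis"
  define d where "d = degree P"
  define L where "L = ln (mahler_measure P)"
  have d: "d > 0" unfolding d_def using P by (rule degree_pos_if_irreducible_root)
  have L: "L = h * real d" using d by (simp add: h_def L_def d_def)
  have M_P: "mahler_measure P \<ge> 1" using P by (intro mahler_measure_poly_ge_1) auto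
  have L0: "L \<ge> 0" unfolding L_def using M_P by simp
  define y where "y F = - ln (v (poly (of_int_poly F) \<kappa>))" for F
  define w where "w F = ln (mahler_measure F)" for F
  have w0: "w F \<ge> 0" if "F \<noteq> 0" for F
    unfolding w_def using mahler_measure_poly_ge_1[OF that] by simp
  have y_le: "y F \<le> real (degree F) * (real d * ln 2 + L) + real d * w F" if "\<not> P dvd F" for F
    unfolding y_def w_def d_def L_def by (rule v_int_poly_ge(2)[OF P that])
  define C where "C = T * (real d * ln 2 + L) + real d"
  have C: "C > 0" unfolding C_def using T(1) d L0 by (intro add_nonneg_pos mult_nonneg_nonneg add_nonneg_nonneg) auto
  define A where "A = h - 1 / T"
  have A: "A > 0" using T(2) by (simp add: A_def)

  have bad: "w F > real (degree F) / T \<or> real (degree F) \<le> T \<or> y F < A * real (degree F)"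
    if "irreducible F" "\<not> P dvd F" for F
  proof (cases "lead_coeff F > 0")
    case True
    thus ?thesis using contra that unfolding y_def w_def A_def by (meson not_le)
  next
    case False
    have "lead_coeff F \<noteq> 0" using that(1) by (metis leading_coeff_0_iff not_irreducible_zero)
    hence "lead_coeff (- F) > 0" using False by (simp del: leading_coeff_0_iff)
    moreover have "irreducible (- F)" "\<not> P dvd - F" using that by simp_all
    ultimately have "w (- F) > real (degree (- F)) / T \<or> real (degree (- F)) \<le> T \<or> y (- F) < A * real (degree (- F))"
      using contra unfolding y_def w_def A_def by (meson not_le)
    moreover have "w (- F) = w F"
      using mahler_measure_mult[of "[:-1:]" F] mahler_measure_const[of "-1"] by (simp add: w_def)
    moreover have "y (- F) = y F"
    proof -
      have "v (- x) = v x" for x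
      proof -
        have "v (- 1) = 1" using v_of_int[of "-1"] prime_p
          by (simp add: not_dvd_imp_multiplicity_0 prime_nat_iff)
        thus ?thesis using v_mult[of "-1" x] by simp
      qed
      thus ?thesis by (simp add: y_def of_int_poly_hom.hom_uminus)
    qed
    ultimately show ?thesis by simp
  qed

  \<comment> \<open>Factors of both small degree and small measure escape the two estimates for factors below.
    There are only finitely many of them.\<close>
  define \<F> where "\<F> = {F :: int poly. irreducible F \<and> degree F > 0 \<and> \<not> P dvd F \<and>
    real (degree F) \<le> T \<and> mahler_measure F \<le> exp 1}"
  have "\<F> \<subseteq> {F. degree F \<le> nat \<lfloor>T\<rfloor> \<and> mahler_measure F \<le> exp 1}"
    unfolding \<F>_def by (auto simp: le_nat_floor)
  hence fin_\<F>: "finite \<F>" using finite_int_polys_mahler_bounded by (rule finite_subset)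

  \<comment> \<open>Half of the margin \<open>1 / T\<close> is spent on the defect of the digit system, the other half
    beats the logarithmic terms.\<close>
  define \<epsilon> where "\<epsilon> = real d / (2 * T)"
  have \<epsilon>: "\<epsilon> > 0" unfolding \<epsilon>_def using d T(1) by simp
  obtain m c where m: "m > 0" and small: "\<And>n k. n * m \<ge> d \<Longrightarrow>
    real k * real d * ln (real p) < real (n * m) * (L - \<epsilon>) \<Longrightarrow>
    (\<exists>Q. \<not> P dvd Q \<and> degree Q \<le> n * m \<and> (\<forall>i. real_of_int \<bar>coeff Q i\<bar> \<le> real n * c) \<and>
      v (poly (of_int_poly Q) \<kappa>) \<le> inverse (real p ^ k))"
    using ex_small_value[OF P \<epsilon>] unfolding d_def[symmetric] L_def[symmetric] by blast
  define cP where "cP = Max ((\<lambda>i. real_of_int \<bar>coeff P i\<bar>) ` {..d})"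
  have cP: "real_of_int \<bar>coeff P i\<bar> \<le> cP" for i
  proof (cases "i \<le> d")
    case True
    thus ?thesis unfolding cP_def by (intro Max_ge) auto
  next
    case False
    have "real_of_int \<bar>coeff P 0\<bar> \<le> cP" unfolding cP_def by (intro Max_ge) auto
    with False show ?thesis by (simp add: coeff_eq_0 d_def)
  qed
  have cP0: "cP \<ge> 0" using cP[of 0] by linarith
  define c' where "c' = max 0 c"
  \<comment> \<open>\<open>E * n ^ 2\<close> bounds the Mahler measure of the polynomial \<open>Q\<close> below.\<close>
  define E where "E = real (m + 1) * (c' + real (card \<F>) * cP + 1)"
  have E: "E > 0" unfolding E_def c'_def using cP0 by (intro mult_pos_pos add_nonneg_pos add_nonneg_nonneg mult_nonneg_nonneg) auto

  have "eventually (\<lambda>n. (ln (real p) + C * ln E) + (2 * C) * ln (real n) < (real m / (2 * T)) * real n) sequentially"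
    using m T(1) C by (intro eventually_log_less_linear) auto
  then obtain N where N: "\<And>n. n \<ge> N \<Longrightarrow>
      (ln (real p) + C * ln E) + (2 * C) * ln (real n) < (real m / (2 * T)) * real n"
    by (auto simp: eventually_sequentially)
  define n where "n = max N (max d 1)"
  have n: "n \<ge> d" "n \<ge> 1" and main: "(ln (real p) + C * ln E) + (2 * C) * ln (real n) < (real m / (2 * T)) * real n"
    using N[of n] by (auto simp: n_def)
  have "n * 1 \<le> n * m" using m by (intro mult_le_mono2) simp
  hence nm: "d \<le> n * m" "n * m > 0" using n by linarith+
  have lnp: "ln (real p) > 0" using prime_gt_1_nat[OF prime_p] by simp
  \<comment> \<open>\<open>k\<close> is the largest integer strictly below \<open>X\<close>, the largest exponent that the count permits.\<close>
  define X where "X = real (n * m) * (h - 1 / (2 * T)) / ln (real p)"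
  have hT: "h - 1 / (2 * T) > 0"
  proof -
    have "1 / (2 * T) \<le> 1 / T" using T(1) by (simp add: field_simps)
    thus ?thesis using T(2) by linarith
  qed
  have X: "X > 0" unfolding X_def using hT lnp nm(2) by (intro divide_pos_pos mult_pos_pos) (simp_all only: of_nat_0_less_iff)
  define k where "k = nat (\<lceil>X\<rceil> - 1)"
  have k: "real k < X" "real k \<ge> X - 1" unfolding k_def using X by linarith+
  have "real k * real d * ln (real p) < real (n * m) * (L - \<epsilon>)"
  proof -
    have "real k * (real d * ln (real p)) < X * (real d * ln (real p))"
      using k(1) d lnp by (intro mult_strict_right_mono) auto
    also have "\<dots> = real (n * m) * (h - 1 / (2 * T)) * real d"
      unfolding X_def using lnp by simp
    also have "\<dots> = real (n * m) * (L - \<epsilon>)"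
      unfolding L \<epsilon>_def by (simp add: left_diff_distrib right_diff_distrib)
    finally show ?thesis by (simp only: mult.assoc)
  qed
  from small[OF nm(1) this] obtain Q0 where Q0: "\<not> P dvd Q0" "degree Q0 \<le> n * m"
    "\<And>i. real_of_int \<bar>coeff Q0 i\<bar> \<le> real n * c" "v (poly (of_int_poly Q0) \<kappa>) \<le> inverse (real p ^ k)"
    by blast
  obtain b where b: "b \<le> card \<F>" "\<forall>F\<in>\<F>. \<not> F dvd Q0 + smult (int b) P"
    using ex_shift_avoiding_factors[OF P(1) fin_\<F>, of Q0] unfolding \<F>_def by blast
  \<comment> \<open>\<open>Q\<close> takes the same value at \<open>\<kappa>\<close> as \<open>Q0\<close>, but none of its factors belongs to \<open>\<F>\<close>.\<close>
  define Q where "Q = Q0 + smult (int b) P"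
  have Q_eq: "Q = Q0 + P * [:int b:]" by (simp add: Q_def)
  have not_dvd: "\<not> P dvd Q" unfolding Q_eq using Q0(1) by (simp only: dvd_add_left_iff dvd_triv_left not_False_eq_True)
  hence Qnz: "Q \<noteq> 0" by auto
  have deg_Q: "degree Q \<le> n * m"
    unfolding Q_def using Q0(2) nm(1) by (intro degree_add_le) (auto simp: d_def)
  have "poly (of_int_poly Q) \<kappa> = poly (of_int_poly Q0) \<kappa>"
    unfolding Q_eq by (simp only: of_int_poly_hom.hom_add of_int_poly_hom.hom_mult poly_add poly_mult P(2) mult_zero_left add_0_right)
  hence v_Q: "v (poly (of_int_poly Q) \<kappa>) \<le> inverse (real p ^ k)" using Q0(4) by simp
  have y_ge: "y Q \<ge> real (n * m) * (h - 1 / (2 * T)) - ln (real p)"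
  proof -
    have p0: "real p > 0" using prime_gt_0_nat[OF prime_p] by simp
    have "v (poly (of_int_poly Q) \<kappa>) > 0" by (rule v_int_poly_ge(1)[OF P not_dvd])
    hence "ln (v (poly (of_int_poly Q) \<kappa>)) \<le> ln (inverse (real p ^ k))" using v_Q by (intro ln_mono) auto
    also have "\<dots> = - (real k * ln (real p))" using p0 by (simp add: ln_inverse ln_realpow)
    finally have "y Q \<ge> real k * ln (real p)" by (simp add: y_def)
    moreover have "real k * ln (real p) \<ge> (X - 1) * ln (real p)" using k(2) lnp by (intro mult_right_mono) auto
    moreover have "(X - 1) * ln (real p) = real (n * m) * (h - 1 / (2 * T)) - ln (real p)"
      unfolding X_def left_diff_distrib using lnp by simp
    ultimately show ?thesis by linarith
  qed

  have y_fac: "y F \<le> A * real (degree F) + C * w F" if irr: "irreducible F" and dvd: "F dvd Q" for F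
  proof -
    have nd: "\<not> P dvd F" using not_dvd dvd dvd_trans by blast
    hence Fnz: "F \<noteq> 0" by auto
    show ?thesis
    proof (cases "w F > real (degree F) / T")
      case True
      hence deg_le: "real (degree F) \<le> T * w F" using T(1) by (simp add: divide_less_eq mult.commute)
      have "y F \<le> real (degree F) * (real d * ln 2 + L) + real d * w F" by (rule y_le[OF nd])
      also have "\<dots> \<le> (T * w F) * (real d * ln 2 + L) + real d * w F"
        using deg_le L0 by (intro add_right_mono mult_right_mono) auto
      also have "\<dots> = C * w F" unfolding C_def by (simp add: algebra_simps)
      also have "\<dots> \<le> A * real (degree F) + C * w F" using A by simp
      finally show ?thesis .
    next
      case False
      \<comment> \<open>A constant irreducible factor is at least 2 in absolute value, so its measure is too large.\<close>
      have deg: "degree F > 0"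
      proof (rule ccontr)
        assume "\<not> degree F > 0"
        then obtain a where a: "F = [:a:]" by (metis degree_eq_zeroE gr0I)
        have "\<bar>a\<bar> \<noteq> 1" using irr unfolding a by (auto simp: irreducible_def is_unit_const_poly_iff)
        moreover have "a \<noteq> 0" using Fnz a by auto
        ultimately have "\<bar>a\<bar> \<ge> 2" by linarith
        hence "\<bar>real_of_int a\<bar> > 1" by linarith
        hence "w F > 0" unfolding w_def a mahler_measure_const by (rule ln_gt_zero)
        with False show False unfolding a by simp
      qed
      have "\<not> real (degree F) \<le> T"
      proof
        assume le: "real (degree F) \<le> T"
        have "w F \<le> real (degree F) / T" using False by simp
        also have "\<dots> \<le> 1" using le T(1) by simp
        finally have "exp (w F) \<le> exp 1" by simp
        moreover have "exp (w F) = mahler_measure F"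
          unfolding w_def using mahler_measure_poly_ge_1[OF Fnz] by simp
        ultimately have "F \<in> \<F>" unfolding \<F>_def using irr deg nd le by simp
        with b(2) dvd show False unfolding Q_def by blast
      qed
      with bad[OF irr nd] False have "y F < A * real (degree F)" by blast
      moreover have "C * w F \<ge> 0" using C w0[OF Fnz] by simp
      ultimately show ?thesis by linarith
    qed
  qed
  have "y Q \<le> A * real (degree Q) + C * w Q"
    unfolding y_def w_def
    by (rule neg_ln_value_le_of_factors[OF P _ _ not_dvd])
       (use C y_fac in \<open>auto simp: y_def w_def\<close>)
  also have "\<dots> \<le> A * real (n * m) + C * (ln E + 2 * ln (real n))"
  proof (intro add_mono mult_left_mono)
    show "real (degree Q) \<le> real (n * m)" using deg_Q by (simp only: of_nat_le_iff)
    have "mahler_measure Q \<le> real (degree Q + 1) * (real n * (c' + real (card \<F>) * cP))"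
    proof (rule mahler_measure_le_height)
      fix i
      have "real_of_int \<bar>coeff Q i\<bar> \<le> real_of_int \<bar>coeff Q0 i\<bar> + real_of_int \<bar>int b * coeff P i\<bar>"
        unfolding Q_def coeff_add coeff_smult by linarith
      also have "real_of_int \<bar>int b * coeff P i\<bar> = real b * real_of_int \<bar>coeff P i\<bar>"
        by (simp add: abs_mult)
      also have "\<dots> \<le> real (card \<F>) * cP" using b(1) cP[of i] by (intro mult_mono) auto
      also have "real (card \<F>) * cP \<le> real n * (real (card \<F>) * cP)"
      proof -
        have "1 * (real (card \<F>) * cP) \<le> real n * (real (card \<F>) * cP)"
          using n(2) cP0 by (intro mult_right_mono mult_nonneg_nonneg) auto
        thus ?thesis by (simp only: mult_1)
      qed
      also have "real_of_int \<bar>coeff Q0 i\<bar> \<le> real n * c'"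
        using Q0(3)[of i] mult_left_mono[of c c' "real n"] by (simp add: c'_def)
      finally show "real_of_int \<bar>coeff Q i\<bar> \<le> real n * (c' + real (card \<F>) * cP)"
        by (simp add: distrib_left)
    qed
    also have "\<dots> \<le> (real (m + 1) * real n) * (real n * (c' + real (card \<F>) * cP + 1))"
    proof (intro mult_mono mult_left_mono)
      have "real (degree Q + 1) \<le> real (n * m + 1)" using deg_Q by (simp only: of_nat_le_iff)
      also have "\<dots> \<le> real (m + 1) * real n" using n(2) by (simp add: algebra_simps)
      finally show "real (degree Q + 1) \<le> real (m + 1) * real n" .
    qed (use cP0 in \<open>auto simp: c'_def\<close>)
    also have "\<dots> = E * real n ^ 2" unfolding E_def by (simp only: power2_eq_square mult_ac)
    finally have M_le: "mahler_measure Q \<le> E * real n ^ 2" .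
    have n0: "real n > 0" using n(2) by simp
    have "w Q \<le> ln (E * real n ^ 2)"
      unfolding w_def using M_le mahler_measure_poly_ge_1[OF Qnz] by (intro ln_mono) auto
    also have "\<dots> = ln E + 2 * ln (real n)" using E n0 by (simp add: ln_mult_pos ln_realpow)
    finally show "w Q \<le> ln E + 2 * ln (real n)" .
  qed (use A C in auto)
  finally have "real (n * m) * (h - 1 / (2 * T)) - ln (real p) \<le> A * real (n * m) + C * (ln E + 2 * ln (real n))"
    using y_ge by linarith
  moreover have "real (n * m) * (h - 1 / (2 * T)) - A * real (n * m) = (real m / (2 * T)) * real n"
    unfolding A_def using T(1) by (simp add: field_simps)
  moreover have "C * (ln E + 2 * ln (real n)) = C * ln E + (2 * C) * ln (real n)" by (simp add: algebra_simps)
  ultimately show False using main by linarith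
qed

end

section \<open>The sequence\<close>

lemma monic_irreducible_rat_poly_unique:
  fixes P Q :: "rat poly"
  assumes "P dvd Q" "Q dvd P" "lead_coeff P = 1" "lead_coeff Q = 1"
  shows "P = Q"
proof -
  have "normalize P = normalize Q" using assms by (intro normalization_semidom_class.associatedI)
  thus ?thesis using assms by (simp add: normalize_poly_def unit_factor_poly_def)
qed

lemma rat_minpoly:
  fixes x :: "'a :: field_char_0"
  assumes "algebraic x"
  shows "irreducible (rat_minpoly x)" and "rat_eval (rat_minpoly x) x = 0"
proof -
  obtain F :: "int poly" where F: "irreducible F" "lead_coeff F > 0" "poly (of_int_poly F) x = 0"
    using assms by (rule algebraic_imp_irreducible_int_poly)
  have deg: "degree F > 0" using F by (intro degree_pos_if_irreducible_root)
  define P where "P = smult (inverse (of_int (lead_coeff F))) (of_int_poly F :: rat poly)"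
  have Fnz: "F \<noteq> 0" using F(1) by auto
  have lc: "lead_coeff P = 1" unfolding P_def using Fnz by simp
  have irr: "irreducible P"
    unfolding P_def using irreducible_rat_poly_of_int[OF F(1) deg] Fnz by simp
  have root: "rat_eval P x = 0"
    unfolding P_def by (simp add: of_rat_hom.map_poly_hom_smult poly_of_rat_of_int_poly F(3))
  have "irreducible (rat_minpoly x) \<and> lead_coeff (rat_minpoly x) = 1 \<and> rat_eval (rat_minpoly x) x = 0"
    unfolding rat_minpoly_def
  proof (rule theI)
    show "irreducible P \<and> lead_coeff P = 1 \<and> rat_eval P x = 0" using irr lc root by blast
    fix Q :: "rat poly" assume Q: "irreducible Q \<and> lead_coeff Q = 1 \<and> rat_eval Q x = 0"
    show "Q = P"
      using Q irr lc root by (intro monic_irreducible_rat_poly_unique irreducible_rat_poly_dvd_if_common_root) auto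
  qed
  thus "irreducible (rat_minpoly x)" "rat_eval (rat_minpoly x) x = 0" by blast+
qed

lemma conjugates_imp_common_root:
  fixes x y :: "'a :: field_char_0"
  assumes "conjugates x y" and "poly (of_int_poly F) x = 0"
  shows "poly (of_int_poly F) y = 0"
proof -
  have eq: "algebraic x" "algebraic y" "rat_minpoly x = rat_minpoly y"
    using assms(1) unfolding conjugates_def by blast+
  have "rat_eval (of_int_poly F) x = 0" using assms(2) by (simp add: poly_of_rat_of_int_poly)
  hence "rat_minpoly x dvd of_int_poly F"
    by (rule irreducible_rat_poly_dvd_if_common_root[OF rat_minpoly[OF eq(1)]])
  then obtain G where "of_int_poly F = rat_minpoly y * G" unfolding eq(3) by (elim dvdE)
  hence "rat_eval (of_int_poly F) y = rat_eval (rat_minpoly y) y * rat_eval G y"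
    by (simp only: of_rat_poly_hom.hom_mult poly_mult)
  thus ?thesis using rat_minpoly(2)[OF eq(2)] by (simp add: poly_of_rat_of_int_poly)
qed

text \<open>
  The \<open>n\<close>-th member of the sequence is a root of a good polynomial for the parameter \<open>T n\<close>, which tends
  to infinity. The degrees exceed \<open>n\<close>, so no number occurs infinitely often.
\<close>

theorem theorem3:
  fixes p :: nat
    and Qp :: "'a :: {alg_closed_field, field_char_0} set"
    and v :: "'a \<Rightarrow> real"
    and \<kappa> :: 'a
    and d :: nat
  assumes "prime p"
    and "padic_closure p Qp v"
    and "algebraic \<kappa>"
    and "\<kappa> \<notin> roots_of_unity"
    and "v \<kappa> = 1"
    and "d = rat_degree (rat_adjoin \<kappa>)"
  shows "\<exists>\<alpha> :: nat \<Rightarrow> 'a.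
           (\<forall>n. algebraic (\<alpha> n)) \<and>
           strict_sequence \<alpha> \<and>
           (\<forall>n. \<not> conjugates (\<alpha> n) \<kappa>) \<and>
           (\<lambda>n. weil_height (\<alpha> n)) \<longlonglongrightarrow> 0 \<and>
           limsup (\<lambda>n. ereal (mean_log_dist v \<kappa> (\<alpha> n))) \<le> ereal (- weil_height \<kappa>) \<and>
           - weil_height \<kappa> < 0 \<and>
           liminf (\<lambda>n. ereal (mean_log_dist v \<kappa> (\<alpha> n))) \<ge> ereal (- (real d * (weil_height \<kappa> + ln 2)))"
proof -
  interpret padic_unit p v \<kappa>
    using assms padic_closure.absolute_value padic_closure.extends_padic_abs
    unfolding padic_unit_def by blast
  obtain P :: "int poly" where P: "irreducible P" "lead_coeff P > 0" "poly (of_int_poly P) \<kappa> = 0"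
    using assms(3) by (rule algebraic_imp_irreducible_int_poly)
  have deg: "degree P > 0" using P(1,3) by (rule degree_pos_if_irreducible_root)
  have Pnz: "P \<noteq> 0" using P by auto
  have minpoly: "int_minpoly \<kappa> = P" using P by (rule int_minpoly_eqI)
  have d: "d = degree P"
    unfolding assms(6) using rat_degree_rat_adjoin[OF irreducible_rat_poly_of_int[OF P(1) deg], of \<kappa>] P(3)
    by (simp add: poly_of_rat_of_int_poly)
  define h where "h = ln (mahler_measure P) / real (degree P)"
  have height: "weil_height \<kappa> = h"
    unfolding weil_height_def minpoly log_mahler_measure_eq[OF Pnz] h_def ..
  have "\<kappa> \<noteq> 0" using v_\<kappa> v_eq_0_iff[of \<kappa>] by auto
  hence "mahler_measure P \<noteq> 1" using kronecker_root_of_unity[OF Pnz P(3)] assms(4) by blast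
  with mahler_measure_poly_ge_1[OF Pnz] have h: "h > 0" unfolding h_def using deg by simp
  obtain T0 where T0: "1 / h < real T0" using reals_Archimedean2 by blast
  have "1 / h > 0" using h by simp
  with T0 have T0_pos: "real T0 > 0" by linarith
  define T where "T n = real n + real T0" for n
  have T: "T n > 0" "1 / T n < h" for n
  proof -
    show "T n > 0" unfolding T_def using T0_pos by simp
    have "1 / h < T n" unfolding T_def using T0 by simp
    thus "1 / T n < h" using h \<open>T n > 0\<close> by (simp add: divide_less_eq mult.commute)
  qed
  have "\<forall>n. \<exists>F. irreducible F \<and> lead_coeff F > 0 \<and> \<not> P dvd F \<and> real (degree F) > T n \<and>
    ln (mahler_measure F) \<le> real (degree F) / T n \<and>
    - ln (v (poly (of_int_poly F) \<kappa>)) \<ge> (h - 1 / T n) * real (degree F)"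
    unfolding h_def using ex_good_factor[OF P(1,3)] T unfolding h_def by blast
  from choice[OF this] obtain F where F: "\<And>n. irreducible (F n) \<and> lead_coeff (F n) > 0 \<and> \<not> P dvd F n \<and>
    real (degree (F n)) > T n \<and> ln (mahler_measure (F n)) \<le> real (degree (F n)) / T n \<and>
    - ln (v (poly (of_int_poly (F n)) \<kappa>)) \<ge> (h - 1 / T n) * real (degree (F n))" by blast
  have irr: "irreducible (F n)" and lc: "lead_coeff (F n) > 0" and nd: "\<not> P dvd F n"
    and deg_F: "real (degree (F n)) > T n" and M_F: "ln (mahler_measure (F n)) \<le> real (degree (F n)) / T n"
    and y_F: "- ln (v (poly (of_int_poly (F n)) \<kappa>)) \<ge> (h - 1 / T n) * real (degree (F n))" for n
    using F[of n] by blast+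
  have Fnz: "F n \<noteq> 0" for n using nd[of n] by auto
  have deg_F0: "real (degree (F n)) > 0" for n using deg_F[of n] T(1)[of n] by linarith
  have "\<exists>x :: 'a. poly (of_int_poly (F n)) x = 0" for n
  proof (rule alg_closed_imp_poly_has_root)
    show "degree (of_int_poly (F n) :: 'a poly) > 0" using deg_F0[of n] by simp
  qed
  hence "\<forall>n. \<exists>x :: 'a. poly (of_int_poly (F n)) x = 0" ..
  from choice[OF this] obtain \<alpha> :: "nat \<Rightarrow> 'a" where "\<forall>n. poly (of_int_poly (F n)) (\<alpha> n) = 0" ..
  hence \<alpha>: "poly (of_int_poly (F n)) (\<alpha> n) = 0" for n ..
  have minpoly_\<alpha>: "int_minpoly (\<alpha> n) = F n" for n
    using irr lc \<alpha> by (rule int_minpoly_eqI)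
  have algebraic_\<alpha>: "algebraic (\<alpha> n)" for n
    using Fnz[of n] \<alpha>[of n] by (intro algebraicI[of "of_int_poly (F n)"]) auto
  have value_nz: "poly (of_int_poly (F n)) \<kappa> \<noteq> 0" for n
  proof
    assume eq0: "poly (of_int_poly (F n)) \<kappa> = 0"
    have "v (poly (of_int_poly (F n)) \<kappa>) = 0" unfolding v_eq_0_iff by (rule eq0)
    with v_int_poly_ge(1)[OF P(1,3) nd[of n]] show False by (simp only: less_irrefl)
  qed
  have fin: "finite {n. \<alpha> n = \<beta>}" for \<beta>
  proof (rule finite_subset)
    show "{n. \<alpha> n = \<beta>} \<subseteq> {..<degree (int_minpoly \<beta>)}"
    proof
      fix n assume "n \<in> {n. \<alpha> n = \<beta>}"
      hence \<beta>: "\<beta> = \<alpha> n" by simp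
      have "real n < real (degree (F n))" using deg_F[of n] T0_pos unfolding T_def by linarith
      thus "n \<in> {..<degree (int_minpoly \<beta>)}" unfolding \<beta> minpoly_\<alpha> by simp
    qed
    show "finite {..<degree (int_minpoly \<beta>)}" by simp
  qed
  have strict: "strict_sequence \<alpha>"
    unfolding strict_sequence_def by (intro allI impI) (rule fin)
  have not_conj: "\<not> conjugates (\<alpha> n) \<kappa>" for n
  proof
    assume "conjugates (\<alpha> n) \<kappa>"
    hence "poly (of_int_poly (F n)) \<kappa> = 0" using \<alpha> by (rule conjugates_imp_common_root)
    with value_nz show False by (rule notE)
  qed
  have height_\<alpha>: "weil_height (\<alpha> n) = ln (mahler_measure (F n)) / real (degree (F n))" for n
    unfolding weil_height_def minpoly_\<alpha> log_mahler_measure_eq[OF Fnz] ..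
  have T_lim: "(\<lambda>n. 1 / T n) \<longlonglongrightarrow> 0" unfolding T_def by real_asymp
  have M1: "mahler_measure (F n) \<ge> 1" for n using Fnz by (rule mahler_measure_poly_ge_1)
  have height_le: "ln (mahler_measure (F n)) / real (degree (F n)) \<le> 1 / T n" for n
    using M_F[of n] deg_F0[of n] by (simp add: divide_le_eq)
  have height_lim: "(\<lambda>n. weil_height (\<alpha> n)) \<longlonglongrightarrow> 0"
  proof (rule tendsto_sandwich[OF _ _ tendsto_const T_lim])
    show "\<forall>\<^sub>F n in sequentially. 0 \<le> weil_height (\<alpha> n)" unfolding height_\<alpha> using M1 by simp
    show "\<forall>\<^sub>F n in sequentially. weil_height (\<alpha> n) \<le> 1 / T n" unfolding height_\<alpha> using height_le by simp
  qed
  define b where "b n = - ln (v (of_int (lead_coeff (F n))))" for n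
  have mean: "mean_log_dist v \<kappa> (\<alpha> n) =
      - (- ln (v (poly (of_int_poly (F n)) \<kappa>)) / real (degree (F n))) + b n / real (degree (F n))" for n
    unfolding mean_log_dist_eq[OF absolute_value_v irr lc \<alpha> value_nz] b_def
    by (simp add: diff_divide_distrib)
  have b0: "b n \<ge> 0" for n
  proof -
    have "v (of_int (lead_coeff (F n))) > 0" using lc[of n] by (intro v_pos) auto
    thus ?thesis unfolding b_def using v_of_int_le_1 by simp
  qed
  have b_le: "b n / real (degree (F n)) \<le> 1 / T n" for n
  proof -
    have lc0: "lead_coeff (F n) \<noteq> 0" "\<bar>real_of_int (lead_coeff (F n))\<bar> > 0" using lc[of n] by auto
    have "ln (1 / \<bar>real_of_int (lead_coeff (F n))\<bar>) \<le> ln (v (of_int (lead_coeff (F n))))"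
      using v_of_int_ge[OF lc0(1)] lc0(2) by (intro ln_mono) auto
    hence "b n \<le> ln \<bar>real_of_int (lead_coeff (F n))\<bar>" unfolding b_def using lc0(2) by (simp add: ln_div)
    also have "\<dots> \<le> ln (mahler_measure (F n))"
      using lc0(2) abs_lead_coeff_le_mahler_measure[of "F n"] by (intro ln_mono) auto
    finally have "b n / real (degree (F n)) \<le> ln (mahler_measure (F n)) / real (degree (F n))"
      using deg_F0[of n] by (intro divide_right_mono) auto
    with height_le[of n] show ?thesis by linarith
  qed
  have mean_le: "mean_log_dist v \<kappa> (\<alpha> n) \<le> - h + 2 * (1 / T n)" for n
  proof -
    have "h - 1 / T n \<le> - ln (v (poly (of_int_poly (F n)) \<kappa>)) / real (degree (F n))"
      using y_F[of n] by (simp only: pos_le_divide_eq[OF deg_F0])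
    with b_le[of n] show ?thesis unfolding mean by linarith
  qed
  have mean_ge: "mean_log_dist v \<kappa> (\<alpha> n) \<ge> - (real d * (h + ln 2)) - real d * (1 / T n)" for n
  proof -
    let ?n = "real (degree (F n))" and ?w = "ln (mahler_measure (F n))"
    have L: "ln (mahler_measure P) = real d * h" using deg by (simp add: h_def d)
    have "- ln (v (poly (of_int_poly (F n)) \<kappa>)) \<le> ?n * (real d * ln 2 + real d * h) + real d * ?w"
      using v_int_poly_ge(2)[OF P(1,3) nd[of n]] unfolding L d[symmetric] .
    hence "- ln (v (poly (of_int_poly (F n)) \<kappa>)) / ?n \<le> (?n * (real d * ln 2 + real d * h) + real d * ?w) / ?n"
      using deg_F0[of n] by (intro divide_right_mono) auto
    also have "\<dots> = real d * (h + ln 2) + real d * (?w / ?n)"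
      using deg_F0[of n] by (simp add: add_divide_distrib algebra_simps)
    also have "\<dots> \<le> real d * (h + ln 2) + real d * (1 / T n)"
      using height_le[of n] by (intro add_left_mono mult_left_mono) auto
    finally have "- ln (v (poly (of_int_poly (F n)) \<kappa>)) / ?n \<le> real d * (h + ln 2) + real d * (1 / T n)" .
    moreover have "b n / ?n \<ge> 0" using b0[of n] deg_F0[of n] by simp
    ultimately show ?thesis unfolding mean by linarith
  qed
  have "(\<lambda>n. ereal (- h + 2 * (1 / T n))) \<longlonglongrightarrow> ereal (- h + 2 * 0)"
    by (intro tendsto_ereal tendsto_intros T_lim)
  from lim_imp_Limsup[OF trivial_limit_sequentially this]
  have upper_lim: "limsup (\<lambda>n. ereal (- h + 2 * (1 / T n))) = ereal (- h)" by simp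
  have "limsup (\<lambda>n. ereal (mean_log_dist v \<kappa> (\<alpha> n))) \<le> limsup (\<lambda>n. ereal (- h + 2 * (1 / T n)))"
    by (intro Limsup_mono always_eventually allI) (simp only: ereal_less_eq(3) mean_le)
  hence upper: "limsup (\<lambda>n. ereal (mean_log_dist v \<kappa> (\<alpha> n))) \<le> ereal (- h)"
    by (simp only: upper_lim)
  have "(\<lambda>n. ereal (- (real d * (h + ln 2)) - real d * (1 / T n))) \<longlonglongrightarrow>
      ereal (- (real d * (h + ln 2)) - real d * 0)"
    by (intro tendsto_ereal tendsto_intros T_lim)
  from lim_imp_Liminf[OF trivial_limit_sequentially this]
  have lower_lim: "liminf (\<lambda>n. ereal (- (real d * (h + ln 2)) - real d * (1 / T n))) =
      ereal (- (real d * (h + ln 2)))" by (simp only: mult_zero_right diff_zero)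
  have "liminf (\<lambda>n. ereal (- (real d * (h + ln 2)) - real d * (1 / T n))) \<le>
      liminf (\<lambda>n. ereal (mean_log_dist v \<kappa> (\<alpha> n)))"
    by (intro Liminf_mono always_eventually allI) (simp only: ereal_less_eq(3) mean_ge)
  hence lower: "ereal (- (real d * (h + ln 2))) \<le> liminf (\<lambda>n. ereal (mean_log_dist v \<kappa> (\<alpha> n)))"
    by (simp only: lower_lim)
  have "- h < 0" using h by simp
  with algebraic_\<alpha> strict not_conj height_lim upper lower
  show ?thesis unfolding height by (intro exI[of _ \<alpha>] conjI allI)
qed

end
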